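(* Let $\Omega\subset\mathbb{R}^d$ be a convex polytope, $s\in(0,1)$, and let $\beta\le4$ satisfy $\beta>2s$ and $\beta,\beta-2s\notin\mathbb{N}_0$. Set $\bar\beta=\min\{\beta,2\}$. Let $f\in C^{\beta-2s}(\Omega)\cap L^\infty(\Omega)$ be such that $\|f\|^{(s)}_{\beta-2s,\Omega}<\infty$. Assume $\eta\in\mathcal{C}(\lambda,\Lambda)$ and that, if $\beta>k$ for some $k\in\mathbb{N}$, then $\eta\in C^k(\mathbb{S}^{d-1})$. Let $u\in\mathcal{S}^\beta(\Omega)$ solve $\mathcal{L}_\eta[u]=f$ in $\Omega$, $u=0$ in $\Omega^c$. Let $\mathscr{T}$ be a triangulation of $\Omega$ graded with parameters $h>0$, $\mu\ge1$, choose $$\bar\varepsilon(z)=\tfrac12 h_z^{1/2}\delta(z)^{1/2}\quad\text{for every interior vertex }z,$$ and let $u_h\in\mathbb{V}_h^0$ solve $\mathcal{L}_{\eta,\bar\varepsilon}[u_h](z)=f(z)$ for all interior vertices $z$. Then $$\|u-u_h\|_{L^\infty(\Omega)}\le C\max\big\{h^{\mu s},\,h^{\bar\beta-s},\,h^{\beta/2-s}\big\},$$ with $C$ independent of $h$.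
   Context: $\delta(x)=\operatorname{dist}(x,\partial\Omega)$, $\delta(x,y)=\min\{\delta(x),\delta(y)\}$, $\Omega^c=\mathbb{R}^d\setminus\overline\Omega$. Functions are extended by zero outside $\Omega$. Kernel class: for $0<\lambda\le\Lambda<\infty$, $\eta\in\mathcal{C}(\lambda,\Lambda)$ means $\eta:\mathbb{S}^{d-1}\to\mathbb{R}$, $\eta(\theta)=\eta(-\theta)$, and $\lambda\le\eta\le\Lambda$ a.e. Operators: $\mathcal{L}_\eta[w](x)=\mathrm{p.v.}\int_{\mathbb{R}^d}\frac{w(x)-w(y)}{|x-y|^{d+2s}}\eta\big(\frac{x-y}{|x-y|}\big)dy$. For $\varepsilon>0$, $\mathcal{L}_{\eta,\varepsilon}[w](x)=\frac12\int_{\mathbb{R}^d}(2w(x)-w(x-y)-w(x+y))\,\eta\big(\frac{y}{|y|}\big)\mathcal{K}_\varepsilon(|y|)dy$, where $\mathcal{K}_\varepsilon(r)=r^{-d-2s}$ for $r\ge\varepsilon$ and $\mathcal{K}_\varepsilon(r)=\varepsilon^{-d-2s}+\gamma(r^2-\varepsilon^2)+\nu(r^3-\varepsilon^3)$ for $r<\varepsilon$, with $\gamma=-\frac{(4+d)(d+2s)(3+d+2s)}{4(1-s)}\varepsilon^{-d-2s-2}$, $\nu=\frac{(5+d)(d+2s)(2+d+2s)}{6(1-s)}\varepsilon^{-d-2s-3}$. For a positive function $\bar\varepsilon$, $\mathcal{L}_{\eta,\bar\varepsilon}[w](z)=\mathcal{L}_{\eta,\bar\varepsilon(z)}[w](z)$.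 Function class: $w\in\mathcal{S}^\beta(\Omega)$ means $w\in C^\beta(\Omega)\cap C^{0,s}(\overline\Omega)$ and there is $M$ with $\|w\|_{C^\beta(\{x\in\Omega:\delta(x)\ge\rho\})}\le M\rho^{s-\beta}$ for all $\rho>0$ (for noninteger $\beta=k+\alpha$, $C^\beta=C^{k,\alpha}$; $C^\beta(\Omega)$ is understood locally, i.e. on $\overline U$ for all $U\Subset\Omega$). Weighted norm: for $b=k+\gamma'>0$ with $k\in\mathbb{N}_0$, $\gamma'\in(0,1]$, $$\|f\|^{(s)}_{b,\Omega}=\sup_{x\in\Omega}\delta(x)^s|f(x)|+\sum_{\ell=1}^k\sup_{x\in\Omega}\delta(x)^{\ell+s}|D^\ell f(x)|+\sup_{x\ne y\in\Omega}\delta(x,y)^{b+s}\frac{|D^kf(x)-D^kf(y)|}{|x-y|^{\gamma'}}.$$ Meshes: $\mathscr{T}$ belongs to a family of conforming, (uniformly) shape regular simplicial triangulations of $\Omega$ with closed elements $T$, $h_T=\operatorname{diam}T$. It is graded: for $h>0$ and fixed $\mu\ge1$, $h_T\approx h^\mu$ if $T\cap\partial\Omega\ne\emptyset$ and $h_T\approx h\operatorname{dist}(T,\partial\Omega)^{(\mu-1)/\mu}$ if $T\cap\partial\Omega=\emptyset$, with equivalence constants independent of $T$ and $h$. Interior vertices are the mesh vertices lying in $\Omega$; for such $z$, $h_z$ is the radius of the largest ball centered at $z$ contained in the patch $\omega_z=\bigcup\{T\in\mathscr{T}:z\in T\}$. $\mathbb{V}_h^0$ is the space of continuous functions on $\overline\Omega$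 that are affine on each $T\in\mathscr{T}$ and vanish on $\partial\Omega$. *)

theory Defs
  imports "HOL-Analysis.Analysis" "HOL-Probability.Essential_Supremum"
begin

section \<open>Derivatives and Hoelder norms\<close>

primrec iter_partial :: "'a::euclidean_space list \<Rightarrow> ('a \<Rightarrow> real) \<Rightarrow> 'a \<Rightarrow> real" where
  "iter_partial [] f = f"
| "iter_partial (b # bs) f = (\<lambda>x. frechet_derivative (iter_partial bs f) (at x) b)"

definition deriv_indices :: "nat \<Rightarrow> 'a::euclidean_space list set" where
  "deriv_indices l = {bs. set bs \<subseteq> Basis \<and> length bs = l}"

text \<open>\<open>D\<^sup>l f(x)\<close> is the tensor of all partial derivatives of order \<open>l\<close>; it is measured
  in the Euclidean (Frobenius) norm.\<close>

definition deriv_norm :: "nat \<Rightarrow> ('a::euclidean_space \<Rightarrow> real) \<Rightarrow> 'a \<Rightarrow> real" where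
  "deriv_norm l f x = L2_set (\<lambda>bs. iter_partial bs f x) (deriv_indices l)"

definition deriv_dist :: "nat \<Rightarrow> ('a::euclidean_space \<Rightarrow> real) \<Rightarrow> 'a \<Rightarrow> 'a \<Rightarrow> real" where
  "deriv_dist l f x y = L2_set (\<lambda>bs. iter_partial bs f x - iter_partial bs f y) (deriv_indices l)"

definition Ck_on :: "nat \<Rightarrow> 'a::euclidean_space set \<Rightarrow> ('a \<Rightarrow> real) \<Rightarrow> bool" where
  "Ck_on k U f \<longleftrightarrow>
     (\<forall>l<k. \<forall>bs\<in>deriv_indices l. \<forall>x\<in>U. iter_partial bs f differentiable (at x)) \<and>
     (\<forall>l\<le>k. \<forall>bs\<in>deriv_indices l. continuous_on U (iter_partial bs f))"

text \<open>\<open>C\<^sup>k\<close> on the unit sphere, as an embedded submanifold: a function is \<open>C\<^sup>k\<close> if it is the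
  restriction of a \<open>C\<^sup>k\<close> function defined on an open neighbourhood of the sphere.\<close>

definition Ck_sphere :: "nat \<Rightarrow> ('a::euclidean_space \<Rightarrow> real) \<Rightarrow> bool" where
  "Ck_sphere k \<eta> \<longleftrightarrow>
     (\<exists>U g. open U \<and> sphere 0 1 \<subseteq> U \<and> Ck_on k U g \<and> (\<forall>\<theta>\<in>sphere 0 1. g \<theta> = \<eta> \<theta>))"

text \<open>The decomposition \<open>b = hoelder_int b + hoelder_frac b\<close> with natural integer part and
  \<open>hoelder_frac b \<in> (0,1]\<close>, for \<open>b > 0\<close>; for noninteger \<open>b\<close> the integer part is the floor.\<close>

definition hoelder_int :: "real \<Rightarrow> nat" where
  "hoelder_int b = nat (\<lceil>b\<rceil> - 1)"

definition hoelder_frac :: "real \<Rightarrow> real" where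
  "hoelder_frac b = b - real (hoelder_int b)"

text \<open>The norm of \<open>C\<^sup>b(A)\<close>. Values are in \<^typ>\<open>ennreal\<close>, so that suprema may be infinite, and
  the supremum over the empty set is 0.\<close>

definition hoelder_norm :: "real \<Rightarrow> 'a::euclidean_space set \<Rightarrow> ('a \<Rightarrow> real) \<Rightarrow> ennreal" where
  "hoelder_norm b A f =
     (\<Sum>l\<le>hoelder_int b. SUP x\<in>A. ennreal (deriv_norm l f x)) +
     (SUP (x, y)\<in>{(x, y). x \<in> A \<and> y \<in> A \<and> x \<noteq> y}.
        ennreal (deriv_dist (hoelder_int b) f x y / norm (x - y) powr hoelder_frac b))"

text \<open>\<open>C\<^sup>b(\<Omega>)\<close> for open \<open>\<Omega>\<close> and noninteger \<open>b\<close>, understood locally.\<close>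

definition hoelder_loc :: "real \<Rightarrow> 'a::euclidean_space set \<Rightarrow> ('a \<Rightarrow> real) \<Rightarrow> bool" where
  "hoelder_loc b \<Omega> f \<longleftrightarrow> Ck_on (hoelder_int b) \<Omega> f \<and>
     (\<forall>U. open U \<and> compact (closure U) \<and> closure U \<subseteq> \<Omega> \<longrightarrow> hoelder_norm b (closure U) f < \<infinity>)"

definition bdist :: "'a::euclidean_space set \<Rightarrow> 'a \<Rightarrow> real" where
  "bdist \<Omega> x = infdist x (frontier \<Omega>)"

definition class_S :: "real \<Rightarrow> real \<Rightarrow> 'a::euclidean_space set \<Rightarrow> ('a \<Rightarrow> real) set" where
  "class_S s \<beta> \<Omega> = {w. hoelder_loc \<beta> \<Omega> w \<and> hoelder_norm s (closure \<Omega>) w < \<infinity> \<and>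
     (\<exists>M::real. \<forall>\<rho>>0. hoelder_norm \<beta> {x\<in>\<Omega>. bdist \<Omega> x \<ge> \<rho>} w \<le> ennreal (M * \<rho> powr (s - \<beta>)))}"

definition weighted_norm :: "real \<Rightarrow> real \<Rightarrow> 'a::euclidean_space set \<Rightarrow> ('a \<Rightarrow> real) \<Rightarrow> ennreal" where
  "weighted_norm s b \<Omega> f =
     (SUP x\<in>\<Omega>. ennreal (bdist \<Omega> x powr s * \<bar>f x\<bar>)) +
     (\<Sum>l=1..hoelder_int b. SUP x\<in>\<Omega>. ennreal (bdist \<Omega> x powr (real l + s) * deriv_norm l f x)) +
     (SUP (x, y)\<in>{(x, y). x \<in> \<Omega> \<and> y \<in> \<Omega> \<and> x \<noteq> y}.
        ennreal (min (bdist \<Omega> x) (bdist \<Omega> y) powr (b + s) *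
          (deriv_dist (hoelder_int b) f x y / norm (x - y) powr hoelder_frac b)))"

text \<open>The essential supremum in the library is \<open>\<top>\<close> for functions that are not measurable, so a
  finite value includes measurability.\<close>

definition Linf_norm :: "'a::euclidean_space set \<Rightarrow> ('a \<Rightarrow> real) \<Rightarrow> ennreal" where
  "Linf_norm \<Omega> f = esssup (restrict_space lebesgue \<Omega>) (\<lambda>x. ennreal \<bar>f x\<bar>)"


section \<open>Kernels and operators\<close>

text \<open>Surface measure on the unit sphere: \<open>\<sigma>(A) = d \<cdot> |{r \<theta>. 0 < r < 1, \<theta> \<in> A}|\<close>.
  Recall that \<open>sgn x = x / |x|\<close>.\<close>

definition sphere_measure :: "'a::euclidean_space measure" where
  "sphere_measure = scale_measure (of_nat DIM('a))
     (distr (restrict_space lborel (ball 0 1 - {0})) (restrict_space borel (sphere 0 1)) sgn)"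

definition kernel_class :: "real \<Rightarrow> real \<Rightarrow> ('a::euclidean_space \<Rightarrow> real) set" where
  "kernel_class lam Lam = {\<eta>. \<eta> \<in> borel_measurable (completion sphere_measure) \<and>
     (\<forall>\<theta>\<in>sphere 0 1. \<eta> \<theta> = \<eta> (- \<theta>)) \<and>
     (AE \<theta> in sphere_measure. lam \<le> \<eta> \<theta> \<and> \<eta> \<theta> \<le> Lam)}"

definition frac_integrand ::
  "('a::euclidean_space \<Rightarrow> real) \<Rightarrow> real \<Rightarrow> ('a \<Rightarrow> real) \<Rightarrow> 'a \<Rightarrow> 'a \<Rightarrow> real" where
  "frac_integrand \<eta> s w x y =
     (w x - w y) / norm (x - y) powr (real DIM('a) + 2 * s) * \<eta> (sgn (x - y))"

text \<open>\<open>has_frac_op \<eta> s w x l\<close>: the principal value defining \<open>\<L>\<^sub>\<eta>[w](x)\<close> exists and equals \<open>l\<close>.\<close>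

definition has_frac_op ::
  "('a::euclidean_space \<Rightarrow> real) \<Rightarrow> real \<Rightarrow> ('a \<Rightarrow> real) \<Rightarrow> 'a \<Rightarrow> real \<Rightarrow> bool" where
  "has_frac_op \<eta> s w x l \<longleftrightarrow>
     (\<forall>\<rho>>0. set_integrable lebesgue (- ball x \<rho>) (frac_integrand \<eta> s w x)) \<and>
     ((\<lambda>\<rho>. LINT y:(- ball x \<rho>)|lebesgue. frac_integrand \<eta> s w x y) \<longlongrightarrow> l) (at_right 0)"

definition kernel_gamma :: "real \<Rightarrow> real \<Rightarrow> real \<Rightarrow> real" where
  "kernel_gamma d s \<epsilon> =
     - ((4 + d) * (d + 2 * s) * (3 + d + 2 * s) / (4 * (1 - s))) * \<epsilon> powr (- d - 2 * s - 2)"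

definition kernel_nu :: "real \<Rightarrow> real \<Rightarrow> real \<Rightarrow> real" where
  "kernel_nu d s \<epsilon> =
     (5 + d) * (d + 2 * s) * (2 + d + 2 * s) / (6 * (1 - s)) * \<epsilon> powr (- d - 2 * s - 3)"

definition reg_kernel :: "real \<Rightarrow> real \<Rightarrow> real \<Rightarrow> real \<Rightarrow> real" where
  "reg_kernel d s \<epsilon> r =
     (if r \<ge> \<epsilon> then r powr (- d - 2 * s)
      else \<epsilon> powr (- d - 2 * s) + kernel_gamma d s \<epsilon> * (r\<^sup>2 - \<epsilon>\<^sup>2) + kernel_nu d s \<epsilon> * (r ^ 3 - \<epsilon> ^ 3))"

definition reg_op ::
  "('a::euclidean_space \<Rightarrow> real) \<Rightarrow> real \<Rightarrow> real \<Rightarrow> ('a \<Rightarrow> real) \<Rightarrow> 'a \<Rightarrow> real" where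
  "reg_op \<eta> s \<epsilon> w x = 1 / 2 * (LINT y|lebesgue.
     (2 * w x - w (x - y) - w (x + y)) * \<eta> (sgn y) * reg_kernel (real DIM('a)) s \<epsilon> (norm y))"


section \<open>Domain, meshes and finite element space\<close>

text \<open>The domain \<open>\<Omega>\<close> is open, whereas a \<^const>\<open>polytope\<close> is compact (and convex).\<close>

definition open_convex_polytope :: "'a::euclidean_space set \<Rightarrow> bool" where
  "open_convex_polytope \<Omega> \<longleftrightarrow> \<Omega> \<noteq> {} \<and> (\<exists>P. polytope P \<and> \<Omega> = interior P)"

text \<open>The library's \<^const>\<open>triangulation\<close> contains conformity, but allows simplices of any dimension.\<close>

definition mesh_of :: "'a::euclidean_space set \<Rightarrow> 'a set set \<Rightarrow> bool" where
  "mesh_of \<Omega> \<T> \<longleftrightarrow> triangulation \<T> \<and> (\<forall>T\<in>\<T>. int DIM('a) simplex T) \<and> \<Union>\<T> = closure \<Omega>"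

definition inball_diam :: "'a::euclidean_space set \<Rightarrow> real" where
  "inball_diam T = Sup {2 * r | r x. r \<ge> 0 \<and> cball x r \<subseteq> T}"

definition shape_regular :: "real \<Rightarrow> 'a::euclidean_space set set \<Rightarrow> bool" where
  "shape_regular \<sigma> \<T> \<longleftrightarrow> (\<forall>T\<in>\<T>. diameter T \<le> \<sigma> * inball_diam T)"

text \<open>\<open>h\<^sub>T \<approx> g\<close> is the two-sided bound with constant \<open>\<kappa>\<close>; it is to be used with \<open>\<kappa>\<close> fixed before
  the mesh and \<open>h\<close>, and likewise for \<open>\<sigma>\<close> in \<open>shape_regular\<close>.\<close>

definition graded :: "'a::euclidean_space set \<Rightarrow> real \<Rightarrow> real \<Rightarrow> real \<Rightarrow> 'a set set \<Rightarrow> bool" where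
  "graded \<Omega> \<kappa> \<mu> h \<T> \<longleftrightarrow> (\<forall>T\<in>\<T>.
     let g = (if T \<inter> frontier \<Omega> \<noteq> {} then h powr \<mu>
              else h * setdist T (frontier \<Omega>) powr ((\<mu> - 1) / \<mu>))
     in g \<le> \<kappa> * diameter T \<and> diameter T \<le> \<kappa> * g)"

definition interior_vertices :: "'a::euclidean_space set \<Rightarrow> 'a set set \<Rightarrow> 'a set" where
  "interior_vertices \<Omega> \<T> = {z\<in>\<Omega>. \<exists>T\<in>\<T>. z extreme_point_of T}"

definition patch :: "'a set set \<Rightarrow> 'a \<Rightarrow> 'a set" where
  "patch \<T> z = \<Union>{T\<in>\<T>. z \<in> T}"

definition vertex_size :: "'a::euclidean_space set set \<Rightarrow> 'a \<Rightarrow> real" where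
  "vertex_size \<T> z = Sup {r. r \<ge> 0 \<and> cball z r \<subseteq> patch \<T> z}"

text \<open>Elements of \<open>\<V>\<^sub>h\<^sup>0\<close> are extended by zero outside \<open>\<Omega>\<close>.\<close>

definition fe_space :: "'a::euclidean_space set \<Rightarrow> 'a set set \<Rightarrow> ('a \<Rightarrow> real) set" where
  "fe_space \<Omega> \<T> = {v. continuous_on (closure \<Omega>) v \<and>
     (\<forall>T\<in>\<T>. \<exists>a c. \<forall>x\<in>T. v x = a \<bullet> x + c) \<and> (\<forall>x. x \<notin> \<Omega> \<longrightarrow> v x = 0)}"

definition eps_bar :: "'a::euclidean_space set \<Rightarrow> 'a set set \<Rightarrow> 'a \<Rightarrow> real" where
  "eps_bar \<Omega> \<T> z = 1 / 2 * vertex_size \<T> z powr (1 / 2) * bdist \<Omega> z powr (1 / 2)"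

end

theory Submission
  imports Defs
begin

text \<open>
  Let \<open>e\<close> be the difference between the Lagrange interpolant of \<open>u\<close> and \<open>uh\<close>. At a vertex \<open>z\<close> where
  \<open>e\<close> attains a positive maximum, the part of the integral over the complement of \<open>\<Omega>\<close>, which
  contains a ball of radius \<open>\<delta>(z)\<close> at distance \<open>\<delta>(z)\<close> from \<open>z\<close> by convexity, shows that the
  regularised operator applied to \<open>e\<close> is at least a multiple of \<open>\<delta>(z)\<^sup>-\<^sup>2\<^sup>s e(z)\<close>. So it suffices to
  bound the residual of the interpolant at the vertices by the rate times \<open>\<delta>(z)\<^sup>-\<^sup>2\<^sup>s\<close>.

  The residual consists of a consistency error and of the operator applied to the interpolation
  error. For the former, the regularised kernel has the second moment of the singular one, so the
  Hessian of \<open>u\<close> drops out and only a Taylor remainder of order \<open>\<beta>\<close> is left. The latter is bounded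
  pointwise, near \<open>z\<close> and globally. Both use the weighted Hoelder bounds and \<open>u = 0\<close> on the boundary,
  which is forced by the growth condition on \<open>f\<close>: a nonzero boundary value of \<open>u\<close> would make \<open>f\<close> grow
  like \<open>\<delta>\<^sup>-\<^sup>2\<^sup>s\<close>.

  The mesh enters through \<open>\<delta>(z) \<ge> c h\<^sup>\<mu>\<close> and \<open>h\<^sub>z \<approx> h \<delta>(z)\<^bsup>1 - 1/\<mu>\<^esup>\<close> at the interior vertices, which hold
  because the ball around \<open>z\<close> whose radius is the smallest inball diameter of the elements at \<open>z\<close> is
  contained in the patch of \<open>z\<close>.
\<close>

section \<open>Convex domains and simplices\<close>

text \<open>The form of \<open>eps_bar\<close> balances two opposite demands. Up to constants, the
  consistency error at z is \<epsilon>^(\<beta> - 2s) \<delta>^(s - \<beta>), small for small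
  \<epsilon>, while the interpolation error is multiplied by the mass \<epsilon>^(-2s) of the
  kernel. With \<epsilon>^2 = h_z \<delta> / 4 the former becomes h_z^(\<beta>/2 - s)
  \<delta>^(-\<beta>/2), the source of the rate h^(\<beta>/2 - s), and the latter carries the factor
  \<delta>^(-2s) (\<delta> / h_z)^s. The excess (\<delta> / h_z)^s is the obstacle: the global bound
  on the interpolation error does not absorb it. Hence the separate bound on the ball of radius
  \<delta>/2, better by just the factor (h_z / \<delta>)^s; outside that ball the kernel has mass of
  order \<delta>^(-2s) only.

  The remaining powers have the form h^p D^(s - p/\<mu>), with p = \<beta>/2 - s or p = min(\<beta>,
  2) - s and D a distance to the boundary. They are of order h^p if the exponent of D is
  nonnegative, and of order h^(\<mu> s) otherwise, which is also the error on the elements at the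
  boundary. This explains the three rates.\<close>

lemma bdist_pos:
  assumes "open \<Omega>" "bounded \<Omega>" "x \<in> \<Omega>"
  shows "bdist \<Omega> x > 0"
proof -
  have ne: "frontier \<Omega> \<noteq> {}"
    using assms frontier_eq_empty[of \<Omega>] not_bounded_UNIV by auto
  have "x \<notin> frontier \<Omega>" using assms by (simp add: frontier_def interior_open)
  then show ?thesis unfolding bdist_def using ne infdist_pos_not_in_closed[of "frontier \<Omega>" x] by simp
qed

lemma bdist_nonneg [simp]: "bdist \<Omega> x \<ge> 0"
  by (simp add: bdist_def infdist_nonneg)

lemma bdist_lipschitz: "\<bar>bdist \<Omega> x - bdist \<Omega> y\<bar> \<le> norm (x - y)"
  unfolding bdist_def using infdist_triangle_abs[of x "frontier \<Omega>" y] by (simp add: dist_norm)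

lemma bdist_le: "q \<in> frontier \<Omega> \<Longrightarrow> bdist \<Omega> x \<le> norm (x - q)"
  unfolding bdist_def using infdist_le[of q "frontier \<Omega>" x] by (simp add: dist_norm)

lemma bdist_attained:
  fixes \<Omega> :: "'a::euclidean_space set"
  assumes "bounded \<Omega>" "\<Omega> \<noteq> {}"
  obtains q where "q \<in> frontier \<Omega>" "bdist \<Omega> x = norm (x - q)"
proof -
  have ne: "frontier \<Omega> \<noteq> {}"
    using assms frontier_eq_empty[of \<Omega>] not_bounded_UNIV by auto
  obtain q where "q \<in> frontier \<Omega>" "infdist x (frontier \<Omega>) = dist x q"
    using infdist_attains_inf[OF frontier_closed ne] by blast
  then show ?thesis using that by (simp add: bdist_def dist_norm)
qed

text \<open>A ball is connected, so one that met both \<open>\<Omega>\<close> and its complement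
  would contain a boundary point closer to \<open>x\<close> than the distance allows.\<close>

lemma ball_bdist_subset:
  fixes \<Omega> :: "'a::euclidean_space set"
  assumes "x \<in> \<Omega>"
  shows "ball x (bdist \<Omega> x) \<subseteq> \<Omega>"
proof (rule ccontr)
  assume "\<not> ?thesis"
  then obtain y where y: "y \<in> ball x (bdist \<Omega> x)" "y \<notin> \<Omega>" by blast
  then have "bdist \<Omega> x > 0" by (simp add: order.strict_trans1[OF zero_le_dist])
  then have "ball x (bdist \<Omega> x) \<inter> frontier \<Omega> \<noteq> {}"
    using y assms by (intro connected_Int_frontier) (auto simp: disjoint_iff intro: exI[of _ x])
  then obtain q where q: "q \<in> frontier \<Omega>" "norm (x - q) < bdist \<Omega> x"
    by (auto simp: dist_norm)
  show False using bdist_le[OF q(1), of x] q(2) by simp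
qed

lemma supporting_direction:
  fixes \<Omega> :: "'a::euclidean_space set"
  assumes "open \<Omega>" "convex \<Omega>" "q \<in> frontier \<Omega>"
  obtains a where "norm a = 1" "\<And>y. y \<in> closure \<Omega> \<Longrightarrow> a \<bullet> y \<le> a \<bullet> q"
proof -
  have "q \<in> closure \<Omega>" "q \<notin> rel_interior \<Omega>"
    using assms rel_interior_open[OF assms(1)] by (auto simp: frontier_def interior_open)
  then obtain a where a: "a \<noteq> 0" "\<And>y. y \<in> closure \<Omega> \<Longrightarrow> a \<bullet> q \<le> a \<bullet> y"
    using supporting_hyperplane_relative_frontier[OF assms(2)] by metis
  show ?thesis
  proof (rule that[of "- (a /\<^sub>R norm a)"])
    show "norm (- (a /\<^sub>R norm a)) = 1" using a(1) by simp
    fix y assume "y \<in> closure \<Omega>"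
    then show "- (a /\<^sub>R norm a) \<bullet> y \<le> - (a /\<^sub>R norm a) \<bullet> q"
      using a by (simp add: inner_minus_left mult_left_mono)
  qed
qed

lemma strictly_inside:
  fixes \<Omega> :: "'a::euclidean_space set"
  assumes "open \<Omega>" "z \<in> \<Omega>" "norm a = 1" "\<And>y. y \<in> closure \<Omega> \<Longrightarrow> a \<bullet> y \<le> b"
  shows "a \<bullet> z < b"
proof -
  obtain e where e: "e > 0" "cball z e \<subseteq> \<Omega>" using assms(1,2) open_contains_cball by blast
  have "z + e *\<^sub>R a \<in> \<Omega>" using e assms(3) by (auto simp: dist_norm subset_iff)
  then have "a \<bullet> (z + e *\<^sub>R a) \<le> b" using assms(4) closure_subset by blast
  moreover have "a \<bullet> a = 1" using assms(3) by (simp add: dot_square_norm)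
  ultimately show ?thesis using e(1) by (simp add: inner_add_right)
qed

text \<open>The distance to the boundary of a convex domain is concave; \<open>- a\<close> is a
  supergradient at \<open>x\<close>, with \<open>a\<close> the outward normal at a nearest boundary
  point. It serves twice: to place a ball in the exterior, and to show that the distance is minimal
  over an element at one of its vertices.\<close>

lemma bdist_direction:
  fixes \<Omega> :: "'a::euclidean_space set"
  assumes "open \<Omega>" "convex \<Omega>" "bounded \<Omega>" "x \<in> \<Omega>"
  obtains a where "norm a = 1" "\<And>y. y \<in> closure \<Omega> \<Longrightarrow> bdist \<Omega> y \<le> bdist \<Omega> x - a \<bullet> (y - x)"
proof -
  let ?d = "bdist \<Omega> x"
  have d: "?d > 0" using assms bdist_pos by blast
  obtain q where q: "q \<in> frontier \<Omega>" "?d = norm (x - q)"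
    using bdist_attained[of \<Omega> x] assms by blast
  obtain a where a: "norm a = 1" "\<And>y. y \<in> closure \<Omega> \<Longrightarrow> a \<bullet> y \<le> a \<bullet> q"
    using supporting_direction[OF assms(1,2) q(1)] by blast
  have aa: "a \<bullet> a = 1" using a(1) by (simp add: dot_square_norm)
  text \<open>The ball of radius \<open>?d\<close> around \<open>x\<close> lies in \<open>\<Omega>\<close> and touches the supporting hyperplane at
    \<open>q\<close>, so the hyperplane is at distance exactly \<open>?d\<close> from \<open>x\<close>.\<close>
  have "x + ?d *\<^sub>R a \<in> closure \<Omega>"
  proof -
    have "cball x ?d \<subseteq> closure \<Omega>"
      using ball_bdist_subset[OF assms(4)] d closure_ball[of ?d x] closure_mono by blast
    then show ?thesis using a(1) d by (auto simp: dist_norm subset_iff)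
  qed
  then have "a \<bullet> (x + ?d *\<^sub>R a) \<le> a \<bullet> q" by (rule a(2))
  then have 1: "?d \<le> a \<bullet> (q - x)" using aa by (simp add: inner_add_right inner_diff_right)
  have "a \<bullet> (q - x) \<le> norm a * norm (q - x)" by (rule norm_cauchy_schwarz)
  then have 2: "a \<bullet> (q - x) = ?d" using 1 q(2) a(1) by (simp add: norm_minus_commute)
  show ?thesis
  proof (rule that[OF a(1)])
    fix y assume y: "y \<in> closure \<Omega>"
    let ?r = "a \<bullet> (q - y)"
    have r: "?r \<ge> 0" using a(2)[OF y] by (simp add: inner_diff_right)
    \<comment> \<open>The projection of \<open>y\<close> onto the supporting hyperplane. It lies
      outside \<open>\<Omega>\<close>, so the segment from \<open>y\<close> to it meets the
      frontier.\<close>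
    let ?p = "y + ?r *\<^sub>R a"
    have "a \<bullet> ?p = a \<bullet> q" using aa by (simp add: inner_add_right inner_diff_right)
    then have "?p \<notin> \<Omega>" using strictly_inside[OF assms(1) _ a] by force
    have "closed_segment y ?p \<inter> frontier \<Omega> \<noteq> {}"
    proof (cases "y \<in> \<Omega>")
      case True
      then show ?thesis using \<open>?p \<notin> \<Omega>\<close> by (intro connected_Int_frontier) auto
    next
      case False
      then have "y \<in> frontier \<Omega>" using y assms(1) by (simp add: frontier_def interior_open)
      then show ?thesis by auto
    qed
    then obtain p where p: "p \<in> closed_segment y ?p" "p \<in> frontier \<Omega>" by auto
    have "bdist \<Omega> y \<le> norm (y - p)" using bdist_le[OF p(2)] .
    also have "\<dots> \<le> norm (y - ?p)"
      using segment_bound1[OF p(1)] by (simp add: norm_minus_commute)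
    also have "\<dots> = ?r" using a(1) r by simp
    also have "\<dots> = ?d - a \<bullet> (y - x)" using 2 by (simp add: inner_diff_right)
    finally show "bdist \<Omega> y \<le> ?d - a \<bullet> (y - x)" .
  qed
qed

section \<open>Affine functions on simplices and the size of inscribed balls\<close>

lemma affine_interpolation:
  fixes v :: "'a::euclidean_space \<Rightarrow> real"
  assumes "\<not> affine_dependent C"
  shows "\<exists>a b. \<forall>c\<in>C. a \<bullet> c + b = v c"
proof (cases "C = {}")
  case False
  then obtain c0 where c0: "c0 \<in> C" by auto
  \<comment> \<open>Affine independence is linear independence of the differences from one point
    \<open>c0\<close>; the gradient of the linear extension is \<open>adjoint g 1\<close>.\<close>
  have "independent ((\<lambda>x. - c0 + x) ` (C - {c0}))"
    using assms c0 affine_dependent_iff_dependent2 by blast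
  from linear_independent_extend[OF this, of "\<lambda>y. v (y + c0) - v c0"]
  obtain g where g: "linear g" "\<forall>y\<in>(\<lambda>x. - c0 + x) ` (C - {c0}). g y = v (y + c0) - v c0" by blast
  have ga: "g x = adjoint g 1 \<bullet> x" for x using adjoint_works[OF g(1), of x 1]
    by (simp add: inner_commute)
  have "adjoint g 1 \<bullet> c + (v c0 - adjoint g 1 \<bullet> c0) = v c" if "c \<in> C" for c
  proof (cases "c = c0")
    case False
    then have "g (- c0 + c) = v c - v c0" using g(2) that by auto
    then show ?thesis using ga[of "- c0 + c"] by (simp add: inner_diff_right)
  qed simp
  then show ?thesis by blast
qed simp

text \<open>By Krein-Milman: the half-space where the bound holds is convex and contains the extreme
  points, hence their hull.\<close>

lemma affine_le_on_extreme:
  fixes S :: "'a::euclidean_space set"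
  assumes "compact S" "convex S" "\<And>c. c extreme_point_of S \<Longrightarrow> a \<bullet> c + b \<le> M" "x \<in> S"
  shows "a \<bullet> x + b \<le> M"
proof -
  have "S = convex hull {c. c extreme_point_of S}"
    using Krein_Milman_Minkowski[OF assms(1,2)] .
  also have "\<dots> \<subseteq> {x. a \<bullet> x \<le> M - b}"
  proof (intro hull_minimal)
    show "{c. c extreme_point_of S} \<subseteq> {x. a \<bullet> x \<le> M - b}" using assms(3) by fastforce
  qed (rule convex_halfspace_le)
  finally show ?thesis using assms(4) by auto
qed

lemma affine_ge_on_extreme:
  fixes S :: "'a::euclidean_space set"
  assumes "compact S" "convex S" "\<And>c. c extreme_point_of S \<Longrightarrow> M \<le> a \<bullet> c + b" "x \<in> S"
  shows "M \<le> a \<bullet> x + b"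
  using affine_le_on_extreme[OF assms(1,2), of "-a" "-b" "-M" x] assms(3,4)
  by (force simp: inner_minus_left)

lemma affine_eq_on_extreme:
  fixes S :: "'a::euclidean_space set"
  assumes "compact S" "convex S" "\<And>c. c extreme_point_of S \<Longrightarrow> a \<bullet> c + b = a' \<bullet> c + b'" "x \<in> S"
  shows "a \<bullet> x + b = a' \<bullet> x + b'"
proof -
  have "(a - a') \<bullet> x + (b - b') \<le> 0"
    by (rule affine_le_on_extreme[OF assms(1,2) _ assms(4)]) (simp add: inner_diff_left, smt (verit) assms(3))
  moreover have "0 \<le> (a - a') \<bullet> x + (b - b')"
    by (rule affine_ge_on_extreme[OF assms(1,2) _ assms(4)]) (simp add: inner_diff_left, smt (verit) assms(3))
  ultimately show ?thesis by (simp add: inner_diff_left)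
qed

lemma simplexD:
  assumes "n simplex T"
  obtains C where "\<not> affine_dependent C" "finite C" "T = convex hull C"
    "\<And>c. c extreme_point_of T \<longleftrightarrow> c \<in> C" "compact T" "convex T" "closed T"
proof -
  obtain C where C: "\<not> affine_dependent C" "T = convex hull C"
    using assms unfolding simplex_def by blast
  have f: "finite C" using C(1) aff_independent_finite by blast
  show ?thesis
    using that[OF C(1) f C(2)] extreme_point_of_convex_hull_affine_independent[OF C(1)] C(2) f
      finite_imp_compact_convex_hull compact_imp_closed by auto
qed

lemma inball_diam_bdd:
  fixes T :: "'a::euclidean_space set"
  assumes "bounded T"
  shows "bdd_above {2 * r | r x. r \<ge> 0 \<and> cball x r \<subseteq> T}"
proof (rule bdd_aboveI[of _ "diameter T"])
  fix e assume "e \<in> {2 * r | r x. r \<ge> 0 \<and> cball x r \<subseteq> T}"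
  then obtain r x where r: "e = 2 * r" "r \<ge> 0" "cball x r \<subseteq> T" by auto
  have "diameter (cball x r) \<le> diameter T" by (rule diameter_subset[OF r(3) assms])
  then show "e \<le> diameter T" using r by simp
qed

lemma inball_diam_nonneg:
  fixes T :: "'a::euclidean_space set"
  assumes "bounded T" "T \<noteq> {}"
  shows "inball_diam T \<ge> 0"
proof -
  obtain x where "x \<in> T" using assms by auto
  then have "0 \<in> {2 * r | r x. r \<ge> 0 \<and> cball x r \<subseteq> T}" by (auto intro!: exI[of _ x])
  then show ?thesis unfolding inball_diam_def by (rule cSup_upper[OF _ inball_diam_bdd[OF assms(1)]])
qed

text \<open>The barycentric coordinate of \<open>z\<close> varies by at most 1 over an inscribed ball, and by exactly
  1 between \<open>z\<close> and \<open>p\<close>.\<close>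

lemma inball_le_dist_opposite_face:
  fixes T :: "'a::euclidean_space set"
  assumes T: "n simplex T" and z: "z extreme_point_of T" and F: "F face_of T" "z \<notin> F" "p \<in> F"
  shows "inball_diam T \<le> norm (p - z)"
proof -
  obtain C where C: "\<not> affine_dependent C" "finite C" "T = convex hull C"
    "\<And>c. c extreme_point_of T \<longleftrightarrow> c \<in> C" "compact T" "convex T" "closed T"
    using simplexD[OF T] by blast
  obtain a b where ab: "\<forall>c\<in>C. a \<bullet> c + b = (if c = z then 1 else 0)"
    using affine_interpolation[OF C(1), of "\<lambda>c. if c = z then 1 else 0"] by blast
  have zC: "z \<in> C" using z C(4) by blast
  have cF: "compact F" "convex F"
    using F(1) C(5,6) face_of_imp_compact face_of_imp_convex by blast+
  have ext: "c \<in> C \<and> c \<noteq> z" if "c extreme_point_of F" for c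
    using that F extreme_point_of_face[OF F(1)] C(4) by blast
  have "a \<bullet> p + b = 0 \<bullet> p + 0"
    using ext ab by (intro affine_eq_on_extreme[OF cF _ F(3)]) auto
  moreover have "a \<bullet> z + b = 1" using ab zC by auto
  ultimately have "a \<bullet> (z - p) = 1" by (simp add: inner_diff_right)
  then have 1: "1 \<le> norm a * norm (p - z)"
    using norm_cauchy_schwarz[of a "z - p"] by (simp add: norm_minus_commute)
  then have a0: "norm a > 0" by (cases "norm a = 0") auto
  have rng: "0 \<le> a \<bullet> x + b" "a \<bullet> x + b \<le> 1" if "x \<in> T" for x
    using affine_ge_on_extreme[OF C(5,6) _ that, of 0 a b]
      affine_le_on_extreme[OF C(5,6) _ that, of a b 1] ab C(4) by auto
  have "e \<le> 1 / norm a" if e: "e \<in> {2 * r | r x. r \<ge> 0 \<and> cball x r \<subseteq> T}" for e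
  proof -
    obtain r x where r: "e = 2 * r" "r \<ge> 0" "cball x r \<subseteq> T" using e by auto
    \<comment> \<open>The radius of the inscribed ball in the direction of the gradient, along which
      the coordinate changes fastest.\<close>
    let ?w = "(r / norm a) *\<^sub>R a"
    have "x + ?w \<in> T" "x - ?w \<in> T" using r a0 by (auto simp: dist_norm subset_iff)
    then have "a \<bullet> (x + ?w) + b - (a \<bullet> (x - ?w) + b) \<le> 1" using rng by (smt (verit))
    then have "2 * (a \<bullet> ?w) \<le> 1" by (simp add: inner_add_right inner_diff_right)
    moreover have "a \<bullet> ?w = r * norm a" using a0 by (simp add: dot_square_norm power2_eq_square)
    ultimately have "2 * (r * norm a) \<le> 1" by (simp only:)
    then show ?thesis using r(1) a0 by (simp add: pos_le_divide_eq mult.assoc)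
  qed
  moreover have "{2 * r | r x. r \<ge> 0 \<and> cball x r \<subseteq> T} \<noteq> {}"
    using zC C(3) hull_subset[of C convex] by (auto intro!: exI[of _ 0] exI[of _ z])
  ultimately have "inball_diam T \<le> 1 / norm a" unfolding inball_diam_def by (intro cSup_least)
  also have "\<dots> \<le> norm (p - z)" using 1 a0 by (simp add: field_simps)
  finally show ?thesis .
qed

section \<open>Meshes of a convex domain\<close>

locale domain_mesh =
  fixes \<Omega> :: "'a::euclidean_space set" and \<T> :: "'a set set"
  assumes open_dom: "open \<Omega>" and convex_dom: "convex \<Omega>" and bounded_dom: "bounded \<Omega>"
    and nonempty_dom: "\<Omega> \<noteq> {}" and mesh: "mesh_of \<Omega> \<T>"
begin

lemma finite_mesh: "finite \<T>"
  using mesh by (simp add: mesh_of_def triangulation_def)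

lemma simplex_elem: "T \<in> \<T> \<Longrightarrow> int DIM('a) simplex T"
  using mesh by (simp add: mesh_of_def)

lemma Union_mesh: "\<Union>\<T> = closure \<Omega>"
  using mesh by (simp add: mesh_of_def)

lemma face_Int: "T \<in> \<T> \<Longrightarrow> T' \<in> \<T> \<Longrightarrow> T \<inter> T' face_of T"
  using mesh by (simp add: mesh_of_def triangulation_def)

lemma elem_subset: "T \<in> \<T> \<Longrightarrow> T \<subseteq> closure \<Omega>"
  using Union_mesh by auto

lemma compact_elem: "T \<in> \<T> \<Longrightarrow> compact T" and convex_elem: "T \<in> \<T> \<Longrightarrow> convex T"
  and closed_elem: "T \<in> \<T> \<Longrightarrow> closed T" and bounded_elem: "T \<in> \<T> \<Longrightarrow> bounded T"
proof -
  show c: "compact T" if "T \<in> \<T>" using simplexD[OF simplex_elem[OF that]] by blast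
  show "convex T" if "T \<in> \<T>" using simplexD[OF simplex_elem[OF that]] by blast
  show "closed T" if "T \<in> \<T>" using c[OF that] by (rule compact_imp_closed)
  show "bounded T" if "T \<in> \<T>" using c[OF that] by (rule compact_imp_bounded)
qed

lemma frontier_dom: "frontier \<Omega> = closure \<Omega> - \<Omega>"
  using open_dom by (simp add: frontier_def interior_open)

lemma interior_closure_dom: "interior (closure \<Omega>) = \<Omega>"
  using convex_interior_closure[OF convex_dom] open_dom by (simp add: interior_open)

text \<open>Conformity excludes hanging nodes: the intersection is a face of \<open>T'\<close>, and
  extreme points of a face are extreme points of the whole.\<close>

lemma extreme_point_of_adjacent:
  assumes "T \<in> \<T>" "T' \<in> \<T>" "z extreme_point_of T" "z \<in> T'"
  shows "z extreme_point_of T'"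
proof -
  have "z \<in> T" using assms(3) by (simp add: extreme_point_of_def)
  have "z extreme_point_of (T' \<inter> T)"
    using assms(3) \<open>z \<in> T\<close> assms(4) by (auto simp: extreme_point_of_def)
  then show ?thesis using extreme_point_of_face[OF face_Int[OF assms(2,1)]] by blast
qed

lemma interior_vertexD:
  assumes "z \<in> interior_vertices \<Omega> \<T>"
  shows "z \<in> \<Omega>" "\<exists>T\<in>\<T>. z \<in> T" "T \<in> \<T> \<Longrightarrow> z \<in> T \<Longrightarrow> z extreme_point_of T"
proof -
  obtain T0 where T0: "z \<in> \<Omega>" "T0 \<in> \<T>" "z extreme_point_of T0"
    using assms unfolding interior_vertices_def by blast
  show "z \<in> \<Omega>" by fact
  show "\<exists>T\<in>\<T>. z \<in> T" using T0(2,3) unfolding extreme_point_of_def by blast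
  show "z extreme_point_of T" if "T \<in> \<T>" "z \<in> T"
    using extreme_point_of_adjacent[OF T0(2) that(1) T0(3) that(2)] .
qed

lemma extreme_point_cases:
  assumes "T \<in> \<T>" "c extreme_point_of T"
  shows "c \<in> interior_vertices \<Omega> \<T> \<or> c \<in> frontier \<Omega>"
proof -
  have "c \<in> closure \<Omega>" using assms elem_subset by (auto simp: extreme_point_of_def)
  then show ?thesis using assms frontier_dom by (auto simp: interior_vertices_def)
qed

text \<open>A supporting hyperplane of \<open>\<Omega>\<close> at \<open>p\<close> also supports
  \<open>T\<close> and therefore cuts out a face; the open set \<open>\<Omega>\<close> does not meet
  the hyperplane. This is how convexity links the boundary of the domain to the faces of the
  mesh.\<close>

lemma frontier_face:
  assumes "T \<in> \<T>" "p \<in> T" "p \<in> frontier \<Omega>"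
  obtains F where "F face_of T" "p \<in> F" "F \<subseteq> frontier \<Omega>"
proof -
  obtain a where a: "norm a = 1" "\<And>y. y \<in> closure \<Omega> \<Longrightarrow> a \<bullet> y \<le> a \<bullet> p"
    using supporting_direction[OF open_dom convex_dom assms(3)] by blast
  show ?thesis
  proof (rule that)
    show "T \<inter> {x. a \<bullet> x = a \<bullet> p} face_of T"
      using face_of_Int_supporting_hyperplane_le[OF convex_elem[OF assms(1)]] a(2) elem_subset[OF assms(1)]
      by blast
    show "p \<in> T \<inter> {x. a \<bullet> x = a \<bullet> p}" using assms by simp
    show "T \<inter> {x. a \<bullet> x = a \<bullet> p} \<subseteq> frontier \<Omega>"
      using strictly_inside[OF open_dom _ a] elem_subset[OF assms(1)] frontier_dom by fastforce
  qed
qed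

lemma inball_le_dist_frontier:
  assumes z: "z \<in> \<Omega>" "T \<in> \<T>" "z extreme_point_of T" and p: "p \<in> T" "p \<in> frontier \<Omega>"
  shows "inball_diam T \<le> norm (p - z)"
proof -
  obtain F where F: "F face_of T" "p \<in> F" "F \<subseteq> frontier \<Omega>"
    using frontier_face[OF z(2) p] by blast
  have "z \<notin> F" using F(3) z(1) frontier_dom by auto
  then show ?thesis using inball_le_dist_opposite_face[OF simplex_elem[OF z(2)] z(3) F(1) _ F(2)] by blast
qed

lemma closed_patch: "closed (patch \<T> z)"
  unfolding patch_def by (intro closed_Union) (use finite_mesh closed_elem in \<open>simp_all\<close>)

lemma patch_subset: "patch \<T> z \<subseteq> closure \<Omega>"
  unfolding patch_def using elem_subset by blast

text \<open>Walk from \<open>z\<close> towards \<open>x\<close> and stop at the last point \<open>p\<close> of the patch: it lies on a face, not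
  containing \<open>z\<close>, of an element of the patch.\<close>

lemma cball_subset_patch:
  assumes z: "z \<in> interior_vertices \<Omega> \<T>"
    and r: "\<And>T. T \<in> \<T> \<Longrightarrow> z \<in> T \<Longrightarrow> r < inball_diam T"
  shows "cball z r \<subseteq> patch \<T> z"
proof (rule ccontr)
  assume "\<not> ?thesis"
  then obtain x where x: "norm (x - z) \<le> r" "x \<notin> patch \<T> z"
    by (auto simp: dist_norm norm_minus_commute subset_iff)
  note zv = interior_vertexD[OF z]
  have zP: "z \<in> patch \<T> z" using zv(2) by (auto simp: patch_def)
  define \<gamma> where "\<gamma> t = z + t *\<^sub>R (x - z)" for t :: real
  have cont: "continuous_on A \<gamma>" for A unfolding \<gamma>_def by (intro continuous_intros)
  define S where "S = {t\<in>{0..1}. \<gamma> t \<in> patch \<T> z}"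
  have "closed ({0..1} \<inter> \<gamma> -` patch \<T> z)"
    by (rule continuous_closed_preimage[OF cont closed_atLeastAtMost closed_patch])
  moreover have "S = {0..1} \<inter> \<gamma> -` patch \<T> z" by (auto simp: S_def)
  ultimately have "closed S" by simp
  moreover have "bounded S" by (rule bounded_subset[of "{0..1}"]) (auto simp: S_def)
  ultimately have "compact S" by (simp add: compact_eq_bounded_closed)
  moreover have "0 \<in> S" using zP by (simp add: S_def \<gamma>_def)
  ultimately obtain t where t: "t \<in> S" "\<And>t'. t' \<in> S \<Longrightarrow> t' \<le> t"
    using compact_attains_sup[of S] by blast
  let ?p = "\<gamma> t"
  have t01: "0 \<le> t" "t \<le> 1" and pP: "?p \<in> patch \<T> z" using t(1) by (auto simp: S_def)
  have "t \<noteq> 1" using pP x(2) by (auto simp: \<gamma>_def)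
  with t01 have t1: "t < 1" by simp
  obtain T where T: "T \<in> \<T>" "z \<in> T" "?p \<in> T" using pP by (auto simp: patch_def)
  note zext = zv(3)[OF T(1,2)]
  have "norm (?p - z) = t * norm (x - z)" using t01 by (simp add: \<gamma>_def)
  also have "\<dots> \<le> norm (x - z)" using t01 by (simp add: mult_left_le_one_le)
  also have "\<dots> < inball_diam T" using x(1) r[OF T(1,2)] by simp
  finally have less: "norm (?p - z) < inball_diam T" .
  \<comment> \<open>A boundary point would lie on a face of \<open>T\<close> avoiding
    \<open>z\<close>, hence at least an inball diameter away from \<open>z\<close>.\<close>
  have "?p \<notin> frontier \<Omega>"
    using inball_le_dist_frontier[OF zv(1) T(1) zext T(3)] less by force
  then have pO: "?p \<in> \<Omega>" using T(1,3) elem_subset frontier_dom by auto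
  \<comment> \<open>The elements away from \<open>z\<close>. If \<open>?p\<close> avoided this
    closed set, a short step beyond \<open>?p\<close> would stay in \<open>\<Omega> - ?Q\<close>,
    thus in the patch, against the maximality of \<open>t\<close>.\<close>
  let ?Q = "\<Union>{T'\<in>\<T>. z \<notin> T'}"
  have "closed ?Q" by (intro closed_Union) (use finite_mesh closed_elem in \<open>simp_all\<close>)
  have "?p \<in> ?Q"
  proof (rule ccontr)
    assume "?p \<notin> ?Q"
    then have "open (\<Omega> - ?Q)" "?p \<in> \<Omega> - ?Q" using open_dom \<open>closed ?Q\<close> pO by auto
    then obtain e where e: "e > 0" "ball ?p e \<subseteq> \<Omega> - ?Q" using open_contains_ball by blast
    define t' where "t' = min 1 (t + e / (2 * (norm (x - z) + 1)))"
    have "t' > t" using e(1) t1 norm_ge_zero[of "x-z"]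
      by (auto simp: t'_def intro!: divide_pos_pos mult_pos_pos add_nonneg_pos)
    have "t' - t \<le> e / (2 * (norm (x - z) + 1))" by (simp add: t'_def)
    have "norm (\<gamma> t' - ?p) = (t' - t) * norm (x - z)"
    proof -
      have "\<gamma> t' - ?p = (t' - t) *\<^sub>R (x - z)" by (simp add: \<gamma>_def algebra_simps)
      then show ?thesis using \<open>t' > t\<close> by simp
    qed
    also have "\<dots> \<le> e / (2 * (norm (x - z) + 1)) * norm (x - z)"
      using \<open>t' - t \<le> _\<close> by (intro mult_right_mono) auto
    also have "\<dots> \<le> e / 2"
    proof -
      have "norm (x - z) / (norm (x - z) + 1) \<le> 1" by (simp add: divide_le_eq add_nonneg_pos)
      then have "e / 2 * (norm (x - z) / (norm (x - z) + 1)) \<le> e / 2 * 1"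
        using e(1) by (intro mult_left_mono) auto
      then show ?thesis by simp
    qed
    also have "\<dots> < e" using e(1) by simp
    finally have "\<gamma> t' \<in> ball ?p e" by (simp add: dist_norm norm_minus_commute)
    then have "\<gamma> t' \<in> \<Omega>" "\<gamma> t' \<notin> ?Q" using e(2) by auto
    then have "\<gamma> t' \<in> \<Union>\<T>" using subsetD[OF closure_subset[of \<Omega>]] unfolding Union_mesh by simp
    then have "\<gamma> t' \<in> patch \<T> z" using \<open>\<gamma> t' \<notin> ?Q\<close> by (auto simp: patch_def)
    then have "t' \<in> S" using \<open>t' > t\<close> t01 by (auto simp: S_def t'_def)
    then show False using t(2) \<open>t' > t\<close> by force
  qed
  then obtain T' where T': "T' \<in> \<T>" "z \<notin> T'" "?p \<in> T'" by auto
  have "inball_diam T \<le> norm (?p - z)"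
    using inball_le_dist_opposite_face[OF simplex_elem[OF T(1)] zext face_Int[OF T(1) T'(1)]] T' T(3)
    by blast
  then show False using less by simp
qed

text \<open>A larger ball would make the nearest boundary point an interior point of the closure,
  but a convex open set is the interior of its closure.\<close>

lemma patch_ball_le:
  assumes "z \<in> \<Omega>" "0 \<le> r" "cball z r \<subseteq> patch \<T> z"
  shows "r \<le> bdist \<Omega> z"
proof (rule ccontr)
  assume *: "\<not> ?thesis"
  obtain q where q: "q \<in> frontier \<Omega>" "bdist \<Omega> z = norm (z - q)"
    using bdist_attained[OF bounded_dom nonempty_dom] by blast
  have "q \<in> ball z r" using * q by (simp add: dist_norm)
  moreover have "ball z r \<subseteq> closure \<Omega>" using assms(3) patch_subset ball_subset_cball by blast
  ultimately have "q \<in> interior (closure \<Omega>)" using interior_maximal open_ball by blast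
  then show False using q(1) interior_closure_dom frontier_dom by auto
qed

lemma patch_ball_le_diameter:
  assumes z: "z \<in> \<Omega>" and r: "0 \<le> r" "cball z r \<subseteq> patch \<T> z"
  shows "\<exists>T\<in>\<T>. z \<in> T \<and> r \<le> diameter T"
proof -
  obtain b :: 'a where b: "b \<in> Basis" using nonempty_Basis by blast
  have "z + r *\<^sub>R b \<in> patch \<T> z" using r b by (auto simp: subset_iff dist_norm)
  then obtain T where T: "T \<in> \<T>" "z \<in> T" "z + r *\<^sub>R b \<in> T" by (auto simp: patch_def)
  have "dist (z + r *\<^sub>R b) z \<le> diameter T"
    using diameter_bounded_bound[OF bounded_elem[OF T(1)] T(3,2)] .
  then show ?thesis using T r b by (auto simp: dist_norm)
qed

lemma vertex_size_le_bdist: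
  assumes z: "z \<in> interior_vertices \<Omega> \<T>"
  shows "vertex_size \<T> z \<le> bdist \<Omega> z"
  unfolding vertex_size_def
proof (rule cSup_least)
  show "{r. r \<ge> 0 \<and> cball z r \<subseteq> patch \<T> z} \<noteq> {}"
  proof -
    have "0 \<in> {r. r \<ge> 0 \<and> cball z r \<subseteq> patch \<T> z}"
      using interior_vertexD(2)[OF z] by (auto simp: patch_def)
    then show ?thesis by blast
  qed
  fix r assume "r \<in> {r. r \<ge> 0 \<and> cball z r \<subseteq> patch \<T> z}"
  then show "r \<le> bdist \<Omega> z" using patch_ball_le[OF interior_vertexD(1)[OF z]] by blast
qed

lemma vertex_size_ge:
  assumes z: "z \<in> interior_vertices \<Omega> \<T>"
    and m: "\<And>T. T \<in> \<T> \<Longrightarrow> z \<in> T \<Longrightarrow> m \<le> inball_diam T"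
  shows "m \<le> vertex_size \<T> z"
proof (rule ccontr)
  assume *: "\<not> ?thesis"
  let ?S = "{r. r \<ge> 0 \<and> cball z r \<subseteq> patch \<T> z}"
  have "z \<in> patch \<T> z" using interior_vertexD(2)[OF z] by (auto simp: patch_def)
  then have 0: "0 \<in> ?S" by simp
  have bdd: "bdd_above ?S"
    using patch_ball_le[OF interior_vertexD(1)[OF z]] by (intro bdd_aboveI[of _ "bdist \<Omega> z"]) blast
  \<comment> \<open>A radius strictly between the two values, since
    \<open>cball_subset_patch\<close> requires a strict inequality.\<close>
  define r where "r = (m + vertex_size \<T> z) / 2"
  have "0 \<le> vertex_size \<T> z" unfolding vertex_size_def by (rule cSup_upper[OF 0 bdd])
  then have r: "0 \<le> r" "vertex_size \<T> z < r" "r < m" using * by (auto simp: r_def)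
  have "cball z r \<subseteq> patch \<T> z" 
    by (rule cball_subset_patch[OF z]) (rule less_le_trans[OF r(3) m])
  then have "r \<le> vertex_size \<T> z" unfolding vertex_size_def using r(1) by (intro cSup_upper[OF _ bdd]) simp
  then show False using r(2) by simp
qed

lemma vertex_size_le_diameter:
  assumes z: "z \<in> interior_vertices \<Omega> \<T>"
    and D: "\<And>T. T \<in> \<T> \<Longrightarrow> z \<in> T \<Longrightarrow> diameter T \<le> D"
  shows "vertex_size \<T> z \<le> D"
  unfolding vertex_size_def
proof (rule cSup_least)
  let ?S = "{r. r \<ge> 0 \<and> cball z r \<subseteq> patch \<T> z}"
  show "?S \<noteq> {}"
  proof -
    have "0 \<in> ?S" using interior_vertexD(2)[OF z] by (auto simp: patch_def)
    then show ?thesis by blast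
  qed
  fix r assume "r \<in> ?S"
  then obtain T where "T \<in> \<T>" "z \<in> T" "r \<le> diameter T"
    using patch_ball_le_diameter[OF interior_vertexD(1)[OF z], of r] by blast
  then show "r \<le> D" using D by force
qed

lemma bdist_ge_inball:
  assumes z: "z \<in> interior_vertices \<Omega> \<T>" and "\<And>T. T \<in> \<T> \<Longrightarrow> z \<in> T \<Longrightarrow> m \<le> inball_diam T"
  shows "m \<le> bdist \<Omega> z"
  by (rule order_trans[OF vertex_size_ge[OF z assms(2)] vertex_size_le_bdist[OF z]])

lemma setdist_frontier_le: "x \<in> T \<Longrightarrow> setdist T (frontier \<Omega>) \<le> bdist \<Omega> x"
proof -
  assume x: "x \<in> T"
  obtain q where "q \<in> frontier \<Omega>" "bdist \<Omega> x = norm (x - q)"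
    using bdist_attained[OF bounded_dom nonempty_dom] by blast
  then show ?thesis using setdist_le_dist[OF x, of q "frontier \<Omega>"] by (simp add: dist_norm)
qed

text \<open>The grading speaks of the distance of an element from the boundary, the analysis of the
  distance of a vertex. This identifies the former with the latter at a suitable vertex of the
  element.\<close>

lemma setdist_frontier_attained:
  assumes T: "T \<in> \<T>" "T \<inter> frontier \<Omega> = {}"
  obtains z where "z \<in> interior_vertices \<Omega> \<T>" "z \<in> T" "setdist T (frontier \<Omega>) = bdist \<Omega> z"
proof -
  obtain C where C: "\<not> affine_dependent C" "finite C" "T = convex hull C"
    "\<And>c. c extreme_point_of T \<longleftrightarrow> c \<in> C" "compact T" "convex T" "closed T"
    using simplexD[OF simplex_elem[OF T(1)]] by blast
  have "aff_dim T = int DIM('a)" by (rule aff_dim_simplex[OF simplex_elem[OF T(1)]])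
  then have ne: "T \<noteq> {}" by (auto simp: aff_dim_empty)
  have fne: "frontier \<Omega> \<noteq> {}"
    using bounded_dom nonempty_dom frontier_eq_empty[of \<Omega>] not_bounded_UNIV by auto
  obtain p q where pq: "p \<in> T" "q \<in> frontier \<Omega>" "dist p q = setdist T (frontier \<Omega>)"
    using setdist_compact_closed[OF compact_elem[OF T(1)] frontier_closed ne fne] by blast
  have 1: "bdist \<Omega> p \<le> setdist T (frontier \<Omega>)" using bdist_le[OF pq(2), of p] pq(3) by (simp add: dist_norm)
  have pO: "p \<in> \<Omega>" using pq(1) T elem_subset frontier_dom by auto
  obtain a where a: "norm a = 1" "\<And>y. y \<in> closure \<Omega> \<Longrightarrow> bdist \<Omega> y \<le> bdist \<Omega> p - a \<bullet> (y - p)"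
    using bdist_direction[OF open_dom convex_dom bounded_dom pO] by blast
  text \<open>By concavity of the distance function, the minimum over \<open>T\<close> is attained at a vertex.\<close>
  have "\<exists>c. c extreme_point_of T \<and> a \<bullet> p \<le> a \<bullet> c"
  proof (rule ccontr)
    assume neg: "\<not> ?thesis"
    let ?M = "Max ((\<bullet>) a ` C)"
    have Cne: "C \<noteq> {}" using ne C(3) by auto
    note fC = C(2) and ext = C(4)
    have "a \<bullet> p + 0 \<le> ?M"
      using fC ext by (intro affine_le_on_extreme[OF compact_elem[OF T(1)] convex_elem[OF T(1)] _ pq(1)]) auto
    moreover have "?M < a \<bullet> p" using neg fC Cne ext by (subst Max_less_iff) (auto simp: not_le)
    ultimately show False by simp
  qed
  then obtain c where c: "c extreme_point_of T" "a \<bullet> p \<le> a \<bullet> c" by blast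
  have cT: "c \<in> T" using c(1) by (simp add: extreme_point_of_def)
  have "bdist \<Omega> c \<le> bdist \<Omega> p" using a(2)[of c] cT elem_subset[OF T(1)] c(2) by (auto simp: inner_diff_right)
  then have "setdist T (frontier \<Omega>) = bdist \<Omega> c" using 1 setdist_frontier_le[OF cT] by simp
  moreover have "c \<in> interior_vertices \<Omega> \<T>" using extreme_point_cases[OF T(1) c(1)] cT T(2) by auto
  ultimately show ?thesis using that[of c] cT by blast
qed

end

section \<open>Finite element functions and graded meshes\<close>

context domain_mesh begin

text \<open>The local affine interpolants fit together because two elements meet in a common face,
  on which an affine function is determined by its values at the extreme points. Zero boundary
  values of \<open>v\<close> make the extension by zero admissible.\<close>

lemma fe_interpolant:
  fixes v :: "'a \<Rightarrow> real"
  assumes v0: "\<And>x. x \<in> frontier \<Omega> \<Longrightarrow> v x = 0"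
  obtains w where "w \<in> fe_space \<Omega> \<T>" "\<And>T c. T \<in> \<T> \<Longrightarrow> c extreme_point_of T \<Longrightarrow> w c = v c"
proof -
  have "\<exists>a b. \<forall>c. c extreme_point_of T \<longrightarrow> a \<bullet> c + b = v c" if T: "T \<in> \<T>" for T
  proof -
    obtain C where C: "\<not> affine_dependent C" "finite C" "T = convex hull C"
      "\<And>c. c extreme_point_of T \<longleftrightarrow> c \<in> C" "compact T" "convex T" "closed T"
      using simplexD[OF simplex_elem[OF T]] by blast
    show ?thesis using affine_interpolation[OF C(1), of v] unfolding C(4) Ball_def by simp
  qed
  then obtain A B where AB: "\<And>T c. T \<in> \<T> \<Longrightarrow> c extreme_point_of T \<Longrightarrow> A T \<bullet> c + B T = v c"
    by metis
  have agree: "A T \<bullet> x + B T = A T' \<bullet> x + B T'"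
    if T: "T \<in> \<T>" "T' \<in> \<T>" and x: "x \<in> T" "x \<in> T'" for T T' x
  proof (rule affine_eq_on_extreme)
    show "compact (T \<inter> T')" "convex (T \<inter> T')"
      using T compact_elem convex_elem by (auto intro: compact_Int convex_Int)
    fix c assume c: "c extreme_point_of (T \<inter> T')"
    have "c extreme_point_of T" using extreme_point_of_face[OF face_Int[OF T]] c by blast
    moreover have "c extreme_point_of T'"
      using extreme_point_of_face[OF face_Int[OF T(2,1)]] c by (simp add: Int_commute)
    ultimately show "A T \<bullet> c + B T = A T' \<bullet> c + B T'" using AB T by simp
  qed (use x in auto)
  define w where "w x = (if x \<in> closure \<Omega> then let T = SOME T. T \<in> \<T> \<and> x \<in> T in A T \<bullet> x + B T else 0)" for x
  have w: "w x = A T \<bullet> x + B T" if T: "T \<in> \<T>" "x \<in> T" for T x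
  proof -
    define T' where "T' = (SOME T. T \<in> \<T> \<and> x \<in> T)"
    have "T' \<in> \<T> \<and> x \<in> T'"
      unfolding T'_def by (rule someI[of "\<lambda>T. T \<in> \<T> \<and> x \<in> T"]) (use T in simp)
    then have "A T' \<bullet> x + B T' = A T \<bullet> x + B T" using agree T by blast
    moreover have "x \<in> closure \<Omega>" using elem_subset T by blast
    ultimately show ?thesis unfolding w_def Let_def T'_def by simp
  qed
  have "continuous_on (\<Union>T\<in>\<T>. T) w"
  proof (rule continuous_on_closed_Union[OF finite_mesh closed_elem])
    fix T assume T: "T \<in> \<T>"
    have "continuous_on T (\<lambda>x. A T \<bullet> x + B T)" by (intro continuous_intros)
    then show "continuous_on T w" by (rule continuous_on_eq) (simp add: w[OF T])
  qed
  then have cont: "continuous_on (closure \<Omega>) w" using Union_mesh by simp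
  have zero: "w x = 0" if "x \<notin> \<Omega>" for x
  proof (cases "x \<in> closure \<Omega>")
    case True
    then have xf: "x \<in> frontier \<Omega>" using that frontier_dom by simp
    from True obtain T where T: "T \<in> \<T>" "x \<in> T" unfolding Union_mesh[symmetric] by blast
    \<comment> \<open>Vertex values alone do not settle a boundary point inside a face; the whole
      face lies in the frontier, so all its vertices carry the value 0.\<close>
    obtain F where F: "F face_of T" "x \<in> F" "F \<subseteq> frontier \<Omega>"
      using frontier_face[OF T xf] by blast
    have "A T \<bullet> x + B T = 0 \<bullet> x + 0"
    proof (rule affine_eq_on_extreme)
      show "compact F" using face_of_imp_compact[OF convex_elem compact_elem F(1)] T by simp
      show "convex F" using face_of_imp_convex[OF F(1)] .
      fix c assume c: "c extreme_point_of F"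
      have "c extreme_point_of T" "c \<in> F" using extreme_point_of_face[OF F(1)] c by auto
      then show "A T \<bullet> c + B T = 0 \<bullet> c + 0" using AB[OF T(1)] v0 F(3) by auto
    qed (rule F(2))
    then show ?thesis using w[OF T] by simp
  qed (simp add: w_def)
  show ?thesis
  proof (rule that)
    show "w \<in> fe_space \<Omega> \<T>"
      unfolding fe_space_def using cont zero w by blast
    fix T c assume T: "T \<in> \<T>" "c extreme_point_of T"
    have "c \<in> T" using T(2) by (simp add: extreme_point_of_def)
    then show "w c = v c" using w[OF T(1)] AB[OF T] by simp
  qed
qed

text \<open>On each element the maximum is at an extreme point. The sign of \<open>M\<close> covers
  the vertices on the boundary and the complement of \<open>\<Omega>\<close>, where \<open>w\<close>
  is 0.\<close>

lemma fe_le_vertices: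
  assumes w: "w \<in> fe_space \<Omega> \<T>" and M: "0 \<le> M"
    and le: "\<And>z. z \<in> interior_vertices \<Omega> \<T> \<Longrightarrow> w z \<le> M"
  shows "w x \<le> M"
proof (cases "x \<in> \<Omega>")
  case True
  then have "x \<in> \<Union>\<T>" unfolding Union_mesh using closure_subset[of \<Omega>] by blast
  then obtain T where T: "T \<in> \<T>" "x \<in> T" by blast
  obtain a b where ab: "\<forall>x\<in>T. w x = a \<bullet> x + b" using w T(1) unfolding fe_space_def by blast
  have "a \<bullet> x + b \<le> M"
  proof (rule affine_le_on_extreme[OF compact_elem[OF T(1)] convex_elem[OF T(1)] _ T(2)])
    fix c assume c: "c extreme_point_of T"
    have cT: "c \<in> T" using c by (simp add: extreme_point_of_def)
    from extreme_point_cases[OF T(1) c] have "w c \<le> M"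
    proof
      assume "c \<in> frontier \<Omega>"
      then have "w c = 0" using w unfolding fe_space_def frontier_dom by simp
      then show ?thesis using M by simp
    qed (rule le)
    then show "a \<bullet> c + b \<le> M" using ab cT by simp
  qed
  then show ?thesis using ab T(2) by simp
next
  case False
  then show ?thesis using w M unfolding fe_space_def by simp
qed

lemma fe_space_diff: "v \<in> fe_space \<Omega> \<T> \<Longrightarrow> w \<in> fe_space \<Omega> \<T> \<Longrightarrow> (\<lambda>x. v x - w x) \<in> fe_space \<Omega> \<T>"
  unfolding fe_space_def
proof (safe intro!: continuous_intros)
  fix T assume "T \<in> \<T>" and v: "\<forall>T\<in>\<T>. \<exists>a c. \<forall>x\<in>T. v x = a \<bullet> x + c"
    and w: "\<forall>T\<in>\<T>. \<exists>a c. \<forall>x\<in>T. w x = a \<bullet> x + c"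
  then obtain a c a' c' where "\<forall>x\<in>T. v x = a \<bullet> x + c" "\<forall>x\<in>T. w x = a' \<bullet> x + c'" by metis
  then have "\<forall>x\<in>T. v x - w x = (a - a') \<bullet> x + (c - c')" by (simp add: inner_diff_left)
  then show "\<exists>a c. \<forall>x\<in>T. v x - w x = a \<bullet> x + c" by blast
qed auto

lemma finite_interior_vertices: "finite (interior_vertices \<Omega> \<T>)"
proof -
  have "finite {c. c extreme_point_of T}" if T: "T \<in> \<T>" for T
  proof -
    obtain C where C: "\<not> affine_dependent C" "finite C" "T = convex hull C"
      "\<And>c. c extreme_point_of T \<longleftrightarrow> c \<in> C" "compact T" "convex T" "closed T"
      using simplexD[OF simplex_elem[OF T]] by blast
    then show ?thesis by simp
  qed
  then have "finite (\<Union>T\<in>\<T>. {c. c extreme_point_of T})" using finite_mesh by blast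
  then show ?thesis by (rule finite_subset[rotated]) (auto simp: interior_vertices_def)
qed

end

text \<open>A common bound for all mesh constants, independent of \<open>h\<close> and the mesh. The
  first summand comes from the lower bound for the vertex size, the second from the elements that
  touch the boundary, in the upper bound.\<close>

definition mesh_const :: "real \<Rightarrow> real \<Rightarrow> real \<Rightarrow> real" where
  "mesh_const \<sigma> \<kappa> \<mu> = \<sigma> * \<kappa> * (1 + \<kappa>\<^sup>2 * \<sigma> + \<kappa>) + \<kappa> * (\<kappa> * \<sigma>) powr \<mu>"

text \<open>That \<open>\<sigma>\<close> and \<open>\<kappa>\<close> are at least 1 is no
  restriction, because shape regularity and grading become weaker as they grow.\<close>

locale graded_mesh = domain_mesh +
  fixes \<sigma> \<kappa> \<mu> h :: real
  assumes sig: "\<sigma> \<ge> 1" and kap: "\<kappa> \<ge> 1" and mu: "\<mu> \<ge> 1" and h_pos: "h > 0"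
    and shape: "shape_regular \<sigma> \<T>" and grading: "graded \<Omega> \<kappa> \<mu> h \<T>"
begin

abbreviation K where "K \<equiv> mesh_const \<sigma> \<kappa> \<mu>"
abbreviation \<tau> where "\<tau> \<equiv> (\<mu> - 1) / \<mu>"

lemma ks_ge1: "\<kappa> * \<sigma> \<ge> 1"
  using sig kap mult_mono[of 1 \<kappa> 1 \<sigma>] by simp

lemma tau_bounds: "0 \<le> \<tau>" "\<tau> < 1" "1 - \<tau> = 1 / \<mu>" "\<mu> * \<tau> = \<mu> - 1"
  using mu by (auto simp: field_simps)

lemma K_ge: "K \<ge> 1" "K \<ge> \<kappa>" "K \<ge> \<kappa>\<^sup>2 * \<sigma>" "K \<ge> \<sigma> * \<kappa> * (1 + \<kappa>\<^sup>2 * \<sigma> + \<kappa>)"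
  "K \<ge> \<kappa> * (\<kappa> * \<sigma>) powr \<mu>" "K \<ge> (\<kappa> * \<sigma>) powr \<mu>"
proof -
  have p: "(\<kappa> * \<sigma>) powr \<mu> \<ge> 1" using ks_ge1 mu by (intro ge_one_powr_ge_zero) auto
  have a: "\<kappa> * (\<kappa> * \<sigma>) powr \<mu> \<ge> (\<kappa> * \<sigma>) powr \<mu>" "\<kappa> * (\<kappa> * \<sigma>) powr \<mu> \<ge> \<kappa>"
    using p kap mult_right_mono[of 1 \<kappa> "(\<kappa> * \<sigma>) powr \<mu>"] mult_left_mono[of 1 "(\<kappa> * \<sigma>) powr \<mu>" \<kappa>] by auto
  let ?X = "1 + \<kappa>\<^sup>2 * \<sigma> + \<kappa>"
  have k2: "\<kappa>\<^sup>2 * \<sigma> \<ge> 0" using sig by simp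
  then have b: "\<sigma> * \<kappa> * ?X \<ge> ?X"
    using mult_right_mono[OF ks_ge1, of ?X] kap by (simp add: mult.commute)
  show "K \<ge> 1" "K \<ge> \<kappa>" "K \<ge> \<kappa>\<^sup>2 * \<sigma>" "K \<ge> \<sigma> * \<kappa> * ?X" "K \<ge> \<kappa> * (\<kappa> * \<sigma>) powr \<mu>" "K \<ge> (\<kappa> * \<sigma>) powr \<mu>"
    unfolding mesh_const_def using a b p k2 kap by linarith+
qed

lemma K_pos: "K > 0" using K_ge(1) by linarith

lemma touching:
  assumes "T \<in> \<T>" "T \<inter> frontier \<Omega> \<noteq> {}"
  shows "h powr \<mu> \<le> \<kappa> * diameter T" "diameter T \<le> \<kappa> * h powr \<mu>"
  using bspec[OF grading[unfolded graded_def Let_def] assms(1)] unfolding if_P[OF assms(2)] by blast+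

lemma nontouching:
  assumes "T \<in> \<T>" "T \<inter> frontier \<Omega> = {}"
  shows "h * setdist T (frontier \<Omega>) powr \<tau> \<le> \<kappa> * diameter T"
    "diameter T \<le> \<kappa> * (h * setdist T (frontier \<Omega>) powr \<tau>)"
  using bspec[OF grading[unfolded graded_def Let_def] assms(1)] assms(2) by simp_all

lemma inball_ge: "T \<in> \<T> \<Longrightarrow> diameter T / \<sigma> \<le> inball_diam T"
  using shape sig unfolding shape_regular_def by (simp add: divide_le_eq mult.commute)

lemma scaled_inball_ge:
  assumes "T \<in> \<T>" "g \<le> \<kappa> * diameter T"
  shows "g / (\<kappa> * \<sigma>) \<le> inball_diam T"
proof -
  have "g / (\<kappa> * \<sigma>) \<le> \<kappa> * diameter T / (\<kappa> * \<sigma>)"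
    using assms(2) ks_ge1 by (intro divide_right_mono) auto
  also have "\<dots> = diameter T / \<sigma>" using kap by simp
  finally show ?thesis using inball_ge[OF assms(1)] by simp
qed

text \<open>For the interior vertex nearest to the boundary, every adjacent element has size at least
  \<open>min (h powr \<mu>) (h * bdist \<Omega> z powr \<tau>)\<close> up to a constant, and it fits between \<open>z\<close> and the boundary.\<close>

lemma bdist_vertex_ge_aux:
  assumes z: "z \<in> interior_vertices \<Omega> \<T>"
  shows "h powr \<mu> \<le> (\<kappa> * \<sigma>) powr \<mu> * bdist \<Omega> z"
proof -
  have fin: "finite (bdist \<Omega> ` interior_vertices \<Omega> \<T>)" using finite_interior_vertices by simp
  \<comment> \<open>The nearest vertex avoids a circular argument: an element at \<open>y\<close>
    that does not touch the boundary has its distance attained at some vertex, so this distance is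
    at least that of \<open>y\<close>.\<close>
  obtain y where y: "y \<in> interior_vertices \<Omega> \<T>" "\<And>y'. y' \<in> interior_vertices \<Omega> \<T> \<Longrightarrow> bdist \<Omega> y \<le> bdist \<Omega> y'"
    using Min_in[OF fin] Min_le[OF fin] z by fastforce
  let ?d = "bdist \<Omega> y"
  have d: "?d > 0" using bdist_pos[OF open_dom bounded_dom] interior_vertexD(1)[OF y(1)] by blast
  have "min (h powr \<mu>) (h * ?d powr \<tau>) / (\<kappa> * \<sigma>) \<le> ?d"
  proof (rule bdist_ge_inball[OF y(1)])
    fix T assume T: "T \<in> \<T>" "y \<in> T"
    have "min (h powr \<mu>) (h * ?d powr \<tau>) \<le> \<kappa> * diameter T"
    proof (cases "T \<inter> frontier \<Omega> = {}")
      case True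
      obtain c where c: "c \<in> interior_vertices \<Omega> \<T>" "c \<in> T" "setdist T (frontier \<Omega>) = bdist \<Omega> c"
        using setdist_frontier_attained[OF T(1) True] by blast
      have "?d powr \<tau> \<le> setdist T (frontier \<Omega>) powr \<tau>"
        using y(2)[OF c(1)] c(3) d tau_bounds(1) by (intro powr_mono2) auto
      then have "h * ?d powr \<tau> \<le> h * setdist T (frontier \<Omega>) powr \<tau>"
        using h_pos by (intro mult_left_mono) auto
      then show ?thesis using nontouching(1)[OF T(1) True] by linarith
    next
      case False
      then show ?thesis using touching(1)[OF T(1) False] by linarith
    qed
    then show "min (h powr \<mu>) (h * ?d powr \<tau>) / (\<kappa> * \<sigma>) \<le> inball_diam T"
      by (rule scaled_inball_ge[OF T(1)])
  qed
  then have m: "min (h powr \<mu>) (h * ?d powr \<tau>) \<le> (\<kappa> * \<sigma>) * ?d"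
    using ks_ge1 by (simp add: divide_le_eq mult.commute)
  have "h powr \<mu> \<le> (\<kappa> * \<sigma>) powr \<mu> * ?d"
  proof (cases "h powr \<mu> \<le> h * ?d powr \<tau>")
    case True
    then have "h powr \<mu> \<le> (\<kappa> * \<sigma>) powr 1 * ?d" using m ks_ge1 by simp
    also have "\<dots> \<le> (\<kappa> * \<sigma>) powr \<mu> * ?d"
      using ks_ge1 mu d by (intro mult_right_mono powr_mono) auto
    finally show ?thesis .
  next
    case False
    \<comment> \<open>As \<open>?d\<close> is the product of \<open>?d powr (1 / \<mu>)\<close> and
      \<open>?d powr \<tau>\<close>, the second factor cancels and the rest is raised to the power
      \<open>\<mu>\<close>.\<close>
    then have "h * ?d powr \<tau> \<le> (\<kappa> * \<sigma>) * ?d" using m by simp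
    also have "\<dots> = (\<kappa> * \<sigma>) * ?d powr (1 / \<mu>) * ?d powr \<tau>"
      using d tau_bounds(3) by (simp add: powr_add[symmetric] flip: tau_bounds(3))
    finally have "h \<le> (\<kappa> * \<sigma>) * ?d powr (1 / \<mu>)" using d by simp
    then have "h powr \<mu> \<le> ((\<kappa> * \<sigma>) * ?d powr (1 / \<mu>)) powr \<mu>"
      using h_pos mu by (intro powr_mono2) auto
    also have "\<dots> = (\<kappa> * \<sigma>) powr \<mu> * ?d"
      using d mu ks_ge1 by (simp add: powr_mult powr_powr)
    finally show ?thesis .
  qed
  also have "\<dots> \<le> (\<kappa> * \<sigma>) powr \<mu> * bdist \<Omega> z" using y(2)[OF z] by (intro mult_left_mono) auto
  finally show ?thesis .
qed

lemma bdist_vertex_ge: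
  assumes z: "z \<in> interior_vertices \<Omega> \<T>"
  shows "h powr \<mu> \<le> K * bdist \<Omega> z"
  using bdist_vertex_ge_aux[OF z] mult_right_mono[OF K_ge(6), of "bdist \<Omega> z"] by simp

text \<open>At the vertex that realises \<open>D\<close>, \<open>h\<close> is at most
  \<open>\<kappa> * \<sigma> * D powr (1 / \<mu>)\<close>, which turns the grading
  \<open>h * D powr \<tau>\<close> into a multiple of \<open>D\<close>: away from the boundary,
  elements are no larger than their distance to it.\<close>

lemma interior_elem:
  assumes T: "T \<in> \<T>" "T \<inter> frontier \<Omega> = {}"
  defines "D \<equiv> setdist T (frontier \<Omega>)"
  shows "D > 0" "h powr \<mu> \<le> K * D" "diameter T \<le> K * (h * D powr \<tau>)" "diameter T \<le> (\<kappa>\<^sup>2 * \<sigma>) * D"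
    "diameter T \<le> K * D"
proof -
  obtain c where c: "c \<in> interior_vertices \<Omega> \<T>" "c \<in> T" "D = bdist \<Omega> c"
    using setdist_frontier_attained[OF T] D_def by blast
  show D: "D > 0" using bdist_pos[OF open_dom bounded_dom] interior_vertexD(1)[OF c(1)] c(3) by simp
  show "h powr \<mu> \<le> K * D" using bdist_vertex_ge[OF c(1)] c(3) by simp
  show "diameter T \<le> K * (h * D powr \<tau>)"
    unfolding D_def using h_pos
    by (intro order_trans[OF nontouching(2)[OF T] mult_right_mono[OF K_ge(2)]]) simp
  have "h = (h powr \<mu>) powr (1 / \<mu>)" using h_pos mu by (simp add: powr_powr)
  also have "\<dots> \<le> ((\<kappa> * \<sigma>) powr \<mu> * D) powr (1 / \<mu>)"
    using bdist_vertex_ge_aux[OF c(1)] c(3) mu by (intro powr_mono2) auto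
  also have "\<dots> = (\<kappa> * \<sigma>) * D powr (1 / \<mu>)"
    using D mu kap sig by (simp add: powr_mult powr_powr)
  finally have "h * D powr \<tau> \<le> (\<kappa> * \<sigma>) * D powr (1 / \<mu>) * D powr \<tau>"
    by (intro mult_right_mono) auto
  also have "\<dots> = (\<kappa> * \<sigma>) * D"
    using D by (simp add: powr_add[symmetric] flip: tau_bounds(3))
  finally have "\<kappa> * (h * D powr \<tau>) \<le> \<kappa> * ((\<kappa> * \<sigma>) * D)" using kap by (intro mult_left_mono) auto
  then show d: "diameter T \<le> (\<kappa>\<^sup>2 * \<sigma>) * D" using nontouching(2)[OF T] D_def
    by (simp add: power2_eq_square mult.assoc)
  show "diameter T \<le> K * D" using d mult_right_mono[OF K_ge(3) less_imp_le[OF D]] by linarith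
qed

lemma boundary_elem:
  assumes T: "T \<in> \<T>" "T \<inter> frontier \<Omega> \<noteq> {}"
  shows "h powr \<mu> \<le> K * diameter T" "diameter T \<le> K * h powr \<mu>"
proof -
  have "diameter T \<ge> 0" using diameter_ge_0[OF bounded_elem[OF T(1)]] .
  then show "h powr \<mu> \<le> K * diameter T" "diameter T \<le> K * h powr \<mu>"
    using touching[OF T] mult_right_mono[OF K_ge(2), of "diameter T"]
     mult_right_mono[OF K_ge(2), of "h powr \<mu>"] by auto
qed

lemma bdist_le_diameter:
  assumes "T \<in> \<T>" "T \<inter> frontier \<Omega> \<noteq> {}" "x \<in> T"
  shows "bdist \<Omega> x \<le> diameter T"
proof -
  obtain q where q: "q \<in> T" "q \<in> frontier \<Omega>" using assms(2) by blast
  have "dist x q \<le> diameter T" by (rule diameter_bounded_bound[OF bounded_elem[OF assms(1)] assms(3) q(1)])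
  then show ?thesis using bdist_le[OF q(2), of x] by (simp add: dist_norm)
qed

lemma bdist_le_setdist:
  assumes "T \<in> \<T>" "T \<inter> frontier \<Omega> = {}" "x \<in> T"
  shows "bdist \<Omega> x \<le> (1 + \<kappa>\<^sup>2 * \<sigma>) * setdist T (frontier \<Omega>)"
proof -
  obtain c where c: "c \<in> interior_vertices \<Omega> \<T>" "c \<in> T" "setdist T (frontier \<Omega>) = bdist \<Omega> c"
    using setdist_frontier_attained[OF assms(1,2)] by blast
  have "dist x c \<le> diameter T" by (rule diameter_bounded_bound[OF bounded_elem[OF assms(1)] assms(3) c(2)])
  then have "bdist \<Omega> x \<le> bdist \<Omega> c + diameter T"
    using bdist_lipschitz[of \<Omega> x c] by (simp add: dist_norm)
  then show ?thesis using interior_elem(4)[OF assms(1,2)] c(3) by (simp add: algebra_simps)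
qed

text \<open>Every element at \<open>z\<close> must be large enough. If it is away from the boundary,
  its distance is comparable with that of \<open>z\<close>; if it touches the boundary, the distance
  of \<open>z\<close> is at most a multiple of \<open>h powr \<mu>\<close>, and
  \<open>1 + \<mu> * \<tau> = \<mu>\<close>.\<close>

lemma vertex_size_lower:
  assumes z: "z \<in> interior_vertices \<Omega> \<T>"
  shows "h * bdist \<Omega> z powr \<tau> \<le> K * vertex_size \<T> z"
proof -
  let ?d = "bdist \<Omega> z" and ?X = "1 + \<kappa>\<^sup>2 * \<sigma> + \<kappa>"
  have X: "?X \<ge> 1" using sig kap by simp
  have pow_le: "c powr \<tau> \<le> c" if "c \<ge> 1" for c
    using powr_mono[of \<tau> 1 c] tau_bounds that by simp
  have "h * ?d powr \<tau> / (\<sigma> * \<kappa> * ?X) \<le> vertex_size \<T> z"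
  proof (rule vertex_size_ge[OF z])
    fix T assume T: "T \<in> \<T>" "z \<in> T"
    have "h * ?d powr \<tau> \<le> ?X * (\<kappa> * diameter T)"
    proof (cases "T \<inter> frontier \<Omega> = {}")
      case True
      let ?D = "setdist T (frontier \<Omega>)"
      have "?d \<le> (1 + \<kappa>\<^sup>2 * \<sigma>) * ?D" by (rule bdist_le_setdist[OF T(1) True T(2)])
      also have "\<dots> \<le> ?X * ?D" using kap interior_elem(1)[OF T(1) True] by (intro mult_right_mono) auto
      finally have "?d powr \<tau> \<le> (?X * ?D) powr \<tau>" using tau_bounds(1) by (intro powr_mono2) auto
      also have "\<dots> = ?X powr \<tau> * ?D powr \<tau>" by (rule powr_mult)
      also have "\<dots> \<le> ?X * ?D powr \<tau>" using pow_le[OF X] by (intro mult_right_mono) auto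
      finally have "h * ?d powr \<tau> \<le> h * (?X * ?D powr \<tau>)" using h_pos by (intro mult_left_mono) auto
      also have "\<dots> = ?X * (h * ?D powr \<tau>)" by (simp only: mult.left_commute)
      also have "\<dots> \<le> ?X * (\<kappa> * diameter T)" using nontouching(1)[OF T(1) True] X by (intro mult_left_mono) auto
      finally show ?thesis .
    next
      case False
      have "?d \<le> \<kappa> * h powr \<mu>"
        using bdist_le_diameter[OF T(1) False T(2)] touching(2)[OF T(1) False] by simp
      then have "?d powr \<tau> \<le> (\<kappa> * h powr \<mu>) powr \<tau>" using tau_bounds(1) by (intro powr_mono2) auto
      also have "\<dots> = \<kappa> powr \<tau> * h powr (\<mu> - 1)"
        using kap h_pos tau_bounds(4) by (simp add: powr_mult powr_powr)
      also have "\<dots> \<le> \<kappa> * h powr (\<mu> - 1)" using pow_le[OF kap] by (intro mult_right_mono) auto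
      finally have "h * ?d powr \<tau> \<le> h * (\<kappa> * h powr (\<mu> - 1))" using h_pos by (intro mult_left_mono) auto
      also have "\<dots> = \<kappa> * h powr \<mu>" using h_pos powr_add[of h 1 "\<mu> - 1"] by simp
      also have "\<dots> \<le> \<kappa> * (\<kappa> * diameter T)"
        using touching(1)[OF T(1) False] kap by (intro mult_left_mono) auto
      also have "\<dots> \<le> ?X * (\<kappa> * diameter T)"
        using sig kap diameter_ge_0[OF bounded_elem[OF T(1)]] by (intro mult_right_mono) auto
      finally show ?thesis .
    qed
    then have "h * ?d powr \<tau> / ?X \<le> \<kappa> * diameter T" using X by (simp add: divide_le_eq mult.commute)
    from scaled_inball_ge[OF T(1) this]
    show "h * ?d powr \<tau> / (\<sigma> * \<kappa> * ?X) \<le> inball_diam T" by (simp add: mult_ac)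
  qed
  moreover have "\<sigma> * \<kappa> * ?X > 0" using X sig kap by (intro mult_pos_pos) linarith+
  ultimately have "h * ?d powr \<tau> \<le> (\<sigma> * \<kappa> * ?X) * vertex_size \<T> z"
    by (simp only: pos_divide_le_eq mult.commute)
  moreover have "0 \<le> vertex_size \<T> z"
    using vertex_size_ge[OF z, of 0] inball_diam_nonneg bounded_elem by blast
  ultimately show ?thesis using mult_right_mono[OF K_ge(4), of "vertex_size \<T> z"] by simp
qed

text \<open>For an element at the boundary the size \<open>h powr \<mu>\<close> equals
  \<open>h * (h powr \<mu>) powr \<tau>\<close>, where the lower bound on the distance of interior
  vertices replaces the inner \<open>h powr \<mu>\<close> by that distance.\<close>

lemma vertex_size_upper:
  assumes z: "z \<in> interior_vertices \<Omega> \<T>"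
  shows "vertex_size \<T> z \<le> K * (h * bdist \<Omega> z powr \<tau>)"
proof (rule vertex_size_le_diameter[OF z])
  let ?d = "bdist \<Omega> z"
  fix T assume T: "T \<in> \<T>" "z \<in> T"
  show "diameter T \<le> K * (h * ?d powr \<tau>)"
  proof (cases "T \<inter> frontier \<Omega> = {}")
    case True
    have "setdist T (frontier \<Omega>) powr \<tau> \<le> ?d powr \<tau>"
      using setdist_frontier_le[OF T(2)] tau_bounds(1) interior_elem(1)[OF T(1) True]
      by (intro powr_mono2) auto
    then have "K * (h * setdist T (frontier \<Omega>) powr \<tau>) \<le> K * (h * ?d powr \<tau>)"
      using h_pos K_pos by (intro mult_left_mono) auto
    then show ?thesis using interior_elem(3)[OF T(1) True] by linarith
  next
    case False
    have le: "(\<kappa> * \<sigma>) powr \<mu> \<ge> 1" using ks_ge1 mu by (intro ge_one_powr_ge_zero) auto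
    have "h powr (\<mu> - 1) = (h powr \<mu>) powr \<tau>" using tau_bounds(4) by (simp add: powr_powr)
    also have "\<dots> \<le> ((\<kappa> * \<sigma>) powr \<mu> * ?d) powr \<tau>"
      using bdist_vertex_ge_aux[OF z] tau_bounds(1) by (intro powr_mono2) auto
    also have "\<dots> = ((\<kappa> * \<sigma>) powr \<mu>) powr \<tau> * ?d powr \<tau>" by (rule powr_mult)
    also have "\<dots> \<le> (\<kappa> * \<sigma>) powr \<mu> * ?d powr \<tau>"
      using powr_mono[of \<tau> 1 "(\<kappa> * \<sigma>) powr \<mu>"] tau_bounds le by (intro mult_right_mono) auto
    finally have "h * h powr (\<mu> - 1) \<le> h * ((\<kappa> * \<sigma>) powr \<mu> * ?d powr \<tau>)"
      using h_pos by (intro mult_left_mono) auto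
    then have "h powr \<mu> \<le> (\<kappa> * \<sigma>) powr \<mu> * (h * ?d powr \<tau>)"
      using h_pos powr_add[of h 1 "\<mu> - 1"] by (simp add: mult_ac)
    then have "\<kappa> * h powr \<mu> \<le> \<kappa> * ((\<kappa> * \<sigma>) powr \<mu> * (h * ?d powr \<tau>))"
      using kap by (intro mult_left_mono) auto
    also have "\<dots> \<le> K * (h * ?d powr \<tau>)"
      using mult_right_mono[OF K_ge(5), of "h * ?d powr \<tau>"] h_pos by (simp add: mult.assoc)
    finally show ?thesis using touching(2)[OF T(1) False] by linarith
  qed
qed

end

section \<open>Homogeneous integrals\<close>

lemma nn_integral_lborel_scale:
  fixes f :: "'a::euclidean_space \<Rightarrow> ennreal"
  assumes [measurable]: "f \<in> borel_measurable borel" and c: "c > 0"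
  shows "(\<integral>\<^sup>+y. f y \<partial>lborel) = ennreal (c ^ DIM('a)) * (\<integral>\<^sup>+y. f (c *\<^sub>R y) \<partial>lborel)"
proof -
  have "(\<integral>\<^sup>+y. f y \<partial>lborel)
      = (\<integral>\<^sup>+y. f y \<partial>density (distr lborel borel (\<lambda>x::'a. 0 + c *\<^sub>R x)) (\<lambda>_. ennreal (\<bar>c\<bar> ^ DIM('a))))"
    using lborel_affine[of c "0::'a"] c by simp
  also have "\<dots> = ennreal (c ^ DIM('a)) * (\<integral>\<^sup>+y. f (c *\<^sub>R y) \<partial>lborel)"
    using c by (simp add: nn_integral_density nn_integral_distr nn_integral_cmult)
  finally show ?thesis .
qed

text \<open>The image of the measure \<open>G(y) dy\<close> under the norm gives mass \<open>\<Gamma> r\<^sup>d\<close> to \<open>[0, r)\<close>, by scaling.\<close>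

lemma polar_nn_integral:
  fixes G :: "'a::euclidean_space \<Rightarrow> ennreal" and \<phi> :: "real \<Rightarrow> ennreal"
  assumes [measurable]: "G \<in> borel_measurable borel" "\<phi> \<in> borel_measurable borel"
    and hom: "\<And>c y. c > 0 \<Longrightarrow> G (c *\<^sub>R y) = G y"
    and \<Gamma>: "(\<integral>\<^sup>+y. indicator (ball 0 1) y * G y \<partial>lborel) = ennreal \<Gamma>" "\<Gamma> \<ge> 0"
  shows "(\<integral>\<^sup>+y. G y * \<phi> (norm y) \<partial>lborel)
    = (\<integral>\<^sup>+r. ennreal (\<Gamma> * real DIM('a) * r ^ (DIM('a) - 1)) * indicator {0..} r * \<phi> r \<partial>lborel)"
proof -
  let ?d = "DIM('a)"
  \<comment> \<open>The derivative of \<Gamma> r^d on the positive half-line, that is, the density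
    of the radial measure.\<close>
  define w where "w r = ennreal (\<Gamma> * real ?d * r ^ (?d - 1)) * indicator {0..} r" for r :: real
  have [measurable]: "w \<in> borel_measurable borel" unfolding w_def by simp
  let ?M = "distr (density lborel G) borel norm" and ?N = "density lborel w"
  have ball: "(\<integral>\<^sup>+y. G y * indicator (ball 0 r) y \<partial>lborel) = ennreal (\<Gamma> * r ^ ?d)" if r: "r > 0" for r
  proof -
    have [measurable]: "(\<lambda>y. G y * indicator (ball 0 r) y) \<in> borel_measurable borel"
      by (intro borel_measurable_times_ennreal borel_measurable_indicator) auto
    have "(\<integral>\<^sup>+y. G y * indicator (ball 0 r) y \<partial>lborel)
      = ennreal (r ^ ?d) * (\<integral>\<^sup>+y. G (r *\<^sub>R y) * indicator (ball 0 r) (r *\<^sub>R y) \<partial>lborel)"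
      using r by (subst nn_integral_lborel_scale[where c=r]) auto
    also have "(\<integral>\<^sup>+y. G (r *\<^sub>R y) * indicator (ball 0 r) (r *\<^sub>R y) \<partial>lborel)
       = (\<integral>\<^sup>+y. indicator (ball 0 1) y * G y \<partial>lborel)"
      using r by (intro nn_integral_cong) (auto simp: hom indicator_def)
    finally show ?thesis using r \<Gamma> by (simp add: ennreal_mult[symmetric] mult.commute)
  qed
  have eM: "emeasure ?M {..<r} = ennreal (\<Gamma> * max 0 r ^ ?d)" for r
  proof -
    have "emeasure ?M {..<r} = (\<integral>\<^sup>+y. G y * indicator (ball 0 r) y \<partial>lborel)"
      by (subst emeasure_distr, simp, simp, subst emeasure_density, simp, measurable)
         (auto intro!: nn_integral_cong simp: indicator_def)
    also have "\<dots> = ennreal (\<Gamma> * max 0 r ^ ?d)"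
    proof (cases "r > 0")
      case False
      then have "\<not> norm y < r" for y :: 'a using norm_ge_zero[of y] by linarith
      then have "indicator (ball 0 r) y = (0::ennreal)" for y :: 'a by (simp add: indicator_def)
      with False show ?thesis by (auto simp: max_def power_0_left)
    qed (use ball in simp)
    finally show ?thesis .
  qed
  have eN: "emeasure ?N {..<r} = ennreal (\<Gamma> * max 0 r ^ ?d)" for r
  proof -
    have "emeasure ?N {..<r} = (\<integral>\<^sup>+x. w x * indicator {..<r} x \<partial>lborel)"
      by (simp add: emeasure_density)
    also have "\<dots> = (\<integral>\<^sup>+x. ennreal (\<Gamma> * real ?d * x ^ (?d - 1)) * indicator {0..max 0 r} x \<partial>lborel)"
    proof (intro nn_integral_cong_AE)
      have "AE x in lborel. x \<noteq> max 0 r" by (rule AE_lborel_singleton)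
      then show "AE x in lborel. w x * indicator {..<r} x =
        ennreal (\<Gamma> * real ?d * x ^ (?d - 1)) * indicator {0..max 0 r} x"
        by eventually_elim (auto simp: w_def indicator_def max_def split: if_splits)
    qed
    also have "\<dots> = ennreal (\<Gamma> * max 0 r ^ ?d - \<Gamma> * 0 ^ ?d)"
      using \<Gamma>(2)
      by (intro nn_integral_FTC_Icc[where F="\<lambda>x. \<Gamma> * x ^ ?d"]) (auto intro!: derivative_eq_intros)
    finally show ?thesis by (simp add: power_0_left)
  qed
  have "?M = ?N"
  \<comment> \<open>Half-lines are closed under intersection, generate the Borel sets and have
    finite mass under both measures.\<close>
  proof (rule measure_eqI_generator_eq[where E="range lessThan" and \<Omega>=UNIV and A="\<lambda>n. {..<real n}"])
    show "Int_stable (range (lessThan :: real \<Rightarrow> _))"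
    proof (clarsimp simp: Int_stable_def)
      fix a b :: real
      have "{..<a} \<inter> {..<b} = {..<min a b}" by auto
      then show "{..<a} \<inter> {..<b} \<in> range lessThan" by blast
    qed
    show "sets ?M = sigma_sets UNIV (range lessThan)" "sets ?N = sigma_sets UNIV (range lessThan)"
      by (simp_all add: borel_Iio)
    show "(\<Union>i. {..<real i}) = UNIV" using reals_Archimedean2 by auto
  qed (auto simp: eM eN)
  then have "(\<integral>\<^sup>+r. \<phi> r \<partial>?M) = (\<integral>\<^sup>+r. \<phi> r \<partial>?N)" by simp
  then show ?thesis by (simp add: nn_integral_distr nn_integral_density w_def)
qed

text \<open>Integration in polar coordinates without surface measure: the angular integral of
  \<open>G\<close> is \<open>DIM('a)\<close> times its integral over the unit ball. The set
  \<open>S\<close> of radii is kept general to cover both balls and their complements.\<close>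

lemma homogeneous_moment_nn:
  fixes G :: "'a::euclidean_space \<Rightarrow> real"
  assumes [measurable]: "G \<in> borel_measurable borel" and G0: "\<And>y. 0 \<le> G y" and GB: "\<And>y. G y \<le> B"
    and hom: "\<And>c y. c > 0 \<Longrightarrow> G (c *\<^sub>R y) = G y"
    and S: "S \<in> sets borel" "S \<subseteq> {0..}"
    and I: "((\<lambda>r. r powr (a + real DIM('a) - 1)) has_integral I) S"
  shows "has_bochner_integral lborel (\<lambda>y. indicator S (norm y) * (G y * norm y powr a))
    ((\<integral>y. indicator (ball 0 1) y * G y \<partial>lborel) * real DIM('a) * I)"
proof -
  let ?d = "DIM('a)"
  let ?\<Gamma> = "\<integral>y. indicator (ball 0 1) y * G y \<partial>lborel"
  have [measurable]: "S \<in> sets borel" by fact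
  have "integrable lborel (\<lambda>y. indicator (ball 0 1) y * G y)"
  proof (rule Bochner_Integration.integrable_bound)
    show "integrable lborel (\<lambda>y::'a. indicator (ball 0 1) y *\<^sub>R B)"
      using emeasure_bounded_finite[OF bounded_ball, of "0::'a" 1]
      by (intro integrable_scaleR_left) (simp add: integrable_indicator_iff)
    show "AE y in lborel. norm (indicator (ball 0 1) y * G y) \<le> norm (indicator (ball 0 1) y *\<^sub>R B)"
      using G0 order_trans[OF GB abs_ge_self[of B]] by (auto simp: indicator_def)
  qed (auto intro!: borel_measurable_times borel_measurable_indicator)
  then have \<Gamma>: "(\<integral>\<^sup>+y. indicator (ball 0 1) y * ennreal (G y) \<partial>lborel) = ennreal ?\<Gamma>"
    using G0 by (subst nn_integral_eq_integral[symmetric]) (auto simp: ennreal_mult ennreal_indicator)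
  have \<Gamma>0: "?\<Gamma> \<ge> 0" using G0 by (intro integral_nonneg_AE) auto
  have I0: "I \<ge> 0" using I by (rule has_integral_nonneg) auto
  have "(\<integral>\<^sup>+y. ennreal (indicator S (norm y) * (G y * norm y powr a)) \<partial>lborel)
     = (\<integral>\<^sup>+y. ennreal (G y) * (\<lambda>r. ennreal (indicator S r * r powr a)) (norm y) \<partial>lborel)"
    using G0 by (intro nn_integral_cong) (auto simp: ennreal_mult[symmetric] mult_ac)
  also have "\<dots> = (\<integral>\<^sup>+r. ennreal (?\<Gamma> * real ?d * r ^ (?d - 1)) * indicator {0..} r *
      ennreal (indicator S r * r powr a) \<partial>lborel)"
    by (rule polar_nn_integral[OF _ _ _ \<Gamma> \<Gamma>0]) (auto simp: hom)
  also have "\<dots> = (\<integral>\<^sup>+r. ennreal (?\<Gamma> * real ?d) * (ennreal (r powr (a + real ?d - 1)) * indicator S r) \<partial>lborel)"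
  proof (intro nn_integral_cong_AE)
    have "AE r in lborel. r \<noteq> (0::real)" by (rule AE_lborel_singleton)
    then show "AE r in lborel. ennreal (?\<Gamma> * real ?d * r ^ (?d - 1)) * indicator {0..} r *
      ennreal (indicator S r * r powr a) = ennreal (?\<Gamma> * real ?d) * (ennreal (r powr (a + real ?d - 1)) * indicator S r)"
    proof eventually_elim
      fix r :: real assume r: "r \<noteq> 0"
      show "ennreal (?\<Gamma> * real ?d * r ^ (?d - 1)) * indicator {0..} r *
      ennreal (indicator S r * r powr a) = ennreal (?\<Gamma> * real ?d) * (ennreal (r powr (a + real ?d - 1)) * indicator S r)"
      proof (cases "r \<in> S")
        case True
        then have r0: "r > 0" using S(2) r by auto
        have "r ^ (?d - 1) = r powr (real ?d - 1)" using r0 by (simp add: powr_realpow[symmetric] of_nat_diff Suc_leI)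
        then have "?\<Gamma> * real ?d * r ^ (?d - 1) * (r powr a) = ?\<Gamma> * real ?d * r powr (a + real ?d - 1)"
          using r0 by (simp add: powr_add[symmetric] algebra_simps)
        then show ?thesis using True r0 \<Gamma>0 by (simp add: ennreal_mult[symmetric])
      qed simp
    qed
  qed
  also have "\<dots> = ennreal (?\<Gamma> * real ?d) * ennreal I"
    using nn_integral_has_integral_lebesgue'[OF _ I] by (simp add: nn_integral_cmult)
  also have "\<dots> = ennreal (?\<Gamma> * real ?d * I)" using \<Gamma>0 I0 by (simp add: ennreal_mult[symmetric])
  finally show ?thesis
    using G0 \<Gamma>0 I0 by (intro has_bochner_integral_nn_integral) auto
qed

lemma homogeneous_moment_ball:
  fixes G :: "'a::euclidean_space \<Rightarrow> real"
  assumes [measurable]: "G \<in> borel_measurable borel" and GB: "\<And>y. \<bar>G y\<bar> \<le> B"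
    and hom: "\<And>c y. c > 0 \<Longrightarrow> G (c *\<^sub>R y) = G y"
    and R: "R \<ge> 0" and a: "a + real DIM('a) > 0"
  shows "has_bochner_integral lborel (\<lambda>y. indicator (ball 0 R) y * (G y * norm y powr a))
    ((\<integral>y. indicator (ball 0 1) y * G y \<partial>lborel) * real DIM('a) * (R powr (a + real DIM('a)) / (a + real DIM('a))))"
proof -
  let ?d = "DIM('a)" and ?e = "a + real DIM('a)"
  let ?I = "R powr ?e / ?e"
  have "((\<lambda>r. r powr (?e - 1)) has_integral (R powr (?e - 1 + 1) / (?e - 1 + 1))) {0..R}"
    using a R by (intro has_integral_powr_from_0) auto
  then have "((\<lambda>r. r powr (?e - 1)) has_integral ?I) {0..R}" by simp
  then have I: "((\<lambda>r. r powr (?e - 1)) has_integral ?I) {0..<R}"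
    by (subst has_integral_spike_set_eq[where T="{0..R}"])
      (auto intro!: negligible_subset[OF negligible_sing[of R]])
  have ind: "indicator {0..<R} (norm y) = (indicator (ball 0 R) y :: real)" for y :: 'a
    by (auto simp: indicator_def)
  have B: "B \<ge> 0" using GB[of 0] by linarith
  note nn = homogeneous_moment_nn[where S="{0..<R}", OF _ _ _ _ _ _ I, unfolded ind]
  \<comment> \<open>Adding the constant \<open>B\<close> makes \<open>G\<close> nonnegative; the
    moment of the constant is subtracted again afterwards.\<close>
  have i1: "has_bochner_integral lborel (\<lambda>y. indicator (ball 0 R) y * ((G y + B) * norm y powr a))
    ((\<integral>y. indicator (ball 0 1) y * (G y + B) \<partial>lborel) * real ?d * ?I)"
  proof (rule nn[of "\<lambda>y. G y + B" "2 * B"])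
    show "0 \<le> G y + B" "G y + B \<le> 2 * B" for y using GB[of y] by linarith+
  qed (use hom in auto)
  have i2: "has_bochner_integral lborel (\<lambda>y::'a. indicator (ball 0 R) y * (B * norm y powr a))
    ((\<integral>y. indicator (ball (0::'a) 1) y * B \<partial>lborel) * real ?d * ?I)"
    using B by (intro nn[of "\<lambda>y. B" B]) auto
  have bi: "integrable lborel (\<lambda>y::'a. indicator (ball 0 1) y * B)"
    using emeasure_bounded_finite[OF bounded_ball, of "0::'a" 1] by (simp add: integrable_indicator_iff)
  have gi: "integrable lborel (\<lambda>y::'a. indicator (ball 0 1) y * G y)"
    by (rule Bochner_Integration.integrable_bound[OF bi]) (use GB in \<open>auto simp: indicator_def intro: order_trans[OF _ abs_ge_self]\<close>)
  have eq: "(\<integral>y. indicator (ball 0 1) y * (G y + B) \<partial>lborel)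
     = (\<integral>y. indicator (ball 0 1) y * G y \<partial>lborel) + (\<integral>y. indicator (ball (0::'a) 1) y * B \<partial>lborel)"
    using gi bi by (simp add: distrib_left)
  have "has_bochner_integral lborel (\<lambda>y. indicator (ball 0 R) y * ((G y + B) * norm y powr a)
      - indicator (ball 0 R) y * (B * norm y powr a))
    ((\<integral>y. indicator (ball 0 1) y * (G y + B) \<partial>lborel) * real ?d * ?I
      - (\<integral>y. indicator (ball (0::'a) 1) y * B \<partial>lborel) * real ?d * ?I)"
    by (rule has_bochner_integral_diff[OF i1 i2])
  also have "(\<integral>y. indicator (ball 0 1) y * (G y + B) \<partial>lborel) * real ?d * ?I
      - (\<integral>y. indicator (ball (0::'a) 1) y * B \<partial>lborel) * real ?d * ?I
     = (\<integral>y. indicator (ball 0 1) y * G y \<partial>lborel) * real ?d * ?I"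
    unfolding eq by (simp only: distrib_right add_diff_cancel_right')
  finally show ?thesis by (simp add: algebra_simps)
qed

lemma integral_indicator_unit_ball:
  "(\<integral>y. indicator (ball (0::'a::euclidean_space) 1) y \<partial>lborel) = unit_ball_vol (real DIM('a))"
  using content_ball[of 1 "0::'a"] by simp

lemma norm_powr_ball:
  assumes "R \<ge> 0" "a + real DIM('a::euclidean_space) > 0"
  shows "has_bochner_integral lborel (\<lambda>y::'a. indicator (ball 0 R) y * norm y powr a)
    (unit_ball_vol (real DIM('a)) * real DIM('a) / (a + real DIM('a)) * R powr (a + real DIM('a)))"
  using homogeneous_moment_ball[of "\<lambda>_::'a. 1" 1 R a] assms integral_indicator_unit_ball[where 'a='a]
  by (simp add: mult_ac)

lemma norm_powr_tail:
  assumes "R > 0" "a + real DIM('a::euclidean_space) < 0"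
  shows "has_bochner_integral lborel (\<lambda>y::'a. indicator (- ball 0 R) y * norm y powr a)
    (unit_ball_vol (real DIM('a)) * real DIM('a) / (- (a + real DIM('a))) * R powr (a + real DIM('a)))"
proof -
  let ?e = "a + real DIM('a)"
  have "((\<lambda>r. r powr (?e - 1)) has_integral - (R powr (?e - 1 + 1)) / (?e - 1 + 1)) {R..}"
    using assms by (intro has_integral_powr_to_inf) auto
  then have I: "((\<lambda>r. r powr (?e - 1)) has_integral (R powr ?e / - ?e)) {R..}" by (simp add: minus_divide_right)
  have ind: "indicator {R..} (norm y) = (indicator (- ball 0 R) y :: real)" for y :: 'a
    by (auto simp: indicator_def)
  from homogeneous_moment_nn[where S="{R..}" and G="\<lambda>_::'a. 1" and B=1, OF _ _ _ _ _ _ I, unfolded ind] assms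
  show ?thesis using integral_indicator_unit_ball[where 'a='a] by (simp add: mult_ac)
qed

section \<open>The regularised kernel\<close>

text \<open>Dimensionless form of the first coefficient: \<gamma> = - A \<epsilon>^(-d-2s-2), and
  likewise \<nu> = B \<epsilon>^(-d-2s-3) below, so the rescaled kernel depends on r / \<epsilon>
  only.\<close>

definition kernel_A :: "real \<Rightarrow> real \<Rightarrow> real" where
  "kernel_A d s = (4 + d) * (d + 2 * s) * (3 + d + 2 * s) / (4 * (1 - s))"

definition kernel_B :: "real \<Rightarrow> real \<Rightarrow> real" where
  "kernel_B d s = (5 + d) * (d + 2 * s) * (2 + d + 2 * s) / (6 * (1 - s))"

lemma reg_kernel_inner:
  assumes "0 < \<epsilon>" "r < \<epsilon>"
  shows "reg_kernel d s \<epsilon> r = \<epsilon> powr (- d - 2 * s) *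
    (1 + kernel_A d s * (1 - (r / \<epsilon>)\<^sup>2) - kernel_B d s * (1 - (r / \<epsilon>) ^ 3))"
proof -
  have e: "\<epsilon> powr (- d - 2 * s - 2) = \<epsilon> powr (- d - 2 * s) / \<epsilon>\<^sup>2"
    "\<epsilon> powr (- d - 2 * s - 3) = \<epsilon> powr (- d - 2 * s) / \<epsilon> ^ 3"
    using assms(1) powr_realpow[of \<epsilon> 2] powr_realpow[of \<epsilon> 3] by (simp_all add: powr_diff)
  have 1: "kernel_gamma d s \<epsilon> * (r\<^sup>2 - \<epsilon>\<^sup>2) = \<epsilon> powr (- d - 2 * s) * (kernel_A d s * (1 - (r / \<epsilon>)\<^sup>2))"
  proof -
    have "r\<^sup>2 - \<epsilon>\<^sup>2 = - \<epsilon>\<^sup>2 * (1 - (r / \<epsilon>)\<^sup>2)" using assms(1) by (simp add: field_simps)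
    then show ?thesis using assms(1) unfolding kernel_gamma_def e kernel_A_def[symmetric] by simp
  qed
  have 2: "kernel_nu d s \<epsilon> * (r ^ 3 - \<epsilon> ^ 3) = - (\<epsilon> powr (- d - 2 * s) * (kernel_B d s * (1 - (r / \<epsilon>) ^ 3)))"
  proof -
    have "r ^ 3 - \<epsilon> ^ 3 = - (\<epsilon> ^ 3) * (1 - (r / \<epsilon>) ^ 3)" using assms(1) by (simp add: field_simps)
    then show ?thesis using assms(1) unfolding kernel_nu_def e kernel_B_def[symmetric] by simp
  qed
  have "reg_kernel d s \<epsilon> r = \<epsilon> powr (- d - 2 * s) + kernel_gamma d s \<epsilon> * (r\<^sup>2 - \<epsilon>\<^sup>2) + kernel_nu d s \<epsilon> * (r ^ 3 - \<epsilon> ^ 3)"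
    using assms(2) by (simp add: reg_kernel_def)
  then show ?thesis unfolding 1 2 by (simp add: algebra_simps)
qed

text \<open>In fact 2 A - 3 B = d + 2s, which says that the polynomial part of the kernel has the
  slope of r^(-d-2s) at r = \<epsilon>.\<close>

lemma kernel_consts:
  assumes "0 < s" "s < 1" "0 \<le> d"
  shows "0 \<le> kernel_A d s" "0 \<le> kernel_B d s" "3 * kernel_B d s \<le> 2 * kernel_A d s"
proof -
  let ?t = "d + 2 * s"
  have t: "?t \<ge> 0" using assms by simp
  show "0 \<le> kernel_A d s" "0 \<le> kernel_B d s"
    unfolding kernel_A_def kernel_B_def using assms by (auto intro!: divide_nonneg_pos mult_nonneg_nonneg)
  have "2 * kernel_A d s = ?t * ((4 + d) * (3 + ?t)) / (2 * (1 - s))"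
    "3 * kernel_B d s = ?t * ((5 + d) * (2 + ?t)) / (2 * (1 - s))"
    unfolding kernel_A_def kernel_B_def using assms(2) by (simp_all add: divide_simps mult_ac add_ac)
  then have "2 * kernel_A d s - 3 * kernel_B d s = ?t * ((4 + d) * (3 + ?t) - (5 + d) * (2 + ?t)) / (2 * (1 - s))"
    by (simp only: diff_divide_distrib[symmetric] right_diff_distrib)
  also have "(4 + d) * (3 + ?t) - (5 + d) * (2 + ?t) = 2 * (1 - s)" by (simp add: algebra_simps)
  finally have "2 * kernel_A d s - 3 * kernel_B d s = ?t" using assms(2) by simp
  then show "3 * kernel_B d s \<le> 2 * kernel_A d s" using t by linarith
qed

lemma reg_kernel_inner_bounds:
  assumes s: "0 < s" "s < 1" "0 \<le> d" and r: "0 < \<epsilon>" "0 \<le> r" "r < \<epsilon>"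
  shows "\<epsilon> powr (- d - 2 * s) \<le> reg_kernel d s \<epsilon> r"
    "reg_kernel d s \<epsilon> r \<le> (1 + kernel_A d s) * \<epsilon> powr (- d - 2 * s)"
proof -
  define \<rho> where "\<rho> = r / \<epsilon>"
  have \<rho>: "0 \<le> \<rho>" "\<rho> \<le> 1" using r by (auto simp: \<rho>_def)
  note AB = kernel_consts[OF s]
  \<comment> \<open>The product is 1 - 3 \<rho>^2 + 2 \<rho>^3. Together with 3 B at most 2 A it
    makes the polynomial correction nonnegative.\<close>
  have "0 \<le> (1 - \<rho>)\<^sup>2 * (1 + 2 * \<rho>)" using \<rho> by (intro mult_nonneg_nonneg) auto
  then have "2 * (1 - \<rho> ^ 3) \<le> 3 * (1 - \<rho>\<^sup>2)" by (simp add: power2_eq_square power3_eq_cube algebra_simps)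
  then have "kernel_B d s * (2 * (1 - \<rho> ^ 3)) \<le> kernel_B d s * (3 * (1 - \<rho>\<^sup>2))"
    using AB by (intro mult_left_mono)
  moreover have "3 * kernel_B d s * (1 - \<rho>\<^sup>2) \<le> 2 * kernel_A d s * (1 - \<rho>\<^sup>2)"
    using AB \<rho> by (intro mult_right_mono) (auto simp: power_le_one)
  ultimately have 1: "kernel_B d s * (1 - \<rho> ^ 3) \<le> kernel_A d s * (1 - \<rho>\<^sup>2)" by (simp add: algebra_simps)
  have 2: "0 \<le> kernel_B d s * (1 - \<rho> ^ 3)" using AB \<rho> by (intro mult_nonneg_nonneg) (auto simp: power_le_one)
  have 3: "kernel_A d s * (1 - \<rho>\<^sup>2) \<le> kernel_A d s * 1" using AB \<rho> by (intro mult_left_mono) auto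
  have K: "reg_kernel d s \<epsilon> r = \<epsilon> powr (- d - 2 * s) *
    (1 + kernel_A d s * (1 - \<rho>\<^sup>2) - kernel_B d s * (1 - \<rho> ^ 3))"
    unfolding \<rho>_def by (rule reg_kernel_inner[OF r(1,3)])
  show "\<epsilon> powr (- d - 2 * s) \<le> reg_kernel d s \<epsilon> r"
    unfolding K using 1 mult_left_mono[of 1 "1 + kernel_A d s * (1 - \<rho>\<^sup>2) - kernel_B d s * (1 - \<rho> ^ 3)" "\<epsilon> powr (- d - 2 * s)"]
    by simp
  show "reg_kernel d s \<epsilon> r \<le> (1 + kernel_A d s) * \<epsilon> powr (- d - 2 * s)"
    unfolding K mult.commute[of "1 + kernel_A d s"] using 2 3 by (intro mult_left_mono) auto
qed

text \<open>Nonnegativity is what a maximum principle needs. The first upper bound controls the mass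
  near the origin, the second compares with the singular kernel; the latter excludes
  \<open>r = 0\<close>, where \<open>powr\<close> returns 0.\<close>

lemma reg_kernel_bounds:
  assumes s: "0 < s" "s < 1" "0 \<le> d" and r: "0 < \<epsilon>" "0 \<le> r"
  shows "0 \<le> reg_kernel d s \<epsilon> r" "reg_kernel d s \<epsilon> r \<le> (1 + kernel_A d s) * \<epsilon> powr (- d - 2 * s)"
    "0 < r \<Longrightarrow> reg_kernel d s \<epsilon> r \<le> (1 + kernel_A d s) * r powr (- d - 2 * s)"
proof -
  note A = kernel_consts(1)[OF s]
  have A1: "x \<le> (1 + kernel_A d s) * x" if "x \<ge> 0" for x using mult_right_mono[of 1 "1 + kernel_A d s" x] A that by simp
  have mono: "y powr (- d - 2 * s) \<le> x powr (- d - 2 * s)" if "0 < x" "x \<le> y" for x y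
    using that s by (intro powr_mono2') auto
  show "0 \<le> reg_kernel d s \<epsilon> r"
  proof (cases "r < \<epsilon>")
    case True
    then show ?thesis using reg_kernel_inner_bounds(1)[OF s r True] by (meson order_trans powr_ge_zero)
  qed (simp add: reg_kernel_def)
  show "reg_kernel d s \<epsilon> r \<le> (1 + kernel_A d s) * \<epsilon> powr (- d - 2 * s)"
  proof (cases "r < \<epsilon>")
    case False
    then have "reg_kernel d s \<epsilon> r \<le> \<epsilon> powr (- d - 2 * s)" using mono[of \<epsilon> r] r by (simp add: reg_kernel_def)
    then show ?thesis using A1[of "\<epsilon> powr (- d - 2 * s)"] by simp
  qed (use reg_kernel_inner_bounds(2)[OF s r] in simp)
  show "reg_kernel d s \<epsilon> r \<le> (1 + kernel_A d s) * r powr (- d - 2 * s)" if "0 < r"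
  proof (cases "r < \<epsilon>")
    case True
    have "(1 + kernel_A d s) * \<epsilon> powr (- d - 2 * s) \<le> (1 + kernel_A d s) * r powr (- d - 2 * s)"
      using mono[of r \<epsilon>] True that A by (intro mult_left_mono) auto
    then show ?thesis using reg_kernel_inner_bounds(2)[OF s r True] by simp
  next
    case False
    then show ?thesis using A1[of "r powr (- d - 2 * s)"] by (simp add: reg_kernel_def)
  qed
qed

lemma measurable_reg_kernel [measurable]: "reg_kernel d s \<epsilon> \<in> borel_measurable borel"
  unfolding reg_kernel_def[abs_def] by measurable

text \<open>On the ball the integrand is a combination of the radial powers 2 - d - 2s, 2, 4 and 5,
  all with the same angular factor \<open>G\<close>. The vanishing of the sum is one linear equation
  for A and B; together with the matching of slopes at \<epsilon> it determines both
  coefficients.\<close>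

lemma kernel_second_moment:
  fixes G :: "'a::euclidean_space \<Rightarrow> real"
  assumes s: "0 < s" "s < 1" and \<epsilon>: "0 < \<epsilon>"
    and G: "G \<in> borel_measurable borel" "\<And>y. \<bar>G y\<bar> \<le> B" "\<And>c y. c > 0 \<Longrightarrow> G (c *\<^sub>R y) = G y"
  shows "has_bochner_integral lborel (\<lambda>y. indicator (ball 0 \<epsilon>) y * (G y * (norm y)\<^sup>2 *
    (norm y powr (- real DIM('a) - 2 * s) - reg_kernel (real DIM('a)) s \<epsilon> (norm y)))) 0"
proof -
  define d where "d = real DIM('a)"
  have d: "d \<ge> 0" by (simp add: d_def)
  define A where "A = kernel_A d s"
  define Bk where "Bk = kernel_B d s"
  define \<Gamma> where "\<Gamma> = (\<integral>y. indicator (ball 0 1) y * G y \<partial>lborel)"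
  define e where "e = \<epsilon> powr (- d - 2 * s)"
  have m: "has_bochner_integral lborel (\<lambda>y. indicator (ball 0 \<epsilon>) y * (G y * norm y powr a))
    (\<Gamma> * d * (\<epsilon> powr (a + d) / (a + d)))" if "a + d > 0" for a
    unfolding \<Gamma>_def d_def using that \<epsilon> by (intro homogeneous_moment_ball[OF G]) (auto simp: d_def)
  let ?f = "\<lambda>a y. indicator (ball 0 \<epsilon>) y * (G y * norm y powr a)"
  let ?I = "\<lambda>a. \<Gamma> * d * (\<epsilon> powr (a + d) / (a + d))"
  have sum: "has_bochner_integral lborel (\<lambda>y. ?f (2 - d - 2 * s) y - (e * (1 + A - Bk)) * ?f 2 y + (e * A / \<epsilon>\<^sup>2) * ?f 4 y
      - (e * Bk / \<epsilon> ^ 3) * ?f 5 y)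
     (?I (2 - d - 2 * s) - (e * (1 + A - Bk)) * ?I 2 + (e * A / \<epsilon>\<^sup>2) * ?I 4 - (e * Bk / \<epsilon> ^ 3) * ?I 5)"
    using d s by (intro has_bochner_integral_diff has_bochner_integral_add has_bochner_integral_mult_right m) auto
  have p: "e * \<epsilon> powr (2 + d) = \<epsilon> powr (2 - 2 * s)" "e / \<epsilon>\<^sup>2 * \<epsilon> powr (4 + d) = \<epsilon> powr (2 - 2 * s)"
    "e / \<epsilon> ^ 3 * \<epsilon> powr (5 + d) = \<epsilon> powr (2 - 2 * s)"
  proof -
    have e: "e / \<epsilon>\<^sup>2 = \<epsilon> powr (- d - 2 * s - 2)" "e / \<epsilon> ^ 3 = \<epsilon> powr (- d - 2 * s - 3)"
      using \<epsilon> powr_realpow[OF \<epsilon>, of 2] powr_realpow[OF \<epsilon>, of 3] by (simp_all add: powr_diff e_def)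
    show "e * \<epsilon> powr (2 + d) = \<epsilon> powr (2 - 2 * s)" "e / \<epsilon>\<^sup>2 * \<epsilon> powr (4 + d) = \<epsilon> powr (2 - 2 * s)"
      "e / \<epsilon> ^ 3 * \<epsilon> powr (5 + d) = \<epsilon> powr (2 - 2 * s)"
      unfolding e unfolding e_def powr_add[symmetric] by (simp_all add: algebra_simps)
  qed
  have "?I (2 - d - 2 * s) - (e * (1 + A - Bk)) * ?I 2 + (e * A / \<epsilon>\<^sup>2) * ?I 4 - (e * Bk / \<epsilon> ^ 3) * ?I 5
    = \<Gamma> * d * (\<epsilon> powr (2 - 2 * s) / (2 - 2 * s) - (1 + A - Bk) * (e * \<epsilon> powr (2 + d)) / (2 + d)
       + A * (e / \<epsilon>\<^sup>2 * \<epsilon> powr (4 + d)) / (4 + d) - Bk * (e / \<epsilon> ^ 3 * \<epsilon> powr (5 + d)) / (5 + d))"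
    by (simp add: algebra_simps)
  also have "\<dots> = \<Gamma> * d * \<epsilon> powr (2 - 2 * s) *
      (1 / (2 - 2 * s) - (1 + A - Bk) / (2 + d) + A / (4 + d) - Bk / (5 + d))"
    unfolding p by (simp add: algebra_simps)
  also have "1 / (2 - 2 * s) - (1 + A - Bk) / (2 + d) + A / (4 + d) - Bk / (5 + d) = 0"
  proof -
    define t where "t = d + 2 * s"
    \<comment> \<open>The factors 4 + d and 5 + d cancel the denominators left by the powers 4 and
      5.\<close>
    have A': "A = (4 + d) * (t * (3 + t) / (4 * (1 - s)))" and B': "Bk = (5 + d) * (t * (2 + t) / (6 * (1 - s)))"
      unfolding A_def Bk_def kernel_A_def kernel_B_def t_def by (simp_all add: algebra_simps)
    define a where "a = t * (3 + t) / (4 * (1 - s))"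
    define b where "b = t * (2 + t) / (6 * (1 - s))"
    have "(1 + A - Bk) / (2 + d) = 1 / (2 - 2 * s) + a - b"
    proof -
      have "1 + A - Bk = (2 + d) * (1 / (2 - 2 * s) + a - b)"
      proof -
        have "2 * a = t * (3 + t) / (2 * (1 - s))" "3 * b = t * (2 + t) / (2 * (1 - s))"
          unfolding a_def b_def using s by (simp_all add: divide_simps)
        then have "2 * a - 3 * b = t / (2 * (1 - s))"
          by (simp only: diff_divide_distrib[symmetric] right_diff_distrib[symmetric]) simp
        moreover have "1 + (4 + d) * a - (5 + d) * b = (1 + (2 * a - 3 * b)) + (2 + d) * (a - b)"
          by (simp add: algebra_simps)
        ultimately have "1 + (4 + d) * a - (5 + d) * b = (1 + t / (2 * (1 - s))) + (2 + d) * (a - b)"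
          by (simp only:)
        also have "1 + t / (2 * (1 - s)) = (2 + d) * (1 / (2 - 2 * s))" unfolding t_def using s by (simp add: field_simps)
        also have "(2 + d) * (1 / (2 - 2 * s)) + (2 + d) * (a - b) = (2 + d) * (1 / (2 - 2 * s) + a - b)"
          by (simp only: distrib_left[symmetric] add_diff_eq)
        finally show ?thesis unfolding A' B' a_def[symmetric] b_def[symmetric] .
      qed
      then show ?thesis using d by simp
    qed
    then show ?thesis using d unfolding A' B' a_def[symmetric] b_def[symmetric] by simp
  qed
  finally have zero: "?I (2 - d - 2 * s) - (e * (1 + A - Bk)) * ?I 2 + (e * A / \<epsilon>\<^sup>2) * ?I 4 - (e * Bk / \<epsilon> ^ 3) * ?I 5 = 0"
    by simp
  have eq: "?f (2 - d - 2 * s) y - (e * (1 + A - Bk)) * ?f 2 y + (e * A / \<epsilon>\<^sup>2) * ?f 4 y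
      - (e * Bk / \<epsilon> ^ 3) * ?f 5 y
      = indicator (ball 0 \<epsilon>) y * (G y * (norm y)\<^sup>2 * (norm y powr (- d - 2 * s) - reg_kernel d s \<epsilon> (norm y)))" for y
  proof (cases "y = 0 \<or> y \<notin> ball 0 \<epsilon>")
    case False
    then have r: "norm y > 0" "norm y < \<epsilon>" by auto
    define r where "r = norm y"
    have pw: "r powr (2 - d - 2 * s) = r\<^sup>2 * r powr (- d - 2 * s)" "r powr 2 = r\<^sup>2" "r powr 4 = r\<^sup>2 * r\<^sup>2" "r powr 5 = r\<^sup>2 * r ^ 3"
      using r(1) powr_add[of r 2 "- d - 2 * s"] powr_realpow[of r 2] powr_realpow[of r 4] powr_realpow[of r 5]
      unfolding r_def by (simp_all add: power_add[symmetric] algebra_simps)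
    have K: "reg_kernel d s \<epsilon> r = e * (1 + A * (1 - (r / \<epsilon>)\<^sup>2) - Bk * (1 - (r / \<epsilon>) ^ 3))"
      unfolding e_def A_def Bk_def r_def by (rule reg_kernel_inner[OF \<epsilon> r(2)])
    show ?thesis using False unfolding r_def[symmetric] pw K
      by (simp add: power_divide algebra_simps)
  qed auto
  show ?thesis using sum unfolding zero eq unfolding d_def .
qed

section \<open>Taylor expansion\<close>

text \<open>The form D^l u(x)[y, ..., y]. Summing over words of basis vectors rather than
  multi-indices builds in the multinomial coefficients, so Taylor's formula has the plain factor 1 /
  l!.\<close>

definition dir_deriv :: "nat \<Rightarrow> ('a::euclidean_space \<Rightarrow> real) \<Rightarrow> 'a \<Rightarrow> 'a \<Rightarrow> real" where
  "dir_deriv l u x y = (\<Sum>bs\<in>deriv_indices l. (\<Prod>b\<leftarrow>bs. y \<bullet> b) * iter_partial bs u x)"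

lemma deriv_indices_0 [simp]: "deriv_indices 0 = {[]}"
  by (auto simp: deriv_indices_def)

lemma deriv_indices_Suc:
  "deriv_indices (Suc l) = (\<lambda>(b, bs). b # bs) ` (Basis \<times> deriv_indices l)"
  by (auto simp: deriv_indices_def length_Suc_conv image_iff)

lemma finite_deriv_indices [simp]: "finite (deriv_indices l)"
  unfolding deriv_indices_def by (rule finite_lists_length_eq) simp

lemma dir_deriv_0 [simp]: "dir_deriv 0 u x y = u x"
  by (simp add: dir_deriv_def)

lemma dir_deriv_Suc:
  "dir_deriv (Suc l) u x y =
    (\<Sum>bs\<in>deriv_indices l. (\<Prod>b\<leftarrow>bs. y \<bullet> b) *
      (\<Sum>b\<in>Basis. (y \<bullet> b) * frechet_derivative (iter_partial bs u) (at x) b))"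
proof -
  have "dir_deriv (Suc l) u x y = (\<Sum>(b, bs)\<in>Basis \<times> deriv_indices l.
      (y \<bullet> b) * (\<Prod>b\<leftarrow>bs. y \<bullet> b) * frechet_derivative (iter_partial bs u) (at x) b)"
    unfolding dir_deriv_def deriv_indices_Suc
    by (subst sum.reindex) (auto simp: inj_on_def intro!: sum.cong)
  also have "\<dots> = (\<Sum>bs\<in>deriv_indices l. \<Sum>b\<in>Basis.
      (y \<bullet> b) * (\<Prod>b\<leftarrow>bs. y \<bullet> b) * frechet_derivative (iter_partial bs u) (at x) b)"
    by (subst sum.cartesian_product[symmetric], rule sum.swap)
  finally show ?thesis by (simp add: sum_distrib_left mult_ac)
qed

lemma dir_deriv_1: "dir_deriv 1 u x y = (\<Sum>b\<in>Basis. iter_partial [b] u x *\<^sub>R b) \<bullet> y"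
  unfolding One_nat_def dir_deriv_Suc by (simp add: inner_sum_left mult.commute inner_commute[of y])

lemma dir_deriv_scale: "dir_deriv l u x (c *\<^sub>R y) = c ^ l * dir_deriv l u x y"
proof -
  have "(\<Prod>b\<leftarrow>bs. (c *\<^sub>R y) \<bullet> b) = c ^ length bs * (\<Prod>b\<leftarrow>bs. y \<bullet> b)" for bs :: "'a list"
    by (induction bs) (auto simp: mult_ac)
  then show ?thesis
    unfolding dir_deriv_def sum_distrib_left
    by (intro sum.cong) (auto simp: deriv_indices_def simp del: inner_scaleR_left)
qed

lemma dir_deriv_minus: "dir_deriv l u x (- y) = (- 1) ^ l * dir_deriv l u x y"
  using dir_deriv_scale[of l u x "-1" y] by simp

lemma continuous_dir_deriv: "continuous_on UNIV (dir_deriv l u x)"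
proof -
  have "continuous_on UNIV (\<lambda>y. \<Prod>b\<leftarrow>bs. y \<bullet> b)" for bs :: "'a list"
    by (induction bs) (auto intro!: continuous_intros)
  then show ?thesis unfolding dir_deriv_def[abs_def] by (intro continuous_intros)
qed

lemma dir_deriv_diff_le:
  fixes u :: "'a::euclidean_space \<Rightarrow> real"
  shows "\<bar>dir_deriv l u x y - dir_deriv l u x' y\<bar>
    \<le> real (card (deriv_indices l :: 'a list set)) * norm y ^ l * deriv_dist l u x x'"
proof -
  have pr: "\<bar>\<Prod>b\<leftarrow>bs. y \<bullet> b\<bar> \<le> norm y ^ length bs" if "set bs \<subseteq> Basis" for bs
    using that
  proof (induction bs)
    case (Cons b bs)
    have "\<bar>y \<bullet> b\<bar> \<le> norm y" using Cons.prems by (intro Basis_le_norm) simp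
    then show ?case using Cons by (simp add: abs_mult mult_mono)
  qed simp
  have "\<bar>dir_deriv l u x y - dir_deriv l u x' y\<bar> = \<bar>\<Sum>bs\<in>deriv_indices l. (\<Prod>b\<leftarrow>bs. y \<bullet> b) * (iter_partial bs u x - iter_partial bs u x')\<bar>"
    unfolding dir_deriv_def sum_subtractf[symmetric] by (simp add: right_diff_distrib)
  also have "\<dots> \<le> (\<Sum>bs\<in>deriv_indices l. \<bar>(\<Prod>b\<leftarrow>bs. y \<bullet> b) * (iter_partial bs u x - iter_partial bs u x')\<bar>)"
    by (rule sum_abs)
  also have "\<dots> \<le> (\<Sum>bs\<in>(deriv_indices l :: 'a list set). norm y ^ l * deriv_dist l u x x')"
  proof (rule sum_mono)
    fix bs :: "'a list" assume bs: "bs \<in> deriv_indices l"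
    have "\<bar>iter_partial bs u x - iter_partial bs u x'\<bar> \<le> deriv_dist l u x x'"
      unfolding deriv_dist_def
      using member_le_L2_set[OF finite_deriv_indices bs, of "\<lambda>bs. \<bar>iter_partial bs u x - iter_partial bs u x'\<bar>"]
      by (simp add: L2_set_def)
    moreover have "\<bar>\<Prod>b\<leftarrow>bs. y \<bullet> b\<bar> \<le> norm y ^ l" using pr[of bs] bs by (simp add: deriv_indices_def)
    ultimately show "\<bar>(\<Prod>b\<leftarrow>bs. y \<bullet> b) * (iter_partial bs u x - iter_partial bs u x')\<bar> \<le> norm y ^ l * deriv_dist l u x x'"
      unfolding abs_mult by (intro mult_mono) auto
  qed
  also have "\<dots> = real (card (deriv_indices l :: 'a list set)) * norm y ^ l * deriv_dist l u x x'" by simp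
  finally show ?thesis .
qed

lemma dir_deriv_has_derivative:
  assumes C: "Ck_on k \<Omega> u" "l < k" and x: "x + t *\<^sub>R y \<in> \<Omega>"
  shows "((\<lambda>t. dir_deriv l u (x + t *\<^sub>R y) y) has_real_derivative dir_deriv (Suc l) u (x + t *\<^sub>R y) y) (at t)"
proof -
  have "((\<lambda>t. iter_partial bs u (x + t *\<^sub>R y)) has_real_derivative
      (\<Sum>b\<in>Basis. (y \<bullet> b) * frechet_derivative (iter_partial bs u) (at (x + t *\<^sub>R y)) b)) (at t)"
    if bs: "bs \<in> deriv_indices l" for bs
  proof -
    let ?D = "frechet_derivative (iter_partial bs u) (at (x + t *\<^sub>R y))"
    have D: "(iter_partial bs u has_derivative ?D) (at (x + t *\<^sub>R y))"
      using C bs x unfolding Ck_on_def by (simp add: frechet_derivative_works[symmetric])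
    have g: "((\<lambda>t. x + t *\<^sub>R y) has_derivative (\<lambda>r. r *\<^sub>R y)) (at t)"
      by (auto intro!: derivative_eq_intros)
    have lin: "linear ?D" using D by (rule has_derivative_linear)
    have "((\<lambda>t. iter_partial bs u (x + t *\<^sub>R y)) has_derivative (\<lambda>r. ?D (r *\<^sub>R y))) (at t)"
      using has_derivative_compose[OF g D] .
    moreover have "?D y = (\<Sum>b\<in>Basis. (y \<bullet> b) * ?D b)"
    proof -
      have "?D y = ?D (\<Sum>b\<in>Basis. (y \<bullet> b) *\<^sub>R b)" by (simp add: euclidean_representation)
      also have "\<dots> = (\<Sum>b\<in>Basis. (y \<bullet> b) * ?D b)" by (simp add: linear_sum[OF lin] linear_scale[OF lin])
      finally show ?thesis .
    qed
    ultimately show ?thesis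
      unfolding has_field_derivative_def by (simp add: linear_scale[OF lin] mult_commute_abs)
  qed
  then show ?thesis
    unfolding dir_deriv_Suc unfolding dir_deriv_def by (intro DERIV_sum DERIV_cmult)
qed

lemma taylor_dir_deriv:
  assumes C: "Ck_on k \<Omega> u" "n \<le> k" and seg: "closed_segment x (x + y) \<subseteq> \<Omega>"
  obtains \<tau> where "0 < \<tau>" "\<tau> \<le> 1"
    "u (x + y) = (\<Sum>m<n. dir_deriv m u x y / fact m) + dir_deriv n u (x + \<tau> *\<^sub>R y) y / fact n"
proof -
  have mem: "x + t *\<^sub>R y \<in> \<Omega>" if "0 \<le> t" "t \<le> 1" for t
  proof -
    have "x + t *\<^sub>R y = (1 - t) *\<^sub>R x + t *\<^sub>R (x + y)" by (simp add: algebra_simps)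
    then show ?thesis using seg that unfolding closed_segment_def by blast
  qed
  have "\<exists>\<tau>. 0 < \<tau> \<and> \<tau> \<le> 1 \<and> u (x + 1 *\<^sub>R y) =
     (\<Sum>m<n. dir_deriv m u (x + 0 *\<^sub>R y) y / fact m * 1 ^ m) + dir_deriv n u (x + \<tau> *\<^sub>R y) y / fact n * 1 ^ n"
    by (rule Maclaurin2[where diff="\<lambda>m t. dir_deriv m u (x + t *\<^sub>R y) y"])
      (use dir_deriv_has_derivative[OF C(1)] C(2) mem in auto)
  then show ?thesis using that by auto
qed

text \<open>\<open>M\<close> bounds the top-order seminorm in the class S^\<beta> and
  \<open>N\<close> the Hoelder seminorm of order s up to the boundary. Bounds on intermediate
  derivatives are recovered from these two by interpolation.\<close>

locale weighted_hoelder =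
  fixes \<Omega> :: "'a::euclidean_space set" and u :: "'a \<Rightarrow> real" and s \<beta> M N :: real
  assumes open_dom: "open \<Omega>" and bounded_dom: "bounded \<Omega>" and convex_dom: "convex \<Omega>"
    and s01: "0 < s" "s < 1" and beta: "2 * s < \<beta>" "\<beta> < 4" "\<beta> \<notin> \<nat>"
    and Ck: "Ck_on (hoelder_int \<beta>) \<Omega> u"
    and M0: "0 \<le> M" and N0: "0 \<le> N"
    and hoelder: "\<And>\<rho> x x'. 0 < \<rho> \<Longrightarrow> x \<in> \<Omega> \<Longrightarrow> x' \<in> \<Omega> \<Longrightarrow> \<rho> \<le> bdist \<Omega> x \<Longrightarrow> \<rho> \<le> bdist \<Omega> x' \<Longrightarrow>
       deriv_dist (hoelder_int \<beta>) u x x' \<le> M * \<rho> powr (s - \<beta>) * norm (x - x') powr hoelder_frac \<beta>"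
    and hoelder_s: "\<And>x x'. x \<in> closure \<Omega> \<Longrightarrow> x' \<in> closure \<Omega> \<Longrightarrow> \<bar>u x - u x'\<bar> \<le> N * norm (x - x') powr s"
begin

abbreviation k where "k \<equiv> hoelder_int \<beta>"

lemma k_props: "real k < \<beta>" "\<beta> < real k + 1" "hoelder_frac \<beta> = \<beta> - real k" "k \<le> 3"
proof -
  have b: "\<beta> > 0" using beta s01 by linarith
  then have c: "\<lceil>\<beta>\<rceil> \<ge> 1" by linarith
  then have r: "real k = real_of_int \<lceil>\<beta>\<rceil> - 1" by (simp add: hoelder_int_def of_nat_nat)
  have "\<beta> \<noteq> real_of_int \<lceil>\<beta>\<rceil>"
  proof
    assume "\<beta> = real_of_int \<lceil>\<beta>\<rceil>"
    then have "\<beta> = real (nat \<lceil>\<beta>\<rceil>)" using c by simp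
    then show False using beta(3) by (metis of_nat_in_Nats)
  qed
  then show "real k < \<beta>" "\<beta> < real k + 1" using r by linarith+
  then show "k \<le> 3" using beta(2) by linarith
  show "hoelder_frac \<beta> = \<beta> - real k" by (simp add: hoelder_frac_def)
qed

definition "cT = real (card (deriv_indices k :: 'a list set)) * M"

lemma cT_nonneg: "0 \<le> cT" unfolding cT_def using M0 by simp

text \<open>With the Lagrange remainder at order k, the error is the difference of the k-th
  derivative at two points of the segment, to which the Hoelder bound applies.\<close>

lemma taylor_hoelder:
  assumes \<rho>: "0 < \<rho>" and seg: "closed_segment x (x + y) \<subseteq> {x\<in>\<Omega>. \<rho> \<le> bdist \<Omega> x}"
  shows "\<bar>u (x + y) - (\<Sum>m\<le>k. dir_deriv m u x y / fact m)\<bar> \<le> cT * \<rho> powr (s - \<beta>) * norm y powr \<beta>"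
proof -
  let ?n = "real (card (deriv_indices k :: 'a list set))"
  obtain \<tau> where \<tau>: "0 < \<tau>" "\<tau> \<le> 1"
    "u (x + y) = (\<Sum>m<k. dir_deriv m u x y / fact m) + dir_deriv k u (x + \<tau> *\<^sub>R y) y / fact k"
    using taylor_dir_deriv[OF Ck order_refl, of x y] seg by blast
  have "x + \<tau> *\<^sub>R y = (1 - \<tau>) *\<^sub>R x + \<tau> *\<^sub>R (x + y)" by (simp add: algebra_simps)
  then have "x + \<tau> *\<^sub>R y \<in> closed_segment x (x + y)" using \<tau> unfolding closed_segment_def by auto
  then have mem: "x + \<tau> *\<^sub>R y \<in> \<Omega>" "\<rho> \<le> bdist \<Omega> (x + \<tau> *\<^sub>R y)" "x \<in> \<Omega>" "\<rho> \<le> bdist \<Omega> x" using seg by auto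
  have "u (x + y) - (\<Sum>m\<le>k. dir_deriv m u x y / fact m)
     = (dir_deriv k u (x + \<tau> *\<^sub>R y) y - dir_deriv k u x y) / fact k"
    unfolding \<tau>(3) lessThan_Suc_atMost[symmetric] by (simp add: diff_divide_distrib)
  then have "\<bar>u (x + y) - (\<Sum>m\<le>k. dir_deriv m u x y / fact m)\<bar>
      = \<bar>dir_deriv k u (x + \<tau> *\<^sub>R y) y - dir_deriv k u x y\<bar> / fact k" by simp
  also have "\<dots> \<le> \<bar>dir_deriv k u (x + \<tau> *\<^sub>R y) y - dir_deriv k u x y\<bar> / 1"
    by (intro divide_left_mono) (auto simp: fact_ge_1)
  also have "\<dots> \<le> ?n * norm y ^ k * deriv_dist k u (x + \<tau> *\<^sub>R y) x"
    using dir_deriv_diff_le[of k u "x + \<tau> *\<^sub>R y" y x] by simp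
  also have "\<dots> \<le> ?n * norm y ^ k * (M * \<rho> powr (s - \<beta>) * norm y powr (\<beta> - real k))"
  proof (intro mult_left_mono)
    have "deriv_dist k u (x + \<tau> *\<^sub>R y) x \<le> M * \<rho> powr (s - \<beta>) * norm (\<tau> *\<^sub>R y) powr (\<beta> - real k)"
      using hoelder[OF \<rho> mem(1,3,2,4)] by (simp add: k_props(3))
    also have "\<dots> \<le> M * \<rho> powr (s - \<beta>) * norm y powr (\<beta> - real k)"
      using \<tau> k_props(1) M0 by (intro mult_left_mono powr_mono2) (auto simp: mult_left_le_one_le)
    finally show "deriv_dist k u (x + \<tau> *\<^sub>R y) x \<le> M * \<rho> powr (s - \<beta>) * norm y powr (\<beta> - real k)" .
  qed auto
  also have "\<dots> = cT * \<rho> powr (s - \<beta>) * norm y powr \<beta>"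
  proof (cases "y = 0")
    case False
    then have "norm y powr \<beta> = norm y ^ k * norm y powr (\<beta> - real k)"
      by (simp add: powr_add[symmetric] flip: powr_realpow)
    then show ?thesis by (simp add: cT_def mult_ac)
  next
    case True
    then show ?thesis using k_props by simp
  qed
  finally show ?thesis .
qed

lemma half_ball:
  assumes "x \<in> \<Omega>" "norm (x' - x) \<le> bdist \<Omega> x / 2"
  shows "x' \<in> \<Omega>" "bdist \<Omega> x / 2 \<le> bdist \<Omega> x'"
proof -
  have d: "bdist \<Omega> x > 0" using bdist_pos[OF open_dom bounded_dom assms(1)] .
  then show "x' \<in> \<Omega>" using ball_bdist_subset[OF assms(1)] assms(2) by (auto simp: dist_norm norm_minus_commute subset_iff)
  show "bdist \<Omega> x / 2 \<le> bdist \<Omega> x'" using bdist_lipschitz[of \<Omega> x' x] assms(2) by linarith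
qed

lemma half_ball_segment:
  assumes "x \<in> \<Omega>" "norm y \<le> bdist \<Omega> x / 2"
  shows "closed_segment x (x + y) \<subseteq> {x'\<in>\<Omega>. bdist \<Omega> x / 2 \<le> bdist \<Omega> x'}"
proof
  fix p assume "p \<in> closed_segment x (x + y)"
  then have "norm (p - x) \<le> norm y" using segment_bound1[of p x "x + y"] by simp
  then show "p \<in> {x'\<in>\<Omega>. bdist \<Omega> x / 2 \<le> bdist \<Omega> x'}" using half_ball[OF assms(1), of p] assms(2) by simp
qed

text \<open>D^2 u(x)[y, y] without a factor 1/2, because the expansions at y and -y contribute one
  half each. For \<beta> < 2 no second derivative is available and the term is absent.\<close>

definition "hess x y = (if \<beta> < 2 then 0 else dir_deriv 2 u x y)"

lemma hess_scale: "hess x (c *\<^sub>R y) = c\<^sup>2 * hess x y"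
  by (simp add: hess_def dir_deriv_scale)

lemma continuous_hess: "continuous_on UNIV (hess x)"
  unfolding hess_def by (cases "\<beta> < 2") (auto intro: continuous_dir_deriv)

definition "cD = 2 * cT * (1 / 2) powr (s - \<beta>)"

lemma cD_nonneg: "0 \<le> cD" unfolding cD_def using cT_nonneg by simp

text \<open>Odd orders cancel between y and -y. Since \<beta> < 4 gives k at most 3, only orders 0
  and 2 remain.\<close>

lemma second_difference:
  assumes x: "x \<in> \<Omega>" and y: "norm y \<le> bdist \<Omega> x / 2"
  shows "\<bar>2 * u x - u (x - y) - u (x + y) + hess x y\<bar> \<le> cD * bdist \<Omega> x powr (s - \<beta>) * norm y powr \<beta>"
proof -
  let ?P = "\<lambda>y. \<Sum>m\<le>k. dir_deriv m u x y / fact m"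
  let ?d = "bdist \<Omega> x"
  have d: "?d > 0" using bdist_pos[OF open_dom bounded_dom x] .
  have 1: "\<bar>u (x + y) - ?P y\<bar> \<le> cT * (?d / 2) powr (s - \<beta>) * norm y powr \<beta>"
    using taylor_hoelder[OF _ half_ball_segment[OF x y]] d by simp
  have 2: "\<bar>u (x - y) - ?P (- y)\<bar> \<le> cT * (?d / 2) powr (s - \<beta>) * norm y powr \<beta>"
    using taylor_hoelder[OF _ half_ball_segment[OF x, of "- y"]] d y by simp
  have k2: "\<beta> < 2 \<longleftrightarrow> k = 0 \<or> k = 1" and kc: "k = 0 \<or> k = 1 \<or> k = 2 \<or> k = 3"
    using k_props by linarith+
  have "2 * u x + hess x y = ?P y + ?P (- y)"
    using kc
  proof (elim disjE)
    assume k: "k = 0" then show ?thesis using k2 by (simp add: hess_def)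
  next
    assume k: "k = 1"
    have "{..1::nat} = {0,1}" by auto
    then show ?thesis using k2 k by (simp add: hess_def dir_deriv_minus)
  next
    assume k: "k = 2"
    have "{..2::nat} = {0,1,2}" by auto
    then show ?thesis using k2 k by (simp add: hess_def dir_deriv_minus)
  next
    assume k: "k = 3"
    have "{..3::nat} = {0,1,2,3}" by auto
    then show ?thesis using k2 k by (simp add: hess_def dir_deriv_minus)
  qed
  then have "\<bar>2 * u x - u (x - y) - u (x + y) + hess x y\<bar> \<le> 2 * (cT * (?d / 2) powr (s - \<beta>) * norm y powr \<beta>)"
    using 1 2 by linarith
  also have "(?d / 2) powr (s - \<beta>) = (1/2) powr (s - \<beta>) * ?d powr (s - \<beta>)"
    using d powr_mult[of "1/2" ?d "s - \<beta>"] by simp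
  finally show ?thesis unfolding cD_def by (simp add: mult_ac)
qed

abbreviation \<beta>' where "\<beta>' \<equiv> min \<beta> 2"

definition "cH = 4 * (2 * N + cD)"

lemma cH_nonneg: "0 \<le> cH" unfolding cH_def using N0 cD_nonneg by simp

text \<open>Rescale y to length \<delta>/2. There the second difference is of order \<delta>^s by
  the Hoelder bound, and so is the Taylor remainder, hence also the Hessian term. Undoing the
  scaling produces \<delta>^(s-2) and the factor 4 of \<open>cH\<close>.\<close>

lemma hess_bound:
  assumes x: "x \<in> \<Omega>"
  shows "\<bar>hess x y\<bar> \<le> cH * bdist \<Omega> x powr (s - 2) * (norm y)\<^sup>2"
proof (cases "y = 0")
  case True
  then show ?thesis using hess_scale[of x 0 0] by simp
next
  case False
  let ?d = "bdist \<Omega> x"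
  have d: "?d > 0" using bdist_pos[OF open_dom bounded_dom x] .
  define c where "c = ?d / (2 * norm y)"
  have c: "c > 0" using d False by (simp add: c_def)
  have ny: "norm (c *\<^sub>R y) = ?d / 2" using False d by (simp add: c_def)
  have mem: "x + c *\<^sub>R y \<in> \<Omega>" "x - c *\<^sub>R y \<in> \<Omega>"
    using half_ball(1)[OF x, of "x + c *\<^sub>R y"] half_ball(1)[OF x, of "x - c *\<^sub>R y"] ny by simp_all
  have cl: "\<Omega> \<subseteq> closure \<Omega>" by (rule closure_subset)
  have "norm (x - (x + c *\<^sub>R y)) = ?d / 2" "norm (x - (x - c *\<^sub>R y)) = ?d / 2" using ny by simp_all
  then have "\<bar>u x - u (x + c *\<^sub>R y)\<bar> \<le> N * (?d / 2) powr s" "\<bar>u x - u (x - c *\<^sub>R y)\<bar> \<le> N * (?d / 2) powr s"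
    using hoelder_s[of x "x + c *\<^sub>R y"] hoelder_s[of x "x - c *\<^sub>R y"] subsetD[OF cl x]
      subsetD[OF cl mem(1)] subsetD[OF cl mem(2)] by metis+
  moreover have "\<bar>2 * u x - u (x - c *\<^sub>R y) - u (x + c *\<^sub>R y) + hess x (c *\<^sub>R y)\<bar>
     \<le> cD * ?d powr (s - \<beta>) * (?d / 2) powr \<beta>"
    using second_difference[OF x, of "c *\<^sub>R y"] unfolding ny by simp
  ultimately have "\<bar>hess x (c *\<^sub>R y)\<bar> \<le> 2 * N * (?d / 2) powr s + cD * ?d powr (s - \<beta>) * (?d / 2) powr \<beta>"
    by linarith
  also have "\<dots> \<le> 2 * N * ?d powr s + cD * ?d powr (s - \<beta>) * ?d powr \<beta>"
    using d N0 cD_nonneg s01 beta by (intro add_mono mult_left_mono powr_mono2) auto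
  also have "\<dots> = (2 * N + cD) * ?d powr s" using d by (simp add: powr_add[symmetric] algebra_simps)
  finally have "c\<^sup>2 * \<bar>hess x y\<bar> \<le> (2 * N + cD) * ?d powr s" by (simp add: hess_scale abs_mult)
  then have "\<bar>hess x y\<bar> \<le> (2 * N + cD) * ?d powr s / c\<^sup>2" using c by (simp add: field_simps)
  also have "\<dots> = cH * (?d powr s / ?d\<^sup>2) * (norm y)\<^sup>2"
    using d False by (simp add: c_def cH_def power_divide power_mult_distrib)
  also have "?d powr s / ?d\<^sup>2 = ?d powr (s - 2)" using d powr_realpow[of ?d 2] by (simp add: powr_diff)
  finally show ?thesis .
qed

text \<open>Without the Hessian correction the order is capped at 2: on the half ball, |y|^\<beta>
  is at most \<delta>^(\<beta>-2) |y|^2. The capped exponent still exceeds 2s, which makes the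
  symmetrised integral converge absolutely.\<close>

lemma second_difference':
  assumes x: "x \<in> \<Omega>" and y: "norm y \<le> bdist \<Omega> x / 2"
  shows "\<bar>2 * u x - u (x - y) - u (x + y)\<bar> \<le> (cD + cH) * bdist \<Omega> x powr (s - \<beta>') * norm y powr \<beta>'"
proof (cases "\<beta> < 2")
  case True
  have "\<bar>2 * u x - u (x - y) - u (x + y)\<bar> \<le> cD * bdist \<Omega> x powr (s - \<beta>) * norm y powr \<beta>"
    using second_difference[OF assms] True by (simp add: hess_def)
  also have "\<dots> \<le> (cD + cH) * bdist \<Omega> x powr (s - \<beta>) * norm y powr \<beta>"
    using cH_nonneg by (intro mult_right_mono) auto
  finally show ?thesis using True by simp
next
  case False
  let ?d = "bdist \<Omega> x"
  have d: "?d > 0" using bdist_pos[OF open_dom bounded_dom x] .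
  have "?d powr (s - \<beta>) * norm y powr \<beta> \<le> ?d powr (s - 2) * (norm y)\<^sup>2"
  proof (cases "y = 0")
    case False
    then have ny: "norm y > 0" by simp
    have "norm y powr \<beta> = norm y powr (\<beta> - 2) * (norm y)\<^sup>2"
      using ny powr_realpow[OF ny, of 2] by (simp add: powr_diff)
    also have "\<dots> \<le> ?d powr (\<beta> - 2) * (norm y)\<^sup>2"
      using \<open>\<not> \<beta> < 2\<close> y d by (intro mult_right_mono powr_mono2) auto
    finally have "?d powr (s - \<beta>) * norm y powr \<beta> \<le> ?d powr (s - \<beta>) * (?d powr (\<beta> - 2) * (norm y)\<^sup>2)"
      by (intro mult_left_mono) auto
    also have "\<dots> = ?d powr (s - 2) * (norm y)\<^sup>2" using d by (simp add: powr_add[symmetric] mult.assoc[symmetric])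
    finally show ?thesis .
  qed (use s01 beta in simp)
  then have "cD * (?d powr (s - \<beta>) * norm y powr \<beta>) \<le> cD * (?d powr (s - 2) * (norm y)\<^sup>2)"
    using cD_nonneg by (intro mult_left_mono)
  then have "\<bar>2 * u x - u (x - y) - u (x + y)\<bar> \<le> (cD + cH) * ?d powr (s - 2) * (norm y)\<^sup>2"
    using second_difference[OF assms] hess_bound[OF x, of y] by (simp add: algebra_simps)
  also have "(norm y)\<^sup>2 = norm y powr 2" by simp
  finally show ?thesis using False by simp
qed

text \<open>Input for the interpolation error. The affine function is the constant
  \<open>u x\<close> for k = 0 and the Taylor polynomial of degree 1 otherwise; from k = 2 on, the
  error is the quadratic Lagrange term, controlled by \<open>hess_bound\<close>.\<close>

lemma affine_approximation:
  assumes W: "convex W" "W \<subseteq> {x\<in>\<Omega>. D \<le> bdist \<Omega> x}" "0 < D" and x: "x \<in> W"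
  obtains a where "\<And>x'. x' \<in> W \<Longrightarrow> \<bar>u x' - u x - a \<bullet> (x' - x)\<bar> \<le> (cT + cH) * D powr (s - \<beta>') * norm (x' - x) powr \<beta>'"
proof -
  have seg: "closed_segment x (x + (x' - x)) \<subseteq> {x\<in>\<Omega>. D \<le> bdist \<Omega> x}" if "x' \<in> W" for x'
    using closed_segment_subset[OF x that W(1)] W(2) by auto
  let ?a = "\<Sum>b\<in>Basis. iter_partial [b] u x *\<^sub>R b"
  show ?thesis
  proof (cases "k \<ge> 2")
    case True
    show ?thesis
    proof (rule that[of ?a])
      fix x' assume x': "x' \<in> W"
      let ?y = "x' - x"
      obtain \<tau> where \<tau>: "0 < \<tau>" "\<tau> \<le> 1"
        "u (x + ?y) = (\<Sum>m<2. dir_deriv m u x ?y / fact m) + dir_deriv 2 u (x + \<tau> *\<^sub>R ?y) ?y / fact 2"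
        using taylor_dir_deriv[OF Ck True, of x ?y] seg[OF x'] by blast
      have b2: "\<not> \<beta> < 2" using True k_props by linarith
      have "x + \<tau> *\<^sub>R ?y = (1 - \<tau>) *\<^sub>R x + \<tau> *\<^sub>R (x + ?y)" by (simp add: algebra_simps)
      then have "x + \<tau> *\<^sub>R ?y \<in> closed_segment x (x + ?y)" using \<tau> unfolding closed_segment_def by auto
      then have mem: "x + \<tau> *\<^sub>R ?y \<in> \<Omega>" "D \<le> bdist \<Omega> (x + \<tau> *\<^sub>R ?y)" using seg[OF x'] by auto
      have "u x' - u x - ?a \<bullet> ?y = dir_deriv 2 u (x + \<tau> *\<^sub>R ?y) ?y / 2"
        using \<tau>(3) dir_deriv_1[of u x ?y] by (simp add: lessThan_Suc numeral_2_eq_2)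
      then have "\<bar>u x' - u x - ?a \<bullet> ?y\<bar> \<le> \<bar>hess (x + \<tau> *\<^sub>R ?y) ?y\<bar>" using b2 by (simp add: hess_def)
      also have "\<dots> \<le> cH * bdist \<Omega> (x + \<tau> *\<^sub>R ?y) powr (s - 2) * (norm ?y)\<^sup>2" by (rule hess_bound[OF mem(1)])
      also have "\<dots> \<le> cH * D powr (s - 2) * (norm ?y)\<^sup>2"
        using cH_nonneg s01 W(3) mem(2) by (intro mult_right_mono mult_left_mono powr_mono2') auto
      also have "\<dots> \<le> (cT + cH) * D powr (s - 2) * (norm ?y)\<^sup>2"
        using cT_nonneg by (intro mult_right_mono) auto
      finally show "\<bar>u x' - u x - ?a \<bullet> (x' - x)\<bar> \<le> (cT + cH) * D powr (s - \<beta>') * norm (x' - x) powr \<beta>'"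
        using b2 by simp
    qed
  next
    case False
    then have kc: "k = 0 \<or> k = 1" and b2: "\<beta> < 2" using k_props by linarith+
    show ?thesis
    proof (rule that[of "if k = 0 then 0 else ?a"])
      fix x' assume x': "x' \<in> W"
      have "(\<Sum>m\<le>k. dir_deriv m u x (x' - x) / fact m) = u x + (if k = 0 then 0 else ?a) \<bullet> (x' - x)"
        using kc dir_deriv_1[of u x "x' - x"] by (elim disjE) (simp_all del: sum.atMost_Suc_shift)
      then have "\<bar>u x' - u x - (if k = 0 then 0 else ?a) \<bullet> (x' - x)\<bar> \<le> cT * D powr (s - \<beta>) * norm (x' - x) powr \<beta>"
        using taylor_hoelder[OF W(3) seg[OF x']] by (simp add: algebra_simps)
      also have "\<dots> \<le> (cT + cH) * D powr (s - \<beta>) * norm (x' - x) powr \<beta>"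
        using cH_nonneg by (intro mult_right_mono) auto
      finally show "\<bar>u x' - u x - (if k = 0 then 0 else ?a) \<bullet> (x' - x)\<bar> \<le> (cT + cH) * D powr (s - \<beta>') * norm (x' - x) powr \<beta>'"
        using b2 by simp
    qed
  qed
qed

end

section \<open>Integral representations\<close>

lemma lborel_reflect:
  fixes f :: "'a::euclidean_space \<Rightarrow> real"
  assumes [measurable]: "f \<in> borel_measurable borel"
  shows "integrable lborel (\<lambda>y. f (- y)) \<longleftrightarrow> integrable lborel f"
    "(\<integral>y. f (- y) \<partial>lborel) = (\<integral>y. f y \<partial>lborel)"
proof -
  have "density (distr lborel borel (uminus :: 'a \<Rightarrow> 'a)) (\<lambda>_. 1) = lborel"
    using lborel_affine[of "-1" "0::'a"] by simp
  then have eq: "distr lborel borel (uminus :: 'a \<Rightarrow> 'a) = lborel" by (simp add: density_1)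
  show "integrable lborel (\<lambda>y. f (- y)) \<longleftrightarrow> integrable lborel f"
    using integrable_distr_eq[of uminus lborel borel f] by (simp add: eq)
  show "(\<integral>y. f (- y) \<partial>lborel) = (\<integral>y. f y \<partial>lborel)"
    using integral_distr[of uminus lborel borel f] by (simp add: eq)
qed

lemma lborel_translate:
  fixes f :: "'a::euclidean_space \<Rightarrow> real"
  assumes [measurable]: "f \<in> borel_measurable borel"
  shows "integrable lborel (\<lambda>y. f (x + y)) \<longleftrightarrow> integrable lborel f"
    "(\<integral>y. f (x + y) \<partial>lborel) = (\<integral>y. f y \<partial>lborel)"
  using integrable_distr_eq[of "(+) x" lborel borel f] integral_distr[of "(+) x" lborel borel f]
  by (simp_all add: lborel_distr_plus)

text \<open>Passes from integrands containing \<open>\<eta>\<close>, which are only Lebesgue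
  measurable, to Borel integrands that agree off a null set.\<close>

lemma lebesgue_integral_spike_borel:
  fixes f h :: "'a::euclidean_space \<Rightarrow> real"
  assumes h: "h \<in> borel_measurable borel" and N: "negligible N" "\<And>y. y \<notin> N \<Longrightarrow> f y = h y"
  shows "integrable lebesgue f \<longleftrightarrow> integrable lborel h" "integral\<^sup>L lebesgue f = integral\<^sup>L lborel h"
proof -
  have hl: "h \<in> borel_measurable lebesgue" using h by (simp add: measurable_completion)
  have ae: "AE y in lebesgue. h y = f y"
    using N by (intro AE_I'[of N]) (auto simp: negligible_iff_null_sets, metis)
  then have fl: "f \<in> borel_measurable lebesgue" by (rule borel_measurable_AE[OF hl])
  have hb: "h \<in> borel_measurable lborel" using h by simp
  show "integrable lebesgue f \<longleftrightarrow> integrable lborel h"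
    using integrable_cong_AE[OF hl fl ae] integrable_completion[OF hb] by simp
  show "integral\<^sup>L lebesgue f = integral\<^sup>L lborel h"
    using integral_cong_AE[OF hl fl ae] integral_completion[OF hb] by simp
qed

lemma negligible_linear_image:
  fixes f :: "'a::euclidean_space \<Rightarrow> 'a"
  assumes "linear f" "negligible S"
  shows "negligible (f ` S)"
  using negligible_differentiable_image_negligible[OF order_refl assms(2)] assms(1)
  by (simp add: linear_imp_differentiable_on)

text \<open>The exceptional set in space is a cone over a null set, hence a countable union of dilates of its
  part in the unit ball.\<close>

lemma kernel_class_representative:
  fixes \<eta> :: "'a::euclidean_space \<Rightarrow> real"
  assumes \<eta>: "\<eta> \<in> kernel_class lam Lam" and lL: "lam \<le> Lam"
  obtains g where "g \<in> borel_measurable borel" "\<And>y. lam \<le> g y" "\<And>y. g y \<le> Lam"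
    "\<And>c y. c > 0 \<Longrightarrow> g (c *\<^sub>R y) = g y" "\<And>y. g (- y) = g y" "negligible {y. \<eta> (sgn y) \<noteq> g y}"
proof -
  let ?S = "sphere (0::'a) 1" and ?B = "ball (0::'a) 1 - {0}"
  let ?D = "distr (restrict_space lborel ?B) (restrict_space borel ?S) sgn"
  have sets: "sets (sphere_measure :: 'a measure) = sets (restrict_space borel ?S)"
    and space: "space (sphere_measure :: 'a measure) = ?S"
    by (auto simp: sphere_measure_def space_restrict_space space_scale_measure)
  have \<eta>m: "\<eta> \<in> borel_measurable (completion sphere_measure)"
    and even: "\<And>\<theta>. \<theta> \<in> ?S \<Longrightarrow> \<eta> \<theta> = \<eta> (- \<theta>)"
    and bds: "AE \<theta> in sphere_measure. lam \<le> \<eta> \<theta> \<and> \<eta> \<theta> \<le> Lam"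
    using \<eta> unfolding kernel_class_def by blast+
  obtain \<eta>' where \<eta>': "\<eta>' \<in> borel_measurable sphere_measure" "AE \<theta> in sphere_measure. \<eta> \<theta> = \<eta>' \<theta>"
    using completion_ex_borel_measurable_real[OF \<eta>m] by blast
  define P where "P \<theta> \<longleftrightarrow> \<eta> \<theta> = \<eta>' \<theta> \<and> lam \<le> \<eta> \<theta> \<and> \<eta> \<theta> \<le> Lam" for \<theta>
  have "AE \<theta> in sphere_measure. P \<theta>" using \<eta>'(2) bds by eventually_elim (simp add: P_def)
  then obtain Z where Z: "{\<theta>\<in>space sphere_measure. \<not> P \<theta>} \<subseteq> Z" "emeasure sphere_measure Z = 0" "Z \<in> sets sphere_measure"
    by (rule AE_E)
  have sgnm: "sgn \<in> measurable (restrict_space lborel ?B) (restrict_space borel ?S)"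
    by (rule measurable_restrict_space2) (auto simp: space_restrict_space norm_sgn intro: measurable_restrict_space1)
  have "emeasure ?D Z = 0" using Z(2) by (simp add: sphere_measure_def)
  then have "emeasure (restrict_space lborel ?B) (sgn -` Z \<inter> ?B) = 0"
    using emeasure_distr[OF sgnm] Z(3) sets by (simp add: space_restrict_space)
  then have "emeasure lborel (sgn -` Z \<inter> ?B) = 0"
    by (subst (asm) emeasure_restrict_space) auto
  moreover have "sgn -` Z \<inter> ?B \<in> sets (restrict_space lborel ?B)"
    using measurable_sets[OF sgnm] Z(3) sets by (simp add: space_restrict_space)
  then have "sgn -` Z \<inter> ?B \<in> sets lborel" by (subst (asm) sets_restrict_space_iff) auto
  ultimately have "sgn -` Z \<inter> ?B \<in> null_sets lborel" by (simp add: null_sets_def)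
  then have negB: "negligible (sgn -` Z \<inter> ?B)"
    using null_sets_completionI by (simp add: negligible_iff_null_sets)
  define V where "V = (\<Union>n. (\<lambda>y. real n *\<^sub>R y) ` (sgn -` Z \<inter> ?B))"
  have "negligible ((\<lambda>y. real n *\<^sub>R y) ` (sgn -` Z \<inter> ?B))" for n
    using negB by (rule negligible_linear_image[rotated]) (auto intro: linear_scale_self)
  then have negV: "negligible V" unfolding V_def by (intro negligible_countable_Union) auto
  have PV: "P (sgn y)" if "y \<notin> V" "y \<noteq> 0" for y
  proof (rule ccontr)
    assume "\<not> P (sgn y)"
    then have Zy: "sgn y \<in> Z" using Z(1) that(2) by (auto simp: space norm_sgn)
    obtain n :: nat where n: "norm y < real n" using reals_Archimedean2 by blast
    then have n0: "real n > 0" using norm_ge_zero[of y] by linarith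
    let ?y = "y /\<^sub>R real n"
    have "?y \<in> sgn -` Z \<inter> ?B" using Zy n n0 that(2) by (simp add: sgn_scaleR divide_simps)
    moreover have "y = real n *\<^sub>R ?y" using n0 by simp
    ultimately have "y \<in> V" unfolding V_def by blast
    with that(1) show False by simp
  qed
  \<comment> \<open>Clipping makes the bounds hold everywhere, and the average over the two signs in
    \<open>g\<close> makes the symmetry exact; neither changes the values off the null set.\<close>
  define c where "c y = max lam (min Lam (indicator ?S y *\<^sub>R \<eta>' y))" for y
  define g where "g y = (c (sgn y) + c (- sgn y)) / 2" for y
  have "\<eta>' \<in> borel_measurable (restrict_space borel ?S)"
    using \<eta>'(1) measurable_cong_sets[OF sets refl] by blast
  then have "(\<lambda>y. indicator ?S y *\<^sub>R \<eta>' y) \<in> borel_measurable borel"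
    by (subst (asm) borel_measurable_restrict_space_iff) auto
  then have [measurable]: "c \<in> borel_measurable borel" unfolding c_def by measurable
  have c: "lam \<le> c y" "c y \<le> Lam" for y using lL by (auto simp: c_def)
  show ?thesis
  proof (rule that[of g])
    show "g \<in> borel_measurable borel" unfolding g_def[abs_def] by measurable
    show "lam \<le> g y" "g y \<le> Lam" for y
      using c[of "sgn y"] c[of "- sgn y"] by (auto simp: g_def)
    show "g (r *\<^sub>R y) = g y" if "r > 0" for r y using that by (simp add: g_def sgn_scaleR)
    show "g (- y) = g y" for y by (simp add: g_def sgn_minus)
    have "{y. \<eta> (sgn y) \<noteq> g y} \<subseteq> {0} \<union> V \<union> uminus ` V"
    proof
      fix y assume y: "y \<in> {y. \<eta> (sgn y) \<noteq> g y}"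
      show "y \<in> {0} \<union> V \<union> uminus ` V"
      proof (rule ccontr)
        assume n: "y \<notin> {0} \<union> V \<union> uminus ` V"
        then have "- y \<notin> V" by (metis UnCI image_eqI minus_minus)
        then have P: "P (sgn y)" "P (sgn (- y))" using n PV[of y] PV[of "- y"] by auto
        have S: "sgn y \<in> ?S" "- sgn y \<in> ?S" using n by (auto simp: norm_sgn)
        have "c (sgn y) = \<eta> (sgn y)" using P(1) S by (simp add: c_def P_def)
        moreover have "c (- sgn y) = \<eta> (- sgn y)" using P(2) S by (simp add: c_def P_def sgn_minus)
        ultimately have "g y = \<eta> (sgn y)" using even[OF S(1)] by (simp add: g_def)
        then show False using y by simp
      qed
    qed
    moreover have "negligible (uminus ` V)"
      using negV by (rule negligible_linear_image[rotated]) (auto intro: linear_uminus)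
    ultimately show "negligible {y. \<eta> (sgn y) \<noteq> g y}"
      using negV by (meson negligible_Un negligible_sing negligible_subset)
  qed
qed

locale homogeneous_kernel =
  fixes g \<eta> :: "'a::euclidean_space \<Rightarrow> real" and lam Lam s d :: real
  assumes dim: "d = real DIM('a)" and g_meas [measurable]: "g \<in> borel_measurable borel"
    and g_ge: "\<And>y. lam \<le> g y" and g_le: "\<And>y. g y \<le> Lam" and lam0: "0 < lam"
    and g_hom: "\<And>c y. c > 0 \<Longrightarrow> g (c *\<^sub>R y) = g y" and g_even: "\<And>y. g (- y) = g y"
    and g_rep: "negligible {y. \<eta> (sgn y) \<noteq> g y}"
    and s01: "0 < s" "s < 1"
begin

abbreviation ker where "ker y \<equiv> norm y powr (- d - 2 * s)"

lemma g_nonneg: "0 \<le> g y" using g_ge[of y] lam0 by linarith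

lemma Lam0: "0 < Lam" using g_ge[of 0] g_le[of 0] lam0 by linarith

lemma d_ge1: "1 \<le> d" unfolding dim by simp

definition "ball_const a = unit_ball_vol d * d / (a + d)"

definition "tail_const a = unit_ball_vol d * d / (- (a + d))"

lemma ball_power:
  assumes "R \<ge> 0" "a + d > 0"
  shows "integrable lborel (\<lambda>y::'a. indicator (ball 0 R) y * norm y powr a)"
    "(\<integral>y. indicator (ball (0::'a) R) y * norm y powr a \<partial>lborel) = ball_const a * R powr (a + d)"
  using norm_powr_ball[where 'a='a, folded dim, OF assms] unfolding ball_const_def has_bochner_integral_iff by auto

lemma tail_power:
  assumes "R > 0" "a + d < 0"
  shows "integrable lborel (\<lambda>y::'a. indicator (- ball 0 R) y * norm y powr a)"
    "(\<integral>y. indicator (- ball (0::'a) R) y * norm y powr a \<partial>lborel) = tail_const a * R powr (a + d)"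
  using norm_powr_tail[where 'a='a, folded dim, OF assms] unfolding tail_const_def has_bochner_integral_iff by auto

lemma consts_nonneg: "a + d > 0 \<Longrightarrow> 0 \<le> ball_const a" "a + d < 0 \<Longrightarrow> 0 \<le> tail_const a"
  unfolding ball_const_def tail_const_def using d_ge1 by (auto intro!: divide_nonneg_pos mult_nonneg_nonneg)

text \<open>The substitution of \<open>x + y\<close> for \<open>y\<close> centres the principal
  value at the origin, and \<open>\<eta>\<close> is exchanged for \<open>g\<close> off a reflected
  and translated null set.\<close>

lemma frac_op_reduce:
  assumes u [measurable]: "u \<in> borel_measurable borel" and op: "has_frac_op \<eta> s u x l"
  shows "\<rho> > 0 \<Longrightarrow> integrable lborel (\<lambda>y. indicator (- ball 0 \<rho>) y * ((u x - u (x + y)) * g y * ker y))"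
    and "((\<lambda>\<rho>. \<integral>y. indicator (- ball 0 \<rho>) y * ((u x - u (x + y)) * g y * ker y) \<partial>lborel) \<longlongrightarrow> l) (at_right 0)"
proof -
  define H where "H \<rho> y = indicator (- ball x \<rho>) y * ((u x - u y) * g (x - y) * ker (x - y))" for \<rho> y
  have [measurable]: "- ball x \<rho> \<in> sets borel" for \<rho> by simp
  have [measurable]: "H \<rho> \<in> borel_measurable borel" for \<rho> unfolding H_def by measurable
  define V where "V = (\<lambda>y. x - y) ` {y. \<eta> (sgn y) \<noteq> g y}"
  have "V = (+) x ` (uminus ` {y. \<eta> (sgn y) \<noteq> g y})" unfolding V_def image_image by simp
  moreover have "negligible (uminus ` {y. \<eta> (sgn y) \<noteq> g y})"
    using g_rep by (rule negligible_linear_image[rotated]) (auto intro: linear_uminus)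
  ultimately have negV: "negligible V" by (simp add: negligible_translation)
  have eq: "indicator (- ball x \<rho>) y *\<^sub>R frac_integrand \<eta> s u x y = H \<rho> y" if "y \<notin> V" for \<rho> y
  proof -
    have "\<eta> (sgn (x - y)) = g (x - y)"
    proof (rule ccontr)
      assume "\<not> ?thesis"
      then have "x - (x - y) \<in> V" unfolding V_def by blast
      with that show False by simp
    qed
    moreover have "ker (x - y) = 1 / norm (x - y) powr (d + 2 * s)"
      using powr_minus_divide[of "norm (x - y)" "d + 2 * s"] by simp
    ultimately show ?thesis unfolding H_def frac_integrand_def by (simp add: dim)
  qed
  have tr: "H \<rho> (x + y) = indicator (- ball 0 \<rho>) y * ((u x - u (x + y)) * g y * ker y)" for \<rho> y
    unfolding H_def by (simp add: g_even indicator_def dist_norm)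
  show "integrable lborel (\<lambda>y. indicator (- ball 0 \<rho>) y * ((u x - u (x + y)) * g y * ker y))" if "\<rho> > 0"
  proof -
    have "integrable lebesgue (\<lambda>y. indicator (- ball x \<rho>) y *\<^sub>R frac_integrand \<eta> s u x y)"
      using op that unfolding has_frac_op_def set_integrable_def by blast
    then have "integrable lborel (H \<rho>)"
      using lebesgue_integral_spike_borel(1)[of "H \<rho>", OF _ negV eq] by simp
    then show ?thesis using lborel_translate(1)[of "H \<rho>" x] unfolding tr by simp
  qed
  have "(LINT y:(- ball x \<rho>)|lebesgue. frac_integrand \<eta> s u x y)
    = (\<integral>y. indicator (- ball 0 \<rho>) y * ((u x - u (x + y)) * g y * ker y) \<partial>lborel)" for \<rho>
    unfolding set_lebesgue_integral_def
    using lebesgue_integral_spike_borel(2)[of "H \<rho>", OF _ negV eq] lborel_translate(2)[of "H \<rho>" x]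
    unfolding tr by simp
  then show "((\<lambda>\<rho>. \<integral>y. indicator (- ball 0 \<rho>) y * ((u x - u (x + y)) * g y * ker y) \<partial>lborel) \<longlongrightarrow> l) (at_right 0)"
    using op unfolding has_frac_op_def by simp
qed

abbreviation diff2 :: "('a \<Rightarrow> real) \<Rightarrow> 'a \<Rightarrow> 'a \<Rightarrow> real" where
  "diff2 w x y \<equiv> 2 * w x - w (x - y) - w (x + y)"

lemma reg_op_eq:
  assumes [measurable]: "w \<in> borel_measurable borel"
  shows "reg_op \<eta> s \<epsilon> w x = 1 / 2 * (\<integral>y. diff2 w x y * g y * reg_kernel d s \<epsilon> (norm y) \<partial>lborel)"
proof -
  have "(\<lambda>y. diff2 w x y * g y * reg_kernel d s \<epsilon> (norm y)) \<in> borel_measurable borel" by measurable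
  then show ?thesis
    unfolding reg_op_def dim[symmetric] by (subst lebesgue_integral_spike_borel(2)[OF _ g_rep]) auto
qed

lemma abs_diff2_le: "(\<And>y. \<bar>w y\<bar> \<le> N) \<Longrightarrow> \<bar>diff2 w x y\<bar> \<le> 4 * N"
proof -
  assume w: "\<And>y. \<bar>w y\<bar> \<le> N"
  show ?thesis using w[of x] w[of "x - y"] w[of "x + y"] by linarith
qed

lemma symmetric_integrable:
  assumes u [measurable]: "u \<in> borel_measurable borel" and N: "\<And>y. \<bar>u y\<bar> \<le> N"
    and r: "r > 0" and b: "b > 2 * s"
    and A: "\<And>y. norm y \<le> r \<Longrightarrow> \<bar>diff2 u x y\<bar> \<le> A * norm y powr b"
  shows "integrable lborel (\<lambda>y. diff2 u x y * g y * ker y)"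
proof (rule Bochner_Integration.integrable_bound)
  let ?F = "\<lambda>y::'a. Lam * A * (indicator (ball 0 r) y * norm y powr (b - d - 2 * s))
      + Lam * (4 * N) * (indicator (- ball 0 r) y * norm y powr (- d - 2 * s))"
  show "integrable lborel ?F"
    using ball_power(1)[of r "b - d - 2 * s"] tail_power(1)[of r "- d - 2 * s"] r b s01
    by (intro Bochner_Integration.integrable_add integrable_mult_right) auto
  have "\<bar>diff2 u x y * g y * ker y\<bar> \<le> ?F y" for y
  proof -
    have *: "\<bar>diff2 u x y * g y * ker y\<bar> \<le> \<bar>diff2 u x y\<bar> * Lam * ker y"
      using g_nonneg g_le by (auto simp: abs_mult intro!: mult_right_mono mult_left_mono)
    show ?thesis
    proof (cases "norm y < r")
      case True
      have "\<bar>diff2 u x y\<bar> * Lam * ker y \<le> A * norm y powr b * Lam * ker y"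
        using A[of y] True Lam0 by (intro mult_right_mono) auto
      also have "\<dots> = Lam * A * norm y powr (b - d - 2 * s)"
        by (cases "y = 0") (simp_all add: powr_add[symmetric] algebra_simps)
      finally show ?thesis using * True by simp
    next
      case False
      have "\<bar>diff2 u x y\<bar> * Lam * ker y \<le> 4 * N * Lam * ker y"
        using abs_diff2_le[of u N x y, OF N] Lam0 by (intro mult_right_mono) auto
      then show ?thesis using * False by (simp add: mult_ac)
    qed
  qed
  then show "AE y in lborel. norm (diff2 u x y * g y * ker y) \<le> norm (?F y)"
    by (intro AE_I2) (simp add: order_trans[OF _ abs_ge_self])
qed measurable

lemma truncated_symmetrize:
  assumes u [measurable]: "u \<in> borel_measurable borel"
    and int: "integrable lborel (\<lambda>y. indicator (- ball 0 \<rho>) y * ((u x - u (x + y)) * g y * ker y))"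
  shows "(\<integral>y. indicator (- ball 0 \<rho>) y * ((u x - u (x + y)) * g y * ker y) \<partial>lborel)
    = 1 / 2 * (\<integral>y. indicator (- ball 0 \<rho>) y * (diff2 u x y * g y * ker y) \<partial>lborel)"
proof -
  define F where "F y = indicator (- ball 0 \<rho>) y * ((u x - u (x + y)) * g y * ker y)" for y
  have [measurable]: "- ball (0::'a) \<rho> \<in> sets borel" by simp
  have [measurable]: "F \<in> borel_measurable borel" unfolding F_def by measurable
  have i: "integrable lborel F" using int unfolding F_def .
  have i': "integrable lborel (\<lambda>y. F (- y))" using lborel_reflect(1)[of F] i by simp
  have "indicator (- ball 0 \<rho>) y * (diff2 u x y * g y * ker y) = F y + F (- y)" for y
    unfolding F_def by (simp add: g_even indicator_def algebra_simps)
  then have "(\<integral>y. indicator (- ball 0 \<rho>) y * (diff2 u x y * g y * ker y) \<partial>lborel) = (\<integral>y. F y + F (- y) \<partial>lborel)"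
    by simp
  also have "\<dots> = 2 * (\<integral>y. F y \<partial>lborel)" using i i' lborel_reflect(2)[of F] by simp
  finally show ?thesis unfolding F_def by simp
qed

text \<open>Dominated convergence along the radii 1 / (n + 1), with the absolutely integrable
  second-difference integrand as majorant, turns the principal value into an ordinary
  integral.\<close>

lemma frac_op_symmetric:
  assumes u [measurable]: "u \<in> borel_measurable borel"
    and int: "integrable lborel (\<lambda>y. diff2 u x y * g y * ker y)"
    and op: "has_frac_op \<eta> s u x l"
  shows "l = 1 / 2 * (\<integral>y. diff2 u x y * g y * ker y \<partial>lborel)"
proof -
  let ?G = "\<lambda>y. diff2 u x y * g y * ker y"
  have [measurable]: "- ball (0::'a) \<rho> \<in> sets borel" for \<rho> by simp
  have seq: "filterlim (\<lambda>n. 1 / real (Suc n)) (at_right 0) sequentially"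
    unfolding filterlim_at using LIMSEQ_inverse_real_of_nat by (auto simp: inverse_eq_divide)
  have "(\<lambda>n. \<integral>y. indicator (- ball 0 (1 / real (Suc n))) y * ((u x - u (x + y)) * g y * ker y) \<partial>lborel) \<longlonglongrightarrow> l"
    using filterlim_compose[OF frac_op_reduce(2)[OF u op] seq] .
  moreover have "(\<integral>y. indicator (- ball 0 (1 / real (Suc n))) y * ((u x - u (x + y)) * g y * ker y) \<partial>lborel)
     = 1 / 2 * (\<integral>y. indicator (- ball 0 (1 / real (Suc n))) y * ?G y \<partial>lborel)" for n
    by (rule truncated_symmetrize[OF u frac_op_reduce(1)[OF u op]]) simp
  ultimately have 1: "(\<lambda>n. 1 / 2 * (\<integral>y. indicator (- ball 0 (1 / real (Suc n))) y * ?G y \<partial>lborel)) \<longlonglongrightarrow> l"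
    by (simp only:)
  have "(\<lambda>n. \<integral>y. indicator (- ball 0 (1 / real (Suc n))) y * ?G y \<partial>lborel) \<longlonglongrightarrow> (\<integral>y. ?G y \<partial>lborel)"
  proof (rule integral_dominated_convergence[where w="\<lambda>y. norm (?G y)"])
    show "integrable lborel (\<lambda>y. norm (?G y))" using int by (rule integrable_norm)
    show "AE y in lborel. (\<lambda>n. indicator (- ball 0 (1 / real (Suc n))) y * ?G y) \<longlonglongrightarrow> ?G y"
    proof (rule AE_I2)
      fix y
      show "(\<lambda>n. indicator (- ball 0 (1 / real (Suc n))) y * ?G y) \<longlonglongrightarrow> ?G y"
      proof (cases "y = 0")
        case False
        then have "\<forall>\<^sub>F n in sequentially. 1 / real (Suc n) < norm y"
          using order_tendstoD(2)[OF LIMSEQ_inverse_real_of_nat, of "norm y"] by (simp add: inverse_eq_divide)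
        then have "\<forall>\<^sub>F n in sequentially. indicator (- ball 0 (1 / real (Suc n))) y * ?G y = ?G y"
          by eventually_elim (auto simp: indicator_def)
        then show ?thesis by (rule tendsto_eventually)
      qed simp
    qed
    show "AE y in lborel. norm (indicator (- ball 0 (1 / real (Suc n))) y * ?G y) \<le> norm (?G y)" for n
      by (intro AE_I2) (auto simp: indicator_def)
  qed measurable
  from tendsto_mult_left[OF this, of "1 / 2"] show ?thesis using LIMSEQ_unique[OF 1] by simp
qed

end

section \<open>Estimates for the continuous problem\<close>

context homogeneous_kernel begin

abbreviation K\<epsilon> where "K\<epsilon> \<epsilon> y \<equiv> reg_kernel d s \<epsilon> (norm y)"

definition "cA = 1 + kernel_A d s"

lemma d_nonneg: "0 \<le> d" using d_ge1 by linarith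

lemma cA_ge1: "1 \<le> cA" unfolding cA_def using kernel_consts(1)[OF s01 d_nonneg] by simp

lemma K\<epsilon>_bounds:
  assumes "0 < \<epsilon>"
  shows "0 \<le> K\<epsilon> \<epsilon> y" "K\<epsilon> \<epsilon> y \<le> cA * \<epsilon> powr (- d - 2 * s)" "y \<noteq> 0 \<Longrightarrow> K\<epsilon> \<epsilon> y \<le> cA * ker y"
  using reg_kernel_bounds[OF s01 d_nonneg assms norm_ge_zero] unfolding cA_def by auto

lemma K\<epsilon>_outer: "\<epsilon> \<le> norm y \<Longrightarrow> K\<epsilon> \<epsilon> y = ker y"
  by (simp add: reg_kernel_def)

lemma indicator_ball_integral:
  assumes "R \<ge> 0"
  shows "integrable lborel (indicator (ball (c::'a) R) :: 'a \<Rightarrow> real)"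
    "(\<integral>y. indicator (ball (c::'a) R) y \<partial>lborel) = unit_ball_vol d * R powr d"
proof -
  show "integrable lborel (indicator (ball c R) :: 'a \<Rightarrow> real)"
    using emeasure_bounded_finite[OF bounded_ball, of c R] by (simp add: integrable_indicator_iff)
  show "(\<integral>y. indicator (ball c R) y \<partial>lborel) = unit_ball_vol d * R powr d"
    using content_ball[OF assms, of c] assms unfolding dim
    by (cases "R = 0") (simp_all add: powr_realpow)
qed

text \<open>Total mass of the regularised kernel in units of \<epsilon>^(-2s): the ball of radius
  \<epsilon> and the tail.\<close>

definition "cK = cA * unit_ball_vol d + tail_const (- d - 2 * s)"

lemma cK_nonneg: "0 \<le> cK"
  unfolding cK_def using cA_ge1 d_nonneg consts_nonneg(2)[of "- d - 2 * s"] s01 by auto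

lemma K\<epsilon>_integral:
  assumes e: "0 < \<epsilon>"
  shows "integrable lborel (\<lambda>y::'a. K\<epsilon> \<epsilon> y)" "(\<integral>(y::'a). K\<epsilon> \<epsilon> y \<partial>lborel) \<le> cK * \<epsilon> powr (- 2 * s)"
proof -
  let ?B = "\<lambda>y::'a. cA * \<epsilon> powr (- d - 2 * s) * indicator (ball 0 \<epsilon>) y + indicator (- ball 0 \<epsilon>) y * ker y"
  have b: "K\<epsilon> \<epsilon> y \<le> ?B y" for y :: 'a
    using K\<epsilon>_bounds(2)[OF e, of y] K\<epsilon>_outer[of \<epsilon> y] by (auto simp: indicator_def)
  have tp: "integrable lborel (\<lambda>y::'a. indicator (- ball 0 \<epsilon>) y * ker y)"
    "(\<integral>y. indicator (- ball (0::'a) \<epsilon>) y * ker y \<partial>lborel) = tail_const (- d - 2 * s) * \<epsilon> powr (- 2 * s)"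
    using tail_power[OF e, of "- d - 2 * s"] s01 by auto
  have iB: "integrable lborel ?B"
    using indicator_ball_integral(1)[of \<epsilon> 0] e tp(1) by (intro Bochner_Integration.integrable_add integrable_mult_right) auto
  show i: "integrable lborel (\<lambda>y::'a. K\<epsilon> \<epsilon> y)"
  proof (rule Bochner_Integration.integrable_bound[OF iB])
    have "norm (K\<epsilon> \<epsilon> y) \<le> norm (?B y)" for y
      using b[of y] K\<epsilon>_bounds(1)[OF e, of y] unfolding real_norm_def by linarith
    then show "AE y in lborel. norm (K\<epsilon> \<epsilon> y) \<le> norm (?B y)" by simp
  qed measurable
  have "(\<integral>(y::'a). K\<epsilon> \<epsilon> y \<partial>lborel) \<le> (\<integral>y. ?B y \<partial>lborel)" by (rule integral_mono[OF i iB b])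
  also have "\<dots> = cA * \<epsilon> powr (- d - 2 * s) * (unit_ball_vol d * \<epsilon> powr d) + tail_const (- d - 2 * s) * \<epsilon> powr (- 2 * s)"
    using indicator_ball_integral[of \<epsilon> "0::'a"] e tp by (subst Bochner_Integration.integral_add) auto
  also have "\<epsilon> powr (- d - 2 * s) * (unit_ball_vol d * \<epsilon> powr d) = unit_ball_vol d * \<epsilon> powr (- 2 * s)"
    using e by (simp add: powr_add[symmetric])
  then have "cA * \<epsilon> powr (- d - 2 * s) * (unit_ball_vol d * \<epsilon> powr d) = cA * unit_ball_vol d * \<epsilon> powr (- 2 * s)"
    by (simp only: mult.assoc)
  finally show "(\<integral>(y::'a). K\<epsilon> \<epsilon> y \<partial>lborel) \<le> cK * \<epsilon> powr (- 2 * s)"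
    unfolding cK_def by (simp add: distrib_right)
qed

lemma reg_integrable:
  assumes w [measurable]: "w \<in> borel_measurable borel" and N: "\<And>y. \<bar>w y\<bar> \<le> N" and e: "0 < \<epsilon>"
  shows "integrable lborel (\<lambda>y. diff2 w z y * g y * K\<epsilon> \<epsilon> y)"
proof (rule Bochner_Integration.integrable_bound)
  show "integrable lborel (\<lambda>y::'a. 4 * N * Lam * K\<epsilon> \<epsilon> y)"
    by (intro integrable_mult_right K\<epsilon>_integral e)
  have "\<bar>diff2 w z y * g y * K\<epsilon> \<epsilon> y\<bar> \<le> 4 * N * Lam * K\<epsilon> \<epsilon> y" for y
    unfolding abs_mult
    using abs_diff2_le[of w N z y, OF N] g_nonneg[of y] g_le[of y] K\<epsilon>_bounds(1)[OF e, of y]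
    by (intro mult_mono) auto
  then show "AE y in lborel. norm (diff2 w z y * g y * K\<epsilon> \<epsilon> y) \<le> norm (4 * N * Lam * K\<epsilon> \<epsilon> y)"
    by (intro AE_I2) (simp only: real_norm_def order_trans[OF _ abs_ge_self])
qed measurable

lemma reg_op_diff:
  assumes [measurable]: "v \<in> borel_measurable borel" "w \<in> borel_measurable borel"
    and N: "\<And>y. \<bar>v y\<bar> \<le> N" "\<And>y. \<bar>w y\<bar> \<le> N'" and e: "0 < \<epsilon>"
  shows "reg_op \<eta> s \<epsilon> (\<lambda>y. v y - w y) z = reg_op \<eta> s \<epsilon> v z - reg_op \<eta> s \<epsilon> w z"
proof -
  have "reg_op \<eta> s \<epsilon> (\<lambda>y. v y - w y) z
     = 1 / 2 * (\<integral>y. diff2 v z y * g y * K\<epsilon> \<epsilon> y - diff2 w z y * g y * K\<epsilon> \<epsilon> y \<partial>lborel)"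
    by (subst reg_op_eq) (auto intro!: Bochner_Integration.integral_cong simp: algebra_simps)
  also have "\<dots> = reg_op \<eta> s \<epsilon> v z - reg_op \<eta> s \<epsilon> w z"
    using reg_integrable[OF assms(1) N(1) e] reg_integrable[OF assms(2) N(2) e]
    by (simp add: reg_op_eq right_diff_distrib)
  finally show ?thesis .
qed

text \<open>A bound with two scales: the near values of \<open>w\<close> meet the full mass
  \<epsilon>^(-2s) of the kernel, the global ones only the tail mass r^(-2s).\<close>

lemma reg_op_bound:
  assumes w [measurable]: "w \<in> borel_measurable borel" and wz: "w z = 0"
    and far: "\<And>y. \<bar>w y\<bar> \<le> Wf" and near: "\<And>y. norm (y - z) < r \<Longrightarrow> \<bar>w y\<bar> \<le> Wn"
    and e: "0 < \<epsilon>" "\<epsilon> \<le> r"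
  shows "\<bar>reg_op \<eta> s \<epsilon> w z\<bar> \<le> Lam * (Wn * cK * \<epsilon> powr (- 2 * s) + Wf * tail_const (- d - 2 * s) * r powr (- 2 * s))"
proof -
  let ?B = "\<lambda>y::'a. 2 * Lam * Wn * K\<epsilon> \<epsilon> y + 2 * Lam * Wf * (indicator (- ball 0 r) y * ker y)"
  have r: "r > 0" using e by simp
  have Wn: "Wn \<ge> 0" using near[of z] wz r by simp
  have Wf: "Wf \<ge> 0" using far[of z] wz by simp
  have tp: "integrable lborel (\<lambda>y::'a. indicator (- ball 0 r) y * ker y)"
    "(\<integral>y. indicator (- ball (0::'a) r) y * ker y \<partial>lborel) = tail_const (- d - 2 * s) * r powr (- 2 * s)"
    using tail_power[OF r, of "- d - 2 * s"] s01 by auto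
  have iB: "integrable lborel ?B"
    by (intro Bochner_Integration.integrable_add integrable_mult_right tp K\<epsilon>_integral e)
  have b: "\<bar>diff2 w z y * g y * K\<epsilon> \<epsilon> y\<bar> \<le> ?B y" for y
  proof (cases "norm y < r")
    case True
    have "\<bar>diff2 w z y\<bar> \<le> 2 * Wn" using near[of "z - y"] near[of "z + y"] True wz by auto
    then have "\<bar>diff2 w z y\<bar> * \<bar>g y\<bar> * \<bar>K\<epsilon> \<epsilon> y\<bar> \<le> 2 * Wn * Lam * K\<epsilon> \<epsilon> y"
      using g_nonneg[of y] g_le[of y] K\<epsilon>_bounds(1)[OF e(1), of y] Wn by (intro mult_mono) auto
    then show ?thesis using True by (simp add: abs_mult mult_ac)
  next
    case False
    have "\<bar>diff2 w z y\<bar> \<le> 2 * Wf" using far[of "z - y"] far[of "z + y"] wz by auto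
    then have "\<bar>diff2 w z y\<bar> * \<bar>g y\<bar> * \<bar>K\<epsilon> \<epsilon> y\<bar> \<le> 2 * Wf * Lam * K\<epsilon> \<epsilon> y"
      using g_nonneg[of y] g_le[of y] K\<epsilon>_bounds(1)[OF e(1), of y] Wf by (intro mult_mono) auto
    moreover have "K\<epsilon> \<epsilon> y = ker y" using False e by (intro K\<epsilon>_outer) auto
    moreover have "0 \<le> 2 * Lam * Wn * K\<epsilon> \<epsilon> y" using Lam0 Wn K\<epsilon>_bounds(1)[OF e(1), of y] by simp
    ultimately show ?thesis using False by (simp add: abs_mult mult_ac)
  qed
  have "\<bar>\<integral>y. diff2 w z y * g y * K\<epsilon> \<epsilon> y \<partial>lborel\<bar> \<le> (\<integral>y. \<bar>diff2 w z y * g y * K\<epsilon> \<epsilon> y\<bar> \<partial>lborel)"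
    by (rule integral_abs_bound)
  also have "\<dots> \<le> (\<integral>y. ?B y \<partial>lborel)"
    by (rule integral_mono[OF integrable_abs[OF reg_integrable[OF w far e(1)]] iB b])
  also have "\<dots> = 2 * Lam * Wn * (\<integral>(y::'a). K\<epsilon> \<epsilon> y \<partial>lborel) + 2 * Lam * Wf * (tail_const (- d - 2 * s) * r powr (- 2 * s))"
    using tp K\<epsilon>_integral(1)[OF e(1)] by (subst Bochner_Integration.integral_add) auto
  also have "\<dots> \<le> 2 * Lam * Wn * (cK * \<epsilon> powr (- 2 * s)) + 2 * Lam * Wf * (tail_const (- d - 2 * s) * r powr (- 2 * s))"
    using K\<epsilon>_integral(2)[OF e(1)] Lam0 Wn by (intro add_right_mono mult_left_mono) auto
  finally show ?thesis unfolding reg_op_eq[OF w] by (simp add: abs_mult algebra_simps)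
qed

text \<open>The lower bound for \<open>g\<close>, the least kernel value and the volume of the
  exterior ball, scaled to radius 1.\<close>

definition "cE = lam * 3 powr (- d - 2 * s) * unit_ball_vol d"

lemma cE_pos: "0 < cE" unfolding cE_def using lam0 d_nonneg by simp

text \<open>The ball of radius \<open>r\<close> around \<open>2 *\<^sub>R (r *\<^sub>R a)\<close> lies in the annulus of radii \<open>r\<close> and \<open>3 r\<close>.\<close>

lemma exterior_mass:
  assumes a: "norm a = 1" and r: "r > 0" and F: "integrable lborel F" "\<And>y. 0 \<le> F y"
    and c: "c \<ge> 0" "\<And>y. y \<in> ball ((2 * r) *\<^sub>R a) r \<Longrightarrow> c * g y * ker y \<le> F y"
  shows "c * cE * r powr (- 2 * s) \<le> (\<integral>y. F y \<partial>lborel)"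
proof -
  let ?D = "ball ((2 * r) *\<^sub>R a) r"
  have norm: "r < norm y" "norm y < 3 * r" if "y \<in> ?D" for y
  proof -
    have n: "norm ((2 * r) *\<^sub>R a) = 2 * r" using a r by simp
    have "norm ((2 * r) *\<^sub>R a - y) < r" using that by (simp add: dist_norm)
    then show "r < norm y" "norm y < 3 * r"
      using norm_triangle_ineq2[of "(2 * r) *\<^sub>R a" y] norm_triangle_ineq2[of y "(2 * r) *\<^sub>R a"] n
      by (simp_all add: norm_minus_commute)
  qed
  have "c * cE * r powr (- 2 * s) = c * lam * (3 * r) powr (- d - 2 * s) * (unit_ball_vol d * r powr d)"
    using r by (simp add: cE_def powr_mult powr_add[symmetric])
  also have "\<dots> = (\<integral>y. c * lam * (3 * r) powr (- d - 2 * s) * indicator ?D y \<partial>lborel)"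
    using indicator_ball_integral[of r "(2 * r) *\<^sub>R a"] r by simp
  also have "\<dots> \<le> (\<integral>y. F y \<partial>lborel)"
  proof (rule integral_mono)
    show "integrable lborel (\<lambda>y. c * lam * (3 * r) powr (- d - 2 * s) * indicator ?D y)"
      using indicator_ball_integral(1)[of r "(2 * r) *\<^sub>R a"] r by (intro integrable_mult_right) auto
    show "c * lam * (3 * r) powr (- d - 2 * s) * indicator ?D y \<le> F y" for y
    proof (cases "y \<in> ?D")
      case True
      have "(3 * r) powr (- d - 2 * s) \<le> ker y"
        using norm[OF True] r d_nonneg s01 by (intro powr_mono2') auto
      then have "c * lam * (3 * r) powr (- d - 2 * s) \<le> c * g y * ker y"
        using c(1) lam0 g_ge[of y] by (intro mult_mono) auto
      then show ?thesis using c(2)[OF True] True by simp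
    qed (use F(2) in simp)
  qed (rule F(1))
  finally show ?thesis .
qed

end

text \<open>The zero condition holds off the closure only; that \<open>u\<close> vanishes on the
  boundary is derived below. \<open>F\<close> bounds the zeroth-order term of the weighted norm of
  \<open>f\<close>.\<close>

locale fractional_problem =
  weighted_hoelder \<Omega> u s \<beta> M N + homogeneous_kernel g \<eta> lam Lam s d
  for \<Omega> :: "'a::euclidean_space set" and u s \<beta> M N g \<eta> lam Lam d +
  fixes f :: "'a \<Rightarrow> real" and F :: real
  assumes nonempty_dom: "\<Omega> \<noteq> {}"
    and u_bound: "\<And>x. \<bar>u x\<bar> \<le> N" and u_outside: "\<And>x. x \<notin> closure \<Omega> \<Longrightarrow> u x = 0"
    and equation: "\<And>x. x \<in> \<Omega> \<Longrightarrow> has_frac_op \<eta> s u x (f x)"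
    and F0: "0 \<le> F" and f_bound: "\<And>x. x \<in> \<Omega> \<Longrightarrow> bdist \<Omega> x powr s * \<bar>f x\<bar> \<le> F"
begin

lemma beta'_props: "2 * s < \<beta>'" "\<beta>' \<le> 2" "s < \<beta>'" "0 < \<beta>'"
  using beta s01 by auto

lemma dpos: "x \<in> \<Omega> \<Longrightarrow> 0 < bdist \<Omega> x"
  using bdist_pos[OF open_dom bounded_dom] .

lemma u_continuous: "continuous_on (closure \<Omega>) u"
proof (cases "N = 0")
  case True
  then have "u x = 0" for x using u_bound[of x] by simp
  then have "u = (\<lambda>x. 0)" by (simp add: fun_eq_iff)
  then show ?thesis by simp
next
  case False
  then have N: "N > 0" using N0 by simp
  show ?thesis
    unfolding continuous_on_iff
  proof safe
    fix x e assume x: "x \<in> closure \<Omega>" and e: "(0::real) < e"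
    have "(e / (2 * N)) powr (1 / s) > 0" using e N by simp
    moreover have "dist (u x') (u x) < e" if x': "x' \<in> closure \<Omega>" "dist x' x < (e / (2 * N)) powr (1 / s)" for x'
    proof -
      have "\<bar>u x' - u x\<bar> \<le> N * norm (x' - x) powr s" by (rule hoelder_s[OF x'(1) x])
      also have "\<dots> \<le> N * ((e / (2 * N)) powr (1 / s)) powr s"
        using x'(2) s01 N by (intro mult_left_mono powr_mono2) (auto simp: dist_norm)
      also have "\<dots> = e / 2" using s01 N e by (simp add: powr_powr)
      finally show ?thesis using e by (simp add: dist_real_def)
    qed
    ultimately show "\<exists>r>0. \<forall>x'\<in>closure \<Omega>. dist x' x < r \<longrightarrow> dist (u x') (u x) < e" by blast
  qed
qed

lemma borel_extension:
  assumes "continuous_on (closure \<Omega>) w" "\<And>x. x \<notin> closure \<Omega> \<Longrightarrow> w x = 0"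
  shows "(w :: 'a \<Rightarrow> real) \<in> borel_measurable borel"
proof -
  have "(\<lambda>x. indicator (closure \<Omega>) x *\<^sub>R w x) \<in> borel_measurable borel"
    by (rule borel_measurable_continuous_on_indicator[OF _ assms(1)]) auto
  moreover have "(\<lambda>x. indicator (closure \<Omega>) x *\<^sub>R w x) = w" using assms(2) by (auto simp: fun_eq_iff indicator_def)
  ultimately show ?thesis by simp
qed

lemma u_meas [measurable]: "u \<in> borel_measurable borel"
  by (rule borel_extension[OF u_continuous u_outside])

text \<open>The ball lies beyond the tangent hyperplane at distance \<delta>(x). A point of the
  closure there would have negative distance to the boundary by the supergradient
  inequality.\<close>

lemma exterior_ball:
  assumes x: "x \<in> \<Omega>"
  obtains a where "norm a = 1"
    "\<And>y. y \<in> ball ((2 * bdist \<Omega> x) *\<^sub>R a) (bdist \<Omega> x) \<Longrightarrow> x + y \<notin> closure \<Omega> \<and> bdist \<Omega> x < norm y"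
proof -
  let ?d = "bdist \<Omega> x"
  obtain a where a: "norm a = 1" "\<And>y. y \<in> closure \<Omega> \<Longrightarrow> bdist \<Omega> y \<le> ?d - a \<bullet> (y - x)"
    using bdist_direction[OF open_dom convex_dom bounded_dom x] by blast
  have aa: "a \<bullet> a = 1" using a(1) by (simp add: dot_square_norm)
  show ?thesis
  proof (rule that[OF a(1)])
    fix y assume "y \<in> ball ((2 * ?d) *\<^sub>R a) ?d"
    then have y: "norm ((2 * ?d) *\<^sub>R a - y) < ?d" by (simp add: dist_norm)
    have "a \<bullet> ((2 * ?d) *\<^sub>R a - y) \<le> norm ((2 * ?d) *\<^sub>R a - y)"
      using norm_cauchy_schwarz[of a "(2 * ?d) *\<^sub>R a - y"] a(1) by simp
    then have ay: "a \<bullet> y > ?d" using y aa by (simp add: inner_diff_right)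
    have "?d < norm y" using norm_cauchy_schwarz[of a y] a(1) ay by simp
    moreover have "x + y \<notin> closure \<Omega>"
    proof
      assume "x + y \<in> closure \<Omega>"
      from a(2)[OF this] show False using ay bdist_nonneg[of \<Omega> "x + y"] by simp
    qed
    ultimately show "x + y \<notin> closure \<Omega> \<and> ?d < norm y" by simp
  qed
qed

lemma sym_int:
  assumes x: "x \<in> \<Omega>"
  shows "integrable lborel (\<lambda>y. diff2 u x y * g y * ker y)"
    "f x = 1 / 2 * (\<integral>y. diff2 u x y * g y * ker y \<partial>lborel)"
proof -
  show i: "integrable lborel (\<lambda>y. diff2 u x y * g y * ker y)"
    by (rule symmetric_integrable[OF u_meas u_bound _ beta'_props(1), of "bdist \<Omega> x / 2" x "(cD + cH) * bdist \<Omega> x powr (s - \<beta>')"])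
      (use dpos[OF x] second_difference'[OF x] in auto)
  show "f x = 1 / 2 * (\<integral>y. diff2 u x y * g y * ker y \<partial>lborel)"
    by (rule frac_op_symmetric[OF u_meas i equation[OF x]])
qed

section \<open>Decay of the solution at the boundary\<close>

definition "c_near = Lam * (cD + cH) * ball_const (\<beta>' - d - 2 * s)"

definition "c_far = N * Lam * tail_const (s - d - 2 * s) * (1 / 2) powr (- s)"

lemma c_near_nonneg: "0 \<le> c_near"
  unfolding c_near_def using Lam0 cD_nonneg cH_nonneg consts_nonneg(1)[of "\<beta>' - d - 2 * s"] beta'_props by auto

lemma c_far_nonneg: "0 \<le> c_far"
  unfolding c_far_def using Lam0 N0 consts_nonneg(2)[of "s - d - 2 * s"] s01 by auto

lemma near_part:
  assumes x: "x \<in> \<Omega>"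
  shows "\<bar>1 / 2 * (\<integral>y. indicator (ball 0 (bdist \<Omega> x / 2)) y * (diff2 u x y * g y * ker y) \<partial>lborel)\<bar>
    \<le> c_near * bdist \<Omega> x powr (- s)"
proof -
  let ?d = "bdist \<Omega> x"
  have d0: "?d > 0" using dpos[OF x] .
  let ?G = "\<lambda>y. diff2 u x y * g y * ker y"
  let ?B = "\<lambda>y::'a. (cD + cH) * ?d powr (s - \<beta>') * Lam * (indicator (ball 0 (?d / 2)) y * norm y powr (\<beta>' - d - 2 * s))"
  have bp: "integrable lborel (\<lambda>y::'a. indicator (ball 0 (?d / 2)) y * norm y powr (\<beta>' - d - 2 * s))"
    "(\<integral>y. indicator (ball (0::'a) (?d / 2)) y * norm y powr (\<beta>' - d - 2 * s) \<partial>lborel)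
      = ball_const (\<beta>' - d - 2 * s) * (?d / 2) powr (\<beta>' - 2 * s)"
    using ball_power[of "?d / 2" "\<beta>' - d - 2 * s"] d0 beta'_props by auto
  have i: "integrable lborel (\<lambda>y. indicator (ball 0 (?d / 2)) y * ?G y)"
    by (rule Bochner_Integration.integrable_bound[OF sym_int(1)[OF x]])
       (auto simp: indicator_def intro!: borel_measurable_times borel_measurable_indicator)
  have b: "\<bar>indicator (ball 0 (?d / 2)) y * ?G y\<bar> \<le> ?B y" for y
  proof (cases "norm y < ?d / 2")
    case True
    have "\<bar>?G y\<bar> = \<bar>diff2 u x y\<bar> * g y * ker y" using g_nonneg by (simp add: abs_mult)
    also have "\<dots> \<le> ((cD + cH) * ?d powr (s - \<beta>') * norm y powr \<beta>') * Lam * ker y"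
      using second_difference'[OF x, of y] True g_nonneg[of y] g_le[of y] cD_nonneg cH_nonneg
      by (intro mult_mono mult_nonneg_nonneg) auto
    also have "\<dots> = (cD + cH) * ?d powr (s - \<beta>') * Lam * (norm y powr \<beta>' * ker y)" by (simp only: mult_ac)
    also have "norm y powr \<beta>' * ker y = norm y powr (\<beta>' - d - 2 * s)"
      by (simp add: powr_add[symmetric] algebra_simps)
    finally show ?thesis using True by simp
  qed simp
  have "\<bar>\<integral>y. indicator (ball 0 (?d / 2)) y * ?G y \<partial>lborel\<bar> \<le> (\<integral>y. \<bar>indicator (ball 0 (?d / 2)) y * ?G y\<bar> \<partial>lborel)"
    by (rule integral_abs_bound)
  also have "\<dots> \<le> (\<integral>y. ?B y \<partial>lborel)"
    by (rule integral_mono[OF integrable_abs[OF i] _ b]) (intro integrable_mult_right bp)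
  also have "\<dots> = (cD + cH) * ?d powr (s - \<beta>') * Lam * (ball_const (\<beta>' - d - 2 * s) * (?d / 2) powr (\<beta>' - 2 * s))"
    using bp by simp
  also have "\<dots> \<le> (cD + cH) * ?d powr (s - \<beta>') * Lam * (ball_const (\<beta>' - d - 2 * s) * ?d powr (\<beta>' - 2 * s))"
    using d0 beta'_props Lam0 cD_nonneg cH_nonneg consts_nonneg(1)[of "\<beta>' - d - 2 * s"]
    by (intro mult_left_mono powr_mono2 mult_nonneg_nonneg) auto
  also have "\<dots> = c_near * (?d powr (s - \<beta>') * ?d powr (\<beta>' - 2 * s))" unfolding c_near_def by (simp only: mult_ac)
  also have "?d powr (s - \<beta>') * ?d powr (\<beta>' - 2 * s) = ?d powr (- s)" by (simp add: powr_add[symmetric])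
  finally have "\<bar>\<integral>y. indicator (ball 0 (?d / 2)) y * ?G y \<partial>lborel\<bar> \<le> c_near * ?d powr (- s)" .
  then show ?thesis using c_near_nonneg by (simp add: abs_mult)
qed

text \<open>The equation at \<open>x\<close> has three parts: the second difference on the half ball
  and the first difference inside the closure are both of order \<delta>^(-s), while the exterior
  contributes \<open>u x\<close> times a mass of order at least \<delta>^(-2s).\<close>

lemma u_decay_aux:
  assumes x: "x \<in> \<Omega>"
  shows "\<bar>u x\<bar> * cE * bdist \<Omega> x powr (- 2 * s) \<le> \<bar>f x\<bar> + (c_near + c_far) * bdist \<Omega> x powr (- s)"
proof -
  let ?d = "bdist \<Omega> x"
  have d0: "?d > 0" using dpos[OF x] .
  let ?G = "\<lambda>y. diff2 u x y * g y * ker y"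
  let ?I = "\<lambda>y::'a. indicator (- ball 0 (?d / 2)) y :: real"
  have [measurable]: "ball (0::'a) (?d / 2) \<in> sets borel" "- ball (0::'a) (?d / 2) \<in> sets borel" "closure \<Omega> \<in> sets borel"
    by auto
  have tk: "integrable lborel (\<lambda>y::'a. ?I y * ker y)"
    using tail_power(1)[of "?d / 2" "- d - 2 * s"] d0 s01 by auto
  have iP: "integrable lborel (\<lambda>y. ?I y * (p y * g y * ker y))"
    if p: "p \<in> borel_measurable borel" "\<And>y. \<bar>p y\<bar> \<le> 2 * N" for p
  proof (rule Bochner_Integration.integrable_bound)
    note p(1)[measurable]
    show "integrable lborel (\<lambda>y::'a. 2 * N * Lam * (?I y * ker y))" by (intro integrable_mult_right tk)
    have "\<bar>p y * g y * ker y\<bar> \<le> 2 * N * Lam * ker y" for y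
      unfolding abs_mult using p(2)[of y] g_nonneg[of y] g_le[of y] by (intro mult_mono) auto
    then show "AE y in lborel. norm (?I y * (p y * g y * ker y)) \<le> norm (2 * N * Lam * (?I y * ker y))"
      using N0 Lam0 by (intro AE_I2) (auto simp: indicator_def abs_mult)
    show "(\<lambda>y. ?I y * (p y * g y * ker y)) \<in> borel_measurable lborel" by measurable
  qed
  let ?p = "\<lambda>y. u x - u (x + y)"
  let ?p1 = "\<lambda>y. indicator (closure \<Omega>) (x + y) * (u x - u (x + y))"
  let ?p2 = "\<lambda>y. (1 - indicator (closure \<Omega>) (x + y)) * u x"
  have i: "integrable lborel (\<lambda>y. ?I y * (?p y * g y * ker y))"
  proof (rule iP)
    show "\<bar>?p y\<bar> \<le> 2 * N" for y using u_bound[of x] u_bound[of "x + y"] by linarith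
  qed measurable
  have i1: "integrable lborel (\<lambda>y. ?I y * (?p1 y * g y * ker y))"
  proof (rule iP)
    show "\<bar>?p1 y\<bar> \<le> 2 * N" for y using u_bound[of x] u_bound[of "x + y"] by (auto simp: indicator_def)
  qed measurable
  have m2: "(\<lambda>y. 1 - indicator (closure \<Omega>) (x + y) :: real) \<in> borel_measurable borel" by measurable
  \<comment> \<open>Kernel density outside the closure, where \<open>u (x + y) = 0\<close>; the
    exterior ball bounds its integral from below.\<close>
  define m where "m y = ?I y * ((1 - indicator (closure \<Omega>) (x + y)) * g y * ker y)" for y
  have im: "integrable lborel m"
    unfolding m_def
  proof (rule Bochner_Integration.integrable_bound)
    show "integrable lborel (\<lambda>y::'a. Lam * (?I y * ker y))" by (intro integrable_mult_right tk)
    show "AE y in lborel. norm (?I y * ((1 - indicator (closure \<Omega>) (x + y)) * g y * ker y)) \<le> norm (Lam * (?I y * ker y))"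
      using g_nonneg g_le Lam0 by (intro AE_I2) (auto simp: indicator_def abs_mult intro!: mult_right_mono)
  qed (use m2 in measurable)
  have p12: "?I y * (?p y * g y * ker y) = ?I y * (?p1 y * g y * ker y) + u x * m y" for y
    using u_outside[of "x + y"] by (auto simp: m_def indicator_def)
  \<comment> \<open>Near the origin the second difference is kept for convergence; away from it the
    first difference is restored, so that interior and exterior can be separated.\<close>
  have split: "f x = 1 / 2 * (\<integral>y. indicator (ball 0 (?d / 2)) y * ?G y \<partial>lborel) + (\<integral>y. ?I y * (?p y * g y * ker y) \<partial>lborel)"
  proof -
    have ia: "integrable lborel (\<lambda>y. indicator (ball 0 (?d / 2)) y * ?G y)" "integrable lborel (\<lambda>y. ?I y * ?G y)"
      by (rule Bochner_Integration.integrable_bound[OF sym_int(1)[OF x]];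
        auto simp: indicator_def intro!: borel_measurable_times borel_measurable_indicator)+
    have "(\<integral>y. ?G y \<partial>lborel) = (\<integral>y. indicator (ball 0 (?d / 2)) y * ?G y + ?I y * ?G y \<partial>lborel)"
      by (intro Bochner_Integration.integral_cong) (auto simp: indicator_def)
    also have "\<dots> = (\<integral>y. indicator (ball 0 (?d / 2)) y * ?G y \<partial>lborel) + (\<integral>y. ?I y * ?G y \<partial>lborel)"
      by (rule Bochner_Integration.integral_add[OF ia])
    finally show ?thesis using sym_int(2)[OF x] truncated_symmetrize[OF u_meas i] by simp
  qed
  have e2: "(\<integral>y. ?I y * (?p y * g y * ker y) \<partial>lborel) = (\<integral>y. ?I y * (?p1 y * g y * ker y) \<partial>lborel) + u x * (\<integral>y. m y \<partial>lborel)"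
    unfolding p12 using i1 im by simp
  have tp: "integrable lborel (\<lambda>y::'a. ?I y * norm y powr (s - d - 2 * s))"
    "(\<integral>(y::'a). ?I y * norm y powr (s - d - 2 * s) \<partial>lborel) = tail_const (s - d - 2 * s) * (?d / 2) powr (- s)"
    using tail_power[of "?d / 2" "s - d - 2 * s"] d0 s01 by auto
  have b1: "\<bar>?I y * (?p1 y * g y * ker y)\<bar> \<le> N * Lam * (?I y * norm y powr (s - d - 2 * s))" for y
  proof -
    have "\<bar>?p1 y\<bar> \<le> N * norm y powr s"
    proof (cases "x + y \<in> closure \<Omega>")
      case True
      have "x \<in> closure \<Omega>" using x closure_subset by blast
      then show ?thesis using hoelder_s[of x "x + y"] True by simp
    qed (use N0 in simp)
    then have "\<bar>?p1 y * g y * ker y\<bar> \<le> N * norm y powr s * Lam * ker y"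
      unfolding abs_mult[of _ "ker y"] abs_mult[of _ "g y"]
      using g_nonneg[of y] g_le[of y] N0 by (intro mult_mono) auto
    also have "\<dots> = N * Lam * norm y powr (s - d - 2 * s)" by (simp add: powr_add[symmetric] algebra_simps)
    finally show ?thesis by (auto simp: indicator_def)
  qed
  have "\<bar>\<integral>y. ?I y * (?p1 y * g y * ker y) \<partial>lborel\<bar> \<le> (\<integral>y. \<bar>?I y * (?p1 y * g y * ker y)\<bar> \<partial>lborel)"
    by (rule integral_abs_bound)
  also have "\<dots> \<le> (\<integral>(y::'a). N * Lam * (?I y * norm y powr (s - d - 2 * s)) \<partial>lborel)"
    by (rule integral_mono[OF integrable_abs[OF i1] _ b1]) (intro integrable_mult_right tp)
  also have "\<dots> = N * Lam * (tail_const (s - d - 2 * s) * (?d / 2) powr (- s))" using tp by simp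
  also have "(?d / 2) powr (- s) = (1 / 2) powr (- s) * ?d powr (- s)"
    using powr_mult[of "1/2" ?d "- s"] by simp
  also have "N * Lam * (tail_const (s - d - 2 * s) * ((1 / 2) powr (- s) * ?d powr (- s))) = c_far * ?d powr (- s)"
    unfolding c_far_def by (simp only: mult_ac)
  finally have far: "\<bar>\<integral>y. ?I y * (?p1 y * g y * ker y) \<partial>lborel\<bar> \<le> c_far * ?d powr (- s)" .
  obtain a where a: "norm a = 1"
    "\<And>y. y \<in> ball ((2 * ?d) *\<^sub>R a) ?d \<Longrightarrow> x + y \<notin> closure \<Omega> \<and> ?d < norm y"
    using exterior_ball[OF x] by blast
  have "1 * cE * ?d powr (- 2 * s) \<le> (\<integral>y. m y \<partial>lborel)"
  proof (rule exterior_mass[OF a(1) d0 im])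
    show "0 \<le> m y" for y using g_nonneg by (simp add: m_def indicator_def)
    fix y assume "y \<in> ball ((2 * ?d) *\<^sub>R a) ?d"
    then have "x + y \<notin> closure \<Omega>" "y \<notin> ball 0 (?d / 2)" using a(2)[of y] d0 by auto
    then show "1 * g y * ker y \<le> m y" by (simp add: m_def)
  qed simp
  then have "\<bar>u x\<bar> * (cE * ?d powr (- 2 * s)) \<le> \<bar>u x\<bar> * \<bar>\<integral>y. m y \<partial>lborel\<bar>"
    by (intro mult_left_mono) auto
  also have "\<dots> = \<bar>u x * (\<integral>y. m y \<partial>lborel)\<bar>" by (simp add: abs_mult)
  also have "\<dots> \<le> \<bar>f x\<bar> + (c_near * ?d powr (- s) + c_far * ?d powr (- s))"
    using split e2 far near_part[OF x] by linarith
  finally show ?thesis by (simp add: algebra_simps)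
qed

definition "c_dec = (F + c_near + c_far) / cE"

lemma u_decay:
  assumes x: "x \<in> \<Omega>"
  shows "\<bar>u x\<bar> \<le> c_dec * bdist \<Omega> x powr s"
proof -
  let ?d = "bdist \<Omega> x"
  have d0: "?d > 0" using dpos[OF x] .
  have "\<bar>f x\<bar> \<le> F * ?d powr (- s)" using f_bound[OF x] d0 by (simp add: powr_minus field_simps)
  then have "\<bar>u x\<bar> * cE * ?d powr (- 2 * s) \<le> (F + c_near + c_far) * ?d powr (- s)"
    using u_decay_aux[OF x] by (simp add: algebra_simps)
  then have "\<bar>u x\<bar> * cE * ?d powr (- 2 * s) * ?d powr (2 * s) \<le> (F + c_near + c_far) * ?d powr (- s) * ?d powr (2 * s)"
    by (intro mult_right_mono) auto
  moreover have "?d powr (- 2 * s) * ?d powr (2 * s) = 1" "?d powr (- s) * ?d powr (2 * s) = ?d powr s"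
    using d0 by (simp_all add: powr_add[symmetric])
  ultimately have "\<bar>u x\<bar> * cE \<le> (F + c_near + c_far) * ?d powr s" by (simp only: mult.assoc mult_1_right)
  then show ?thesis unfolding c_dec_def using cE_pos by (simp add: pos_le_divide_eq)
qed

lemma c_dec_nonneg: "0 \<le> c_dec"
  unfolding c_dec_def using F0 c_near_nonneg c_far_nonneg cE_pos by simp

text \<open>Approach \<open>q\<close> from inside: \<open>u\<close> decays like \<delta>^s there and
  is Hoelder continuous up to the boundary.\<close>

lemma u_frontier:
  assumes q: "q \<in> frontier \<Omega>"
  shows "u q = 0"
proof (rule ccontr)
  assume "u q \<noteq> 0"
  define C where "C = c_dec + N + 1"
  have C: "C > 0" unfolding C_def using c_dec_nonneg N0 by simp
  \<comment> \<open>Chosen such that \<open>C * e powr s\<close> is half of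
    \<open>\<bar>u q\<bar>\<close>.\<close>
  define e where "e = (\<bar>u q\<bar> / (2 * C)) powr (1 / s)"
  have e: "e > 0" using \<open>u q \<noteq> 0\<close> C by (simp add: e_def)
  have qc: "q \<in> closure \<Omega>" using q by (simp add: frontier_def)
  then obtain x where x: "x \<in> \<Omega>" "dist x q < e" using closure_approachable e by blast
  have xq: "norm (x - q) < e" using x(2) by (simp add: dist_norm)
  have "\<bar>u x\<bar> \<le> c_dec * e powr s"
  proof -
    have "bdist \<Omega> x powr s \<le> e powr s"
      using bdist_le[OF q, of x] xq s01 by (intro powr_mono2) auto
    then show ?thesis using u_decay[OF x(1)] mult_left_mono[OF _ c_dec_nonneg] by (meson order_trans)
  qed
  moreover have "\<bar>u x - u q\<bar> \<le> N * e powr s"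
  proof -
    have "norm (x - q) powr s \<le> e powr s" using xq s01 by (intro powr_mono2) auto
    moreover have "x \<in> closure \<Omega>" using x(1) closure_subset by blast
    ultimately show ?thesis using hoelder_s[OF _ qc] mult_left_mono[OF _ N0] by (meson order_trans)
  qed
  ultimately have "\<bar>u q\<bar> \<le> (c_dec + N) * e powr s" by (simp add: algebra_simps)
  also have "\<dots> \<le> C * e powr s" unfolding C_def by (intro mult_right_mono) auto
  also have "\<dots> = \<bar>u q\<bar> / 2" unfolding e_def using s01 C by (simp add: powr_powr)
  finally show False using \<open>u q \<noteq> 0\<close> by simp
qed

section \<open>Consistency and the maximum principle\<close>

definition "c_cons = cD * Lam * (1 + cA) * ball_const (\<beta> - d - 2 * s)"

lemma c_cons_nonneg: "0 \<le> c_cons"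
  unfolding c_cons_def using cD_nonneg Lam0 cA_ge1 consts_nonneg(1)[of "\<beta> - d - 2 * s"] beta by auto

text \<open>The quadratic part of the second difference integrates to zero against the difference of the
  kernels, because the regularised kernel has the same second moment as the singular one.\<close>

lemma consistency:
  assumes z: "z \<in> \<Omega>" and e: "0 < \<epsilon>" "\<epsilon> \<le> bdist \<Omega> z / 2"
  shows "\<bar>f z - reg_op \<eta> s \<epsilon> u z\<bar> \<le> c_cons * \<epsilon> powr (\<beta> - 2 * s) * bdist \<Omega> z powr (s - \<beta>)"
proof -
  let ?d = "bdist \<Omega> z"
  have [measurable]: "ball (0::'a) \<epsilon> \<in> sets borel" by simp
  have [measurable]: "hess z \<in> borel_measurable borel"
    by (rule borel_measurable_continuous_onI[OF continuous_hess])
  let ?I = "\<lambda>y::'a. indicator (ball 0 \<epsilon>) y :: real"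
  let ?k = "\<lambda>y::'a. ker y - K\<epsilon> \<epsilon> y"
  \<comment> \<open>The Hessian form restricted to directions, homogeneous of degree 0, so that the
    second moment identity applies to \<open>G y * (norm y)\<^sup>2\<close>.\<close>
  define G where "G y = g y * hess z (sgn y)" for y
  have Gm: "G \<in> borel_measurable borel" unfolding G_def by measurable
  have Gb: "\<bar>G y\<bar> \<le> Lam * (cH * ?d powr (s - 2))" for y
  proof -
    have "\<bar>hess z (sgn y)\<bar> \<le> cH * ?d powr (s - 2) * (norm (sgn y))\<^sup>2" by (rule hess_bound[OF z])
    also have "\<dots> \<le> cH * ?d powr (s - 2) * 1"
      using cH_nonneg by (intro mult_left_mono) (auto simp: norm_sgn)
    finally show ?thesis unfolding G_def abs_mult
      using g_nonneg[of y] g_le[of y] by (intro mult_mono) auto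
  qed
  have Gh: "G (c *\<^sub>R y) = G y" if "c > 0" for c y
    using that g_hom[OF that, of y] by (simp add: G_def sgn_scaleR)
  have "has_bochner_integral lborel (\<lambda>y. ?I y * (G y * (norm y)\<^sup>2 * ?k y)) 0"
    using kernel_second_moment[OF s01 e(1) Gm Gb Gh] unfolding dim by simp
  moreover have "G y * (norm y)\<^sup>2 = g y * hess z y" for y
  proof -
    have "hess z y = hess z (norm y *\<^sub>R sgn y)" by (cases "y = 0") (simp_all add: sgn_div_norm)
    then show ?thesis by (simp add: G_def hess_scale)
  qed
  ultimately have q: "has_bochner_integral lborel (\<lambda>y. ?I y * (g y * hess z y * ?k y)) 0" by simp
  have i1: "integrable lborel (\<lambda>y. diff2 u z y * g y * ker y)" by (rule sym_int(1)[OF z])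
  have i2: "integrable lborel (\<lambda>y. diff2 u z y * g y * K\<epsilon> \<epsilon> y)" by (rule reg_integrable[OF u_meas u_bound e(1)])
  have eq: "diff2 u z y * g y * ker y - diff2 u z y * g y * K\<epsilon> \<epsilon> y = ?I y * (diff2 u z y * g y * ?k y)" for y
    using K\<epsilon>_outer[of \<epsilon> y] by (auto simp: indicator_def algebra_simps)
  have iI: "integrable lborel (\<lambda>y. ?I y * (diff2 u z y * g y * ?k y))"
    using Bochner_Integration.integrable_diff[OF i1 i2] unfolding eq .
  have iR: "integrable lborel (\<lambda>y. ?I y * ((diff2 u z y + hess z y) * g y * ?k y))"
    "(\<integral>y. ?I y * ((diff2 u z y + hess z y) * g y * ?k y) \<partial>lborel) = (\<integral>y. ?I y * (diff2 u z y * g y * ?k y) \<partial>lborel)"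
  proof -
    have eq': "?I y * ((diff2 u z y + hess z y) * g y * ?k y)
       = ?I y * (diff2 u z y * g y * ?k y) + ?I y * (g y * hess z y * ?k y)" for y
      by (simp add: algebra_simps)
    show "integrable lborel (\<lambda>y. ?I y * ((diff2 u z y + hess z y) * g y * ?k y))"
      "(\<integral>y. ?I y * ((diff2 u z y + hess z y) * g y * ?k y) \<partial>lborel) = (\<integral>y. ?I y * (diff2 u z y * g y * ?k y) \<partial>lborel)"
      unfolding eq' using iI q by (auto simp: has_bochner_integral_iff)
  qed
  have bp: "integrable lborel (\<lambda>y::'a. ?I y * norm y powr (\<beta> - d - 2 * s))"
    "(\<integral>y. ?I y * norm y powr (\<beta> - d - 2 * s) \<partial>lborel) = ball_const (\<beta> - d - 2 * s) * \<epsilon> powr (\<beta> - 2 * s)"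
    using ball_power[of \<epsilon> "\<beta> - d - 2 * s"] e(1) beta by auto
  let ?c = "cD * ?d powr (s - \<beta>) * Lam * (1 + cA)"
  have b: "\<bar>?I y * ((diff2 u z y + hess z y) * g y * ?k y)\<bar> \<le> ?c * (?I y * norm y powr (\<beta> - d - 2 * s))" for y
  \<comment> \<open>The origin is separate because \<open>ker 0 = 0\<close> there, so the comparison
    of the kernels fails; the second difference and the Hessian term vanish at it.\<close>
  proof (cases "norm y < \<epsilon> \<and> y \<noteq> 0")
    case True
    have "\<bar>?k y\<bar> \<le> \<bar>ker y\<bar> + \<bar>K\<epsilon> \<epsilon> y\<bar>" by (rule abs_triangle_ineq4)
    also have "\<dots> \<le> ker y + cA * ker y" using K\<epsilon>_bounds[OF e(1), of y] True by auto
    finally have k: "\<bar>?k y\<bar> \<le> (1 + cA) * ker y" by (simp add: distrib_right)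
    have "\<bar>(diff2 u z y + hess z y) * g y * ?k y\<bar> \<le> (cD * ?d powr (s - \<beta>) * norm y powr \<beta>) * Lam * ((1 + cA) * ker y)"
      unfolding abs_mult
      using second_difference[OF z, of y] True e(2) g_nonneg[of y] g_le[of y] cD_nonneg Lam0 k
      by (intro mult_mono mult_nonneg_nonneg) auto
    also have "\<dots> = ?c * (norm y powr \<beta> * ker y)" by (simp only: mult_ac)
    also have "norm y powr \<beta> * ker y = norm y powr (\<beta> - d - 2 * s)" by (simp add: powr_add[symmetric] algebra_simps)
    finally show ?thesis using True by simp
  next
    case False
    then show ?thesis
    proof (cases "y = 0")
      case True
      have "hess z 0 = 0" using hess_scale[of z 0 0] by simp
      then show ?thesis using True by simp
    qed auto
  qed
  have "f z - reg_op \<eta> s \<epsilon> u z = 1 / 2 * (\<integral>y. ?I y * (diff2 u z y * g y * ?k y) \<partial>lborel)"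
    unfolding sym_int(2)[OF z] reg_op_eq[OF u_meas] eq[symmetric] using i1 i2 by (simp add: right_diff_distrib)
  then have "\<bar>f z - reg_op \<eta> s \<epsilon> u z\<bar> = 1 / 2 * \<bar>\<integral>y. ?I y * ((diff2 u z y + hess z y) * g y * ?k y) \<partial>lborel\<bar>"
    by (simp only: iR(2) abs_mult abs_divide abs_one abs_numeral)
  also have "\<dots> \<le> \<bar>\<integral>y. ?I y * ((diff2 u z y + hess z y) * g y * ?k y) \<partial>lborel\<bar>" by simp
  also have "\<dots> \<le> (\<integral>y. \<bar>?I y * ((diff2 u z y + hess z y) * g y * ?k y)\<bar> \<partial>lborel)" by (rule integral_abs_bound)
  also have "\<dots> \<le> (\<integral>y. ?c * (?I y * norm y powr (\<beta> - d - 2 * s)) \<partial>lborel)"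
    by (rule integral_mono[OF integrable_abs[OF iR(1)] _ b]) (intro integrable_mult_right bp)
  also have "\<dots> = ?c * (ball_const (\<beta> - d - 2 * s) * \<epsilon> powr (\<beta> - 2 * s))" using bp by simp
  also have "\<dots> = c_cons * \<epsilon> powr (\<beta> - 2 * s) * ?d powr (s - \<beta>)" unfolding c_cons_def by (simp only: mult_ac)
  finally show ?thesis .
qed

lemma maximum_principle:
  assumes e [measurable]: "e \<in> borel_measurable borel" and N': "\<And>y. \<bar>e y\<bar> \<le> N'"
    and z: "z \<in> \<Omega>" and max: "\<And>y. e y \<le> e z" and nn: "0 \<le> e z"
    and out: "\<And>y. y \<notin> closure \<Omega> \<Longrightarrow> e y = 0" and eps: "0 < \<epsilon>" "\<epsilon> \<le> bdist \<Omega> z"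
  shows "e z * cE * bdist \<Omega> z powr (- 2 * s) \<le> 2 * reg_op \<eta> s \<epsilon> e z"
proof -
  let ?d = "bdist \<Omega> z"
  obtain a where a: "norm a = 1"
    "\<And>y. y \<in> ball ((2 * ?d) *\<^sub>R a) ?d \<Longrightarrow> z + y \<notin> closure \<Omega> \<and> ?d < norm y"
    using exterior_ball[OF z] by blast
  have "e z * cE * ?d powr (- 2 * s) \<le> (\<integral>y. diff2 e z y * g y * K\<epsilon> \<epsilon> y \<partial>lborel)"
  proof (rule exterior_mass[OF a(1) dpos[OF z] reg_integrable[OF e N' eps(1)] _ nn])
    have diff: "0 \<le> diff2 e z y" for y using max[of "z - y"] max[of "z + y"] by linarith
    show "0 \<le> diff2 e z y * g y * K\<epsilon> \<epsilon> y" for y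
      using diff[of y] g_nonneg[of y] K\<epsilon>_bounds(1)[OF eps(1), of y] by simp
    fix y assume "y \<in> ball ((2 * ?d) *\<^sub>R a) ?d"
    then have y: "z + y \<notin> closure \<Omega>" "?d < norm y" using a(2)[of y] by auto
    \<comment> \<open>Only \<open>z + y\<close> has to be in the exterior; \<open>e (z - y)\<close>
      is bounded by the maximum. The exterior ball also has norm larger than \<epsilon>, where the
      kernel is unmodified.\<close>
    have "e z \<le> diff2 e z y" using max[of "z - y"] out[OF y(1)] by simp
    then have "e z * g y * ker y \<le> diff2 e z y * g y * ker y"
      using g_nonneg[of y] by (intro mult_right_mono) auto
    moreover have "K\<epsilon> \<epsilon> y = ker y" using y(2) eps(2) by (intro K\<epsilon>_outer) simp
    ultimately show "e z * g y * ker y \<le> diff2 e z y * g y * K\<epsilon> \<epsilon> y" by simp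
  qed
  then show ?thesis unfolding reg_op_eq[OF e] by simp
qed

end

section \<open>The discrete problem\<close>

context fractional_problem begin

text \<open>The summand 1 makes powers of \<open>L\<close> monotone in the exponent. The constants
  that follow depend on the mesh only through the argument \<open>Kc\<close>, which keeps them
  independent of h.\<close>

definition "L = 1 + diameter (closure \<Omega>)"
text \<open>One summand for each sign of the exponent s - p/\<mu> in
  \<open>power_rate\<close>.\<close>

definition "c_pw Kc p = L powr s + Kc powr p"
definition "c_int = cT + cH"
definition "c_sup Kc = c_int * Kc powr \<beta>' * c_pw Kc (\<beta>' - s) + 2 * N * Kc powr s"
definition "c_loc Kc = c_int * Kc powr \<beta>' * (2 * Kc) powr s * c_pw Kc (\<beta>' - s) + 2 * N * Kc powr s * (2 * Kc) powr s"
definition "c_res Kc = c_cons * Kc powr (\<beta> / 2 - s) * c_pw Kc (\<beta> / 2 - s)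
  + Lam * (c_loc Kc * cK * (4 * Kc) powr s + c_sup Kc * tail_const (- d - 2 * s) * (1 / 2) powr (- 2 * s))"
definition "c_total Kc = c_sup Kc + 2 * c_res Kc / cE"

lemma L_ge1: "1 \<le> L"
  unfolding L_def using diameter_ge_0[OF bounded_closure[OF bounded_dom]] by simp

lemma bdist_le_L:
  assumes "x \<in> closure \<Omega>"
  shows "bdist \<Omega> x \<le> L"
proof -
  obtain q where q: "q \<in> frontier \<Omega>" "bdist \<Omega> x = norm (x - q)"
    using bdist_attained[OF bounded_dom nonempty_dom] by blast
  have "q \<in> closure \<Omega>" using q(1) by (simp add: frontier_def)
  from diameter_bounded_bound[OF bounded_closure[OF bounded_dom] assms this]
  show ?thesis using q(2) by (simp add: L_def dist_norm)
qed

lemma c_pw_nonneg: "0 \<le> c_pw Kc p" by (simp add: c_pw_def)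

lemma c_int_nonneg: "0 \<le> c_int" unfolding c_int_def using cT_nonneg cH_nonneg by simp

lemma c_sup_nonneg: "0 \<le> c_sup Kc" and c_loc_nonneg: "0 \<le> c_loc Kc"
  unfolding c_sup_def c_loc_def using c_int_nonneg c_pw_nonneg N0
  by (auto intro!: add_nonneg_nonneg mult_nonneg_nonneg)

text \<open>If \<open>s < p / \<mu>\<close>, the negative power of \<open>D\<close> is compensated by \<open>h powr \<mu> \<le> Kc * D\<close>.\<close>

lemma power_rate:
  assumes h: "0 < h" and mu: "1 \<le> \<mu>" and p: "0 < p" and D: "0 < D" "D \<le> L" "h powr \<mu> \<le> Kc * D"
    and Kc: "1 \<le> Kc" and R: "h powr p \<le> R" "h powr (\<mu> * s) \<le> R"
  shows "h powr p * D powr (s - p / \<mu>) \<le> c_pw Kc p * R"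
proof (cases "p / \<mu> \<le> s")
  case True
  have "D powr (s - p / \<mu>) \<le> L powr (s - p / \<mu>)" using True D by (intro powr_mono2) auto
  also have "\<dots> \<le> L powr s" using L_ge1 p mu by (intro powr_mono) auto
  also have "\<dots> \<le> c_pw Kc p" by (simp add: c_pw_def)
  finally have "h powr p * D powr (s - p / \<mu>) \<le> R * c_pw Kc p"
    using R(1) by (intro mult_mono) (auto intro: order_trans[OF powr_ge_zero])
  then show ?thesis by (simp add: mult.commute)
next
  case False
  have neg: "s - p / \<mu> \<le> 0" using False by linarith
  have pos: "0 < h powr \<mu> / Kc" "h powr \<mu> / Kc \<le> D" using D Kc h by (simp_all add: divide_le_eq mult.commute)
  have "D powr (s - p / \<mu>) \<le> (h powr \<mu> / Kc) powr (s - p / \<mu>)"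
    by (rule powr_mono2'[OF neg pos])
  also have "\<dots> = h powr (\<mu> * s - p) * Kc powr (p / \<mu> - s)"
  proof -
    have "\<mu> * (s - p / \<mu>) = \<mu> * s - p" using mu by (simp add: right_diff_distrib)
    moreover have "1 / Kc powr (s - p / \<mu>) = Kc powr (p / \<mu> - s)"
      using powr_minus_divide[of Kc "s - p / \<mu>"] by simp
    moreover have "(h powr \<mu> / Kc) powr (s - p / \<mu>) = h powr (\<mu> * (s - p / \<mu>)) * (1 / Kc powr (s - p / \<mu>))"
      using h Kc by (simp add: powr_divide powr_powr)
    ultimately show ?thesis by (simp only:)
  qed
  also have "\<dots> \<le> h powr (\<mu> * s - p) * Kc powr p"
  proof -
    have "p / \<mu> \<le> p" using mu p by (simp add: divide_le_eq mult_le_cancel_left1)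
    then show ?thesis using Kc s01 by (intro mult_left_mono powr_mono) auto
  qed
  finally have "h powr p * D powr (s - p / \<mu>) \<le> h powr p * (h powr (\<mu> * s - p) * Kc powr p)"
    by (intro mult_left_mono) auto
  also have "\<dots> = h powr (\<mu> * s) * Kc powr p" using h by (simp add: powr_add[symmetric] mult.assoc[symmetric])
  also have "\<dots> \<le> R * c_pw Kc p"
    using R(2) by (intro mult_mono) (auto simp: c_pw_def intro: order_trans[OF powr_ge_zero])
  finally show ?thesis by (simp add: mult.commute)
qed

end

text \<open>\<open>R\<close> stands for any common bound of the three rates; it becomes their
  maximum in the end.\<close>

locale discrete_problem =
  fractional_problem \<Omega> u s \<beta> M N g \<eta> lam Lam d f F + graded_mesh \<Omega> \<T> \<sigma> \<kappa> \<mu> h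
  for \<Omega> :: "'a::euclidean_space set" and u s \<beta> M N g \<eta> lam Lam d f F \<T> \<sigma> \<kappa> \<mu> h +
  fixes uh :: "'a \<Rightarrow> real" and R :: real
  assumes uh: "uh \<in> fe_space \<Omega> \<T>"
    and scheme: "\<And>z. z \<in> interior_vertices \<Omega> \<T> \<Longrightarrow> reg_op \<eta> s (eps_bar \<Omega> \<T> z) uh z = f z"
    and rate: "h powr (\<mu> * s) \<le> R" "h powr (\<beta>' - s) \<le> R" "h powr (\<beta> / 2 - s) \<le> R"
begin

lemma R_nonneg: "0 \<le> R" using rate(1) by (rule order_trans[OF powr_ge_zero])

section \<open>The interpolation error\<close>

definition Iu :: "'a \<Rightarrow> real" where
  "Iu = (SOME w. w \<in> fe_space \<Omega> \<T> \<and> (\<forall>T\<in>\<T>. \<forall>c. c extreme_point_of T \<longrightarrow> w c = u c))"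

lemma Iu: "Iu \<in> fe_space \<Omega> \<T>" "\<And>T c. T \<in> \<T> \<Longrightarrow> c extreme_point_of T \<Longrightarrow> Iu c = u c"
proof -
  let ?P = "\<lambda>w. w \<in> fe_space \<Omega> \<T> \<and> (\<forall>T\<in>\<T>. \<forall>c. c extreme_point_of T \<longrightarrow> w c = u c)"
  obtain w where w: "w \<in> fe_space \<Omega> \<T>" "\<And>T c. T \<in> \<T> \<Longrightarrow> c extreme_point_of T \<Longrightarrow> w c = u c"
    using fe_interpolant[of u, OF u_frontier] by blast
  have "?P w" by (intro conjI ballI allI impI w)
  then have P: "?P Iu" unfolding Iu_def by (rule someI[of ?P])
  show "Iu \<in> fe_space \<Omega> \<T>" by (rule conjunct1[OF P])
  show "Iu c = u c" if "T \<in> \<T>" "c extreme_point_of T" for T c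
    using conjunct2[OF P] that by simp
qed

lemma fe_affine_bound:
  assumes T: "T \<in> \<T>" and v: "v \<in> fe_space \<Omega> \<T>"
    and b: "\<And>c. c extreme_point_of T \<Longrightarrow> \<bar>v c - (a \<bullet> c + b)\<bar> \<le> B" and x: "x \<in> T"
  shows "\<bar>v x - (a \<bullet> x + b)\<bar> \<le> B"
proof -
  obtain a' b' where ab: "\<forall>x\<in>T. v x = a' \<bullet> x + b'" using v T unfolding fe_space_def by blast
  have cT: "c \<in> T" if "c extreme_point_of T" for c using that by (simp add: extreme_point_of_def)
  have "(a' - a) \<bullet> x + (b' - b) \<le> B"
  proof (rule affine_le_on_extreme[OF compact_elem[OF T] convex_elem[OF T] _ x])
    fix c assume c: "c extreme_point_of T"
    show "(a' - a) \<bullet> c + (b' - b) \<le> B" using b[OF c] ab cT[OF c] by (simp add: inner_diff_left)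
  qed
  moreover have "- B \<le> (a' - a) \<bullet> x + (b' - b)"
  proof (rule affine_ge_on_extreme[OF compact_elem[OF T] convex_elem[OF T] _ x])
    fix c assume c: "c extreme_point_of T"
    show "- B \<le> (a' - a) \<bullet> c + (b' - b)" using b[OF c] ab cT[OF c] by (simp add: inner_diff_left)
  qed
  ultimately show ?thesis using ab x by (simp add: inner_diff_left)
qed

abbreviation w where "w \<equiv> \<lambda>x. u x - Iu x"

lemma w_interior_elem:
  assumes T: "T \<in> \<T>" "T \<inter> frontier \<Omega> = {}" and x: "x \<in> T"
  defines "D \<equiv> setdist T (frontier \<Omega>)"
  shows "\<bar>w x\<bar> \<le> c_int * D powr (s - \<beta>') * diameter T powr \<beta>'"
proof -
  have W: "T \<subseteq> {x\<in>\<Omega>. D \<le> bdist \<Omega> x}"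
    using elem_subset[OF T(1)] T(2) frontier_dom setdist_frontier_le unfolding D_def by blast
  have D: "0 < D" using interior_elem(1)[OF T] unfolding D_def .
  obtain a where a: "\<And>x'. x' \<in> T \<Longrightarrow> \<bar>u x' - u x - a \<bullet> (x' - x)\<bar> \<le> (cT + cH) * D powr (s - \<beta>') * norm (x' - x) powr \<beta>'"
    using affine_approximation[OF convex_elem[OF T(1)] W D x] by blast
  let ?B = "c_int * D powr (s - \<beta>') * diameter T powr \<beta>'"
  \<comment> \<open>The affine function equals \<open>u\<close> at the point \<open>x\<close>
    itself, so its distance from \<open>Iu\<close> at \<open>x\<close> is the interpolation error,
    and it suffices to bound it at the vertices.\<close>
  have "\<bar>Iu x - (a \<bullet> x + (u x - a \<bullet> x))\<bar> \<le> ?B"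
  proof (rule fe_affine_bound[OF T(1) Iu(1) _ x])
    fix c assume c: "c extreme_point_of T"
    have cT: "c \<in> T" using c by (simp add: extreme_point_of_def)
    have "dist c x \<le> diameter T" by (rule diameter_bounded_bound[OF bounded_elem[OF T(1)] cT x])
    then have "norm (c - x) powr \<beta>' \<le> diameter T powr \<beta>'"
      using beta'_props by (intro powr_mono2) (auto simp: dist_norm)
    then have "(cT + cH) * D powr (s - \<beta>') * norm (c - x) powr \<beta>' \<le> ?B"
      unfolding c_int_def using cT_nonneg cH_nonneg by (intro mult_left_mono) auto
    then show "\<bar>Iu c - (a \<bullet> c + (u x - a \<bullet> x))\<bar> \<le> ?B"
      using a[OF cT] Iu(2)[OF T(1) c] by (simp add: inner_diff_right algebra_simps)
  qed
  then show ?thesis by (simp add: abs_minus_commute)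
qed

text \<open>No smoothness is available up to the boundary. Both \<open>u\<close> and its interpolant
  are small separately, since \<open>u\<close> vanishes at a point of the element and is Hoelder
  continuous of order s.\<close>

lemma w_boundary_elem:
  assumes T: "T \<in> \<T>" "T \<inter> frontier \<Omega> \<noteq> {}" and x: "x \<in> T"
  shows "\<bar>w x\<bar> \<le> 2 * N * K powr s * h powr (\<mu> * s)"
proof -
  obtain q where q: "q \<in> T" "q \<in> frontier \<Omega>" using T(2) by blast
  have ub: "\<bar>u x'\<bar> \<le> N * (K powr s * h powr (\<mu> * s))" if x': "x' \<in> T" for x'
  proof -
    have "dist x' q \<le> diameter T" by (rule diameter_bounded_bound[OF bounded_elem[OF T(1)] x' q(1)])
    also have "\<dots> \<le> K * h powr \<mu>" by (rule boundary_elem(2)[OF T])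
    finally have "norm (x' - q) powr s \<le> (K * h powr \<mu>) powr s"
      using s01 by (intro powr_mono2) (auto simp: dist_norm)
    also have "\<dots> = K powr s * h powr (\<mu> * s)" by (simp add: powr_mult powr_powr)
    finally have "N * norm (x' - q) powr s \<le> N * (K powr s * h powr (\<mu> * s))" using N0 by (intro mult_left_mono)
    moreover have "\<bar>u x' - u q\<bar> \<le> N * norm (x' - q) powr s"
      using x' q(1) elem_subset[OF T(1)] by (intro hoelder_s) auto
    ultimately show ?thesis using u_frontier[OF q(2)] by simp
  qed
  have "\<bar>Iu x - (0 \<bullet> x + 0)\<bar> \<le> N * (K powr s * h powr (\<mu> * s))"
  proof (rule fe_affine_bound[OF T(1) Iu(1) _ x])
    fix c assume c: "c extreme_point_of T"
    then have "c \<in> T" by (simp add: extreme_point_of_def)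
    then show "\<bar>Iu c - (0 \<bullet> c + 0)\<bar> \<le> N * (K powr s * h powr (\<mu> * s))"
      using ub Iu(2)[OF T(1) c] by simp
  qed
  then show ?thesis using ub[OF x] by simp
qed

lemma w_outside: "x \<notin> \<Omega> \<Longrightarrow> w x = 0"
proof -
  assume x: "x \<notin> \<Omega>"
  have "Iu x = 0" using Iu(1) x unfolding fe_space_def by blast
  moreover have "u x = 0"
  proof (cases "x \<in> closure \<Omega>")
    case True
    then have "x \<in> frontier \<Omega>" using x unfolding frontier_dom by blast
    then show ?thesis by (rule u_frontier)
  qed (rule u_outside)
  ultimately show ?thesis by simp
qed

lemma mem_elem: "x \<in> \<Omega> \<Longrightarrow> \<exists>T\<in>\<T>. x \<in> T"
  using subsetD[OF closure_subset[of \<Omega>]] unfolding Union_mesh[symmetric] by blast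

lemma setdist_le_L:
  assumes "T \<in> \<T>" "x \<in> T"
  shows "setdist T (frontier \<Omega>) \<le> L"
  by (rule order_trans[OF setdist_frontier_le[OF assms(2)] bdist_le_L[OF subsetD[OF elem_subset[OF assms(1)] assms(2)]]])

lemma w_sup: "\<bar>w x\<bar> \<le> c_sup K * R"
proof (cases "x \<in> \<Omega>")
  case False
  then show ?thesis using w_outside c_sup_nonneg R_nonneg by simp
next
  case True
  then obtain T where T: "T \<in> \<T>" "x \<in> T" using mem_elem by blast
  let ?A = "c_int * K powr \<beta>' * c_pw K (\<beta>' - s) * R" and ?B = "2 * N * K powr s * R"
  have AB: "0 \<le> ?A" "0 \<le> ?B" using c_int_nonneg c_pw_nonneg R_nonneg N0 by auto
  have "\<bar>w x\<bar> \<le> ?A + ?B"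
  proof (cases "T \<inter> frontier \<Omega> = {}")
    case True
    let ?D = "setdist T (frontier \<Omega>)" and ?q = "\<beta>' - s"
    note ie = interior_elem[OF T(1) True]
    have dT: "0 \<le> diameter T" by (rule diameter_ge_0[OF bounded_elem[OF T(1)]])
    \<comment> \<open>The power \<beta>' - s of the diameter, bounded by the grading, gives the
      rate; the power s, bounded by a multiple of D, leaves exactly the exponent s - q/\<mu> that
      \<open>power_rate\<close> expects.\<close>
    have "diameter T powr \<beta>' = diameter T powr ?q * diameter T powr s"
      by (simp add: powr_add[symmetric])
    also have "\<dots> \<le> (K * (h * ?D powr \<tau>)) powr ?q * (K * ?D) powr s"
      using ie dT beta'_props s01 by (intro mult_mono powr_mono2) auto
    also have "\<dots> = K powr \<beta>' * (h powr ?q * (?D powr (\<tau> * ?q) * ?D powr s))"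
    proof -
      have "K powr \<beta>' = K powr ?q * K powr s" by (simp add: powr_add[symmetric])
      then show ?thesis by (simp only: powr_mult powr_powr mult_ac)
    qed
    finally have "c_int * ?D powr (s - \<beta>') * diameter T powr \<beta>'
       \<le> c_int * ?D powr (s - \<beta>') * (K powr \<beta>' * (h powr ?q * (?D powr (\<tau> * ?q) * ?D powr s)))"
      using c_int_nonneg by (intro mult_left_mono) auto
    also have "\<dots> = c_int * K powr \<beta>' * (h powr ?q * (?D powr (s - \<beta>') * (?D powr (\<tau> * ?q) * ?D powr s)))"
      by (simp only: mult_ac)
    also have "?D powr (s - \<beta>') * (?D powr (\<tau> * ?q) * ?D powr s) = ?D powr (s - ?q / \<mu>)"
    proof -
      have "\<tau> * ?q = ?q - ?q / \<mu>" using mu by (simp add: field_simps)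
      then have "s - \<beta>' + (\<tau> * ?q + s) = s - ?q / \<mu>" by simp
      then show ?thesis by (simp only: powr_add[symmetric])
    qed
    also have "h powr ?q * ?D powr (s - ?q / \<mu>) \<le> c_pw K ?q * R"
      using ie setdist_le_L[OF T] beta'_props K_ge(1) rate by (intro power_rate[OF h_pos mu]) auto
    then have "c_int * K powr \<beta>' * (h powr ?q * ?D powr (s - ?q / \<mu>)) \<le> c_int * K powr \<beta>' * (c_pw K ?q * R)"
      using c_int_nonneg by (intro mult_left_mono) auto
    finally have "\<bar>w x\<bar> \<le> ?A" using w_interior_elem[OF T(1) True T(2)] by (simp add: mult_ac)
    then show ?thesis using AB by linarith
  next
    case False
    have "2 * N * K powr s * h powr (\<mu> * s) \<le> ?B" using rate(1) N0 by (intro mult_left_mono) auto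
    then show ?thesis using w_boundary_elem[OF T(1) False T(2)] AB by linarith
  qed
  then show ?thesis unfolding c_sup_def by (simp add: distrib_right)
qed

text \<open>Compared with \<open>w_sup\<close> this gains h^s \<delta>^(-s/\<mu>), of the order (h_z
  / \<delta>)^s. All of the diameter power is now bounded by the grading, instead of spending the
  power s on the distance.\<close>

lemma w_near:
  assumes z: "z \<in> interior_vertices \<Omega> \<T>" and x: "norm (x - z) < bdist \<Omega> z / 2"
  shows "\<bar>w x\<bar> \<le> c_loc K * R * h powr s * bdist \<Omega> z powr (- (s / \<mu>))"
proof -
  let ?d = "bdist \<Omega> z"
  have zO: "z \<in> \<Omega>" using interior_vertexD(1)[OF z] .
  have d: "0 < ?d" using dpos[OF zO] .
  have xO: "x \<in> \<Omega>" "?d / 2 \<le> bdist \<Omega> x" using half_ball[OF zO] x by auto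
  obtain T where T: "T \<in> \<T>" "x \<in> T" using mem_elem xO(1) by blast
  let ?A = "c_int * K powr \<beta>' * (2 * K) powr s * c_pw K (\<beta>' - s) * R"
  let ?B = "2 * N * K powr s * (2 * K) powr s * R"
  have AB: "0 \<le> ?A" "0 \<le> ?B" using c_int_nonneg c_pw_nonneg R_nonneg N0 by auto
  have smu: "0 \<le> s / \<mu>" "s / \<mu> \<le> s" using s01 mu by (auto simp: divide_le_eq)
  have K2: "(2 * K) powr (s / \<mu>) \<le> (2 * K) powr s" using smu K_ge(1) by (intro powr_mono) auto
  \<comment> \<open>Proved in normalised form, with the gain moved to the left; it is moved back at
    the end.\<close>
  have "\<bar>w x\<bar> * h powr (- s) * ?d powr (s / \<mu>) \<le> ?A + ?B"
  proof (cases "T \<inter> frontier \<Omega> = {}")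
    case True
    let ?D = "setdist T (frontier \<Omega>)" and ?q = "\<beta>' - s"
    note ie = interior_elem[OF T(1) True]
    have dT: "0 \<le> diameter T" by (rule diameter_ge_0[OF bounded_elem[OF T(1)]])
    have kK: "1 + \<kappa>\<^sup>2 * \<sigma> \<le> K"
    proof -
      have "1 + \<kappa>\<^sup>2 * \<sigma> \<le> 1 + \<kappa>\<^sup>2 * \<sigma> + \<kappa>" using kap by simp
      also have "\<dots> \<le> (\<kappa> * \<sigma>) * (1 + \<kappa>\<^sup>2 * \<sigma> + \<kappa>)"
        using mult_right_mono[OF ks_ge1, of "1 + \<kappa>\<^sup>2 * \<sigma> + \<kappa>"] sig kap by simp
      also have "\<dots> \<le> K" using K_ge(4) by (simp add: mult_ac)
      finally show ?thesis .
    qed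
    have "?d \<le> 2 * bdist \<Omega> x" using xO(2) by simp
    also have "\<dots> \<le> 2 * ((1 + \<kappa>\<^sup>2 * \<sigma>) * ?D)" using bdist_le_setdist[OF T(1) True T(2)] by simp
    also have "\<dots> \<le> (2 * K) * ?D" using mult_right_mono[OF kK less_imp_le[OF ie(1)]] by simp
    finally have "?d powr (s / \<mu>) \<le> ((2 * K) * ?D) powr (s / \<mu>)" using d smu by (intro powr_mono2) auto
    also have "\<dots> = (2 * K) powr (s / \<mu>) * ?D powr (s / \<mu>)" by (rule powr_mult)
    also have "\<dots> \<le> (2 * K) powr s * ?D powr (s / \<mu>)" using K2 by (intro mult_right_mono) auto
    finally have dle: "?d powr (s / \<mu>) \<le> (2 * K) powr s * ?D powr (s / \<mu>)" .
    have "diameter T powr \<beta>' \<le> (K * (h * ?D powr \<tau>)) powr \<beta>'"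
      using ie dT beta'_props by (intro powr_mono2) auto
    also have "\<dots> = K powr \<beta>' * (h powr \<beta>' * ?D powr (\<tau> * \<beta>'))" by (simp add: powr_mult powr_powr)
    finally have "c_int * ?D powr (s - \<beta>') * diameter T powr \<beta>'
       \<le> c_int * ?D powr (s - \<beta>') * (K powr \<beta>' * (h powr \<beta>' * ?D powr (\<tau> * \<beta>')))"
      using c_int_nonneg by (intro mult_left_mono) auto
    then have wx: "\<bar>w x\<bar> \<le> c_int * ?D powr (s - \<beta>') * (K powr \<beta>' * (h powr \<beta>' * ?D powr (\<tau> * \<beta>')))"
      using w_interior_elem[OF T(1) True T(2)] by simp
    have "\<bar>w x\<bar> * h powr (- s) * ?d powr (s / \<mu>)
      \<le> (c_int * ?D powr (s - \<beta>') * (K powr \<beta>' * (h powr \<beta>' * ?D powr (\<tau> * \<beta>')))) * h powr (- s)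
         * ((2 * K) powr s * ?D powr (s / \<mu>))"
      using wx dle c_int_nonneg by (intro mult_mono mult_nonneg_nonneg) auto
    also have "\<dots> = c_int * K powr \<beta>' * (2 * K) powr s * ((h powr \<beta>' * h powr (- s)) *
        (?D powr (s - \<beta>') * ?D powr (\<tau> * \<beta>') * ?D powr (s / \<mu>)))"
      by (simp only: mult_ac)
    also have "\<dots> = c_int * K powr \<beta>' * (2 * K) powr s * (h powr ?q * ?D powr (s - \<beta>' + \<tau> * \<beta>' + s / \<mu>))"
      by (simp add: powr_add[symmetric])
    also have "s - \<beta>' + \<tau> * \<beta>' + s / \<mu> = s - ?q / \<mu>"
    proof -
      have "\<tau> * \<beta>' = \<beta>' - \<beta>' / \<mu>" using mu by (simp add: field_simps)
      then show ?thesis by (simp add: diff_divide_distrib)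
    qed
    also have "h powr ?q * ?D powr (s - ?q / \<mu>) \<le> c_pw K ?q * R"
      using ie setdist_le_L[OF T] beta'_props K_ge(1) rate by (intro power_rate[OF h_pos mu]) auto
    then have "c_int * K powr \<beta>' * (2 * K) powr s * (h powr ?q * ?D powr (s - ?q / \<mu>))
       \<le> c_int * K powr \<beta>' * (2 * K) powr s * (c_pw K ?q * R)"
      using c_int_nonneg by (intro mult_left_mono) auto
    finally have "\<bar>w x\<bar> * h powr (- s) * ?d powr (s / \<mu>) \<le> ?A" by (simp only: mult.assoc)
    then show ?thesis using AB by linarith
  next
    case False
    \<comment> \<open>At an element touching the boundary, \<delta>(z) is at most a multiple of
      h^\<mu>, so the weight \<delta>^(s/\<mu>) is of order h^s and cancels h^(-s).\<close>
    have "?d \<le> 2 * bdist \<Omega> x" using xO(2) by simp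
    also have "\<dots> \<le> 2 * diameter T" using bdist_le_diameter[OF T(1) False T(2)] by simp
    also have "\<dots> \<le> (2 * K) * h powr \<mu>" using boundary_elem(2)[OF T(1) False] by simp
    finally have "?d powr (s / \<mu>) \<le> ((2 * K) * h powr \<mu>) powr (s / \<mu>)" using d smu by (intro powr_mono2) auto
    also have "\<dots> = (2 * K) powr (s / \<mu>) * h powr s" using mu by (simp add: powr_mult powr_powr)
    also have "\<dots> \<le> (2 * K) powr s * h powr s" using K2 by (intro mult_right_mono) auto
    finally have dle: "?d powr (s / \<mu>) \<le> (2 * K) powr s * h powr s" .
    have "\<bar>w x\<bar> * h powr (- s) * ?d powr (s / \<mu>)
      \<le> (2 * N * K powr s * h powr (\<mu> * s)) * h powr (- s) * ((2 * K) powr s * h powr s)"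
      using w_boundary_elem[OF T(1) False T(2)] dle N0 by (intro mult_mono mult_nonneg_nonneg) auto
    also have "\<dots> = 2 * N * K powr s * (2 * K) powr s * (h powr (\<mu> * s) * (h powr (- s) * h powr s))"
      by (simp only: mult_ac)
    also have "h powr (- s) * h powr s = 1" using h_pos by (simp add: powr_add[symmetric])
    also have "2 * N * K powr s * (2 * K) powr s * (h powr (\<mu> * s) * 1) \<le> ?B"
      using rate(1) N0 by (intro mult_left_mono) auto
    finally show ?thesis using AB by linarith
  qed
  also have "?A + ?B = c_loc K * R" unfolding c_loc_def by (simp add: distrib_right)
  finally have "\<bar>w x\<bar> * h powr (- s) * ?d powr (s / \<mu>) * (h powr s * ?d powr (- (s / \<mu>)))
     \<le> c_loc K * R * (h powr s * ?d powr (- (s / \<mu>)))" by (intro mult_right_mono) auto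
  moreover have "\<bar>w x\<bar> * h powr (- s) * ?d powr (s / \<mu>) * (h powr s * ?d powr (- (s / \<mu>)))
     = \<bar>w x\<bar> * (h powr (- s) * h powr s) * (?d powr (s / \<mu>) * ?d powr (- (s / \<mu>)))" by (simp only: mult_ac)
  moreover have "h powr (- s) * h powr s = 1" "?d powr (s / \<mu>) * ?d powr (- (s / \<mu>)) = 1"
    using h_pos d by (simp_all add: powr_add[symmetric])
  ultimately have "\<bar>w x\<bar> * 1 * 1 \<le> c_loc K * R * (h powr s * ?d powr (- (s / \<mu>)))" by metis
  then show ?thesis by (simp only: mult_1_right mult.assoc)
qed

text \<open>The patch stays in the closure of the domain, so the vertex size is at most \<delta>(z);
  this keeps \<epsilon> within the half ball where the Taylor bounds hold.\<close>

lemma eps_bar_props: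
  assumes z: "z \<in> interior_vertices \<Omega> \<T>"
  defines "\<epsilon> \<equiv> eps_bar \<Omega> \<T> z"
  shows "0 < \<epsilon>" "\<epsilon> \<le> bdist \<Omega> z / 2"
    "\<epsilon> powr (2 * p) = (vertex_size \<T> z * bdist \<Omega> z / 4) powr p"
    "0 < vertex_size \<T> z"
proof -
  let ?d = "bdist \<Omega> z" and ?h = "vertex_size \<T> z"
  have d: "0 < ?d" using dpos interior_vertexD(1)[OF z] by blast
  have "0 < h * ?d powr \<tau>" using h_pos d by simp
  then have "0 < K * ?h" using vertex_size_lower[OF z] by linarith
  then show h: "0 < ?h" using K_pos by (simp add: zero_less_mult_iff)
  show e: "0 < \<epsilon>" unfolding \<epsilon>_def eps_bar_def using h d by simp
  have "\<epsilon> \<le> 1 / 2 * ?d powr (1 / 2) * ?d powr (1 / 2)"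
    unfolding \<epsilon>_def eps_bar_def using vertex_size_le_bdist[OF z] h
    by (intro mult_right_mono mult_left_mono powr_mono2) auto
  then show "\<epsilon> \<le> ?d / 2" using d by (simp add: powr_add[symmetric])
  have "\<epsilon> powr 2 = ?h * ?d / 4"
    unfolding \<epsilon>_def eps_bar_def by (simp only: powr_mult powr_powr) (use h d in \<open>simp add: power_divide\<close>)
  then show "\<epsilon> powr (2 * p) = (?h * ?d / 4) powr p" by (metis powr_powr)
qed

section \<open>Residual of the interpolant and comparison at the vertices\<close>

lemma fe_measurable: "v \<in> fe_space \<Omega> \<T> \<Longrightarrow> v \<in> borel_measurable borel"
  using closure_subset[of \<Omega>] unfolding fe_space_def by (intro borel_extension) auto

lemma fe_bounded:
  assumes "v \<in> fe_space \<Omega> \<T>"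
  obtains B where "\<And>y. \<bar>v y\<bar> \<le> B"
proof -
  have "compact (v ` closure \<Omega>)"
    using assms bounded_dom unfolding fe_space_def by (intro compact_continuous_image) auto
  then have "bounded (v ` closure \<Omega>)" by (rule compact_imp_bounded)
  then obtain B where B: "\<forall>y\<in>closure \<Omega>. \<bar>v y\<bar> \<le> B"
    unfolding bounded_iff by (auto simp del: closure_closed)
  have "\<bar>v y\<bar> \<le> max B 0" for y
  proof (cases "y \<in> closure \<Omega>")
    case False
    then have "y \<notin> \<Omega>" using closure_subset by blast
    then show ?thesis using assms unfolding fe_space_def by simp
  qed (use B in fastforce)
  then show ?thesis by (rule that)
qed

lemma residual:
  assumes z: "z \<in> interior_vertices \<Omega> \<T>"
  shows "\<bar>reg_op \<eta> s (eps_bar \<Omega> \<T> z) Iu z - f z\<bar> \<le> c_res K * R * bdist \<Omega> z powr (- 2 * s)"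
proof -
  let ?d = "bdist \<Omega> z" and ?h = "vertex_size \<T> z" and ?e = "eps_bar \<Omega> \<T> z"
  let ?p = "\<beta> / 2 - s"
  have zO: "z \<in> \<Omega>" using interior_vertexD(1)[OF z] .
  have zc: "z \<in> closure \<Omega>" using zO closure_subset by blast
  have d: "0 < ?d" using dpos[OF zO] .
  note ep = eps_bar_props[OF z]
  have p: "0 < ?p" using beta by simp
  have hz: "?h \<le> K * (h * ?d powr \<tau>)" by (rule vertex_size_upper[OF z])
  have hz': "h * ?d powr \<tau> / K \<le> ?h" using vertex_size_lower[OF z] K_pos by (simp add: divide_le_eq mult.commute)
  have cons: "\<bar>f z - reg_op \<eta> s ?e u z\<bar> \<le> c_cons * K powr ?p * c_pw K ?p * R * ?d powr (- 2 * s)"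
  proof -
    have "?e powr (\<beta> - 2 * s) = (?h * ?d / 4) powr ?p" using ep(3)[of ?p] by simp
    also have "\<dots> \<le> (K * (h * ?d powr \<tau>) * ?d) powr ?p"
    proof (rule powr_mono2)
      have "?h * ?d / 4 \<le> ?h * ?d" using ep(4) d by simp
      also have "\<dots> \<le> K * (h * ?d powr \<tau>) * ?d" using hz d by (intro mult_right_mono) auto
      finally show "?h * ?d / 4 \<le> K * (h * ?d powr \<tau>) * ?d" .
    qed (use p ep(4) d in auto)
    also have "\<dots> = K powr ?p * (h powr ?p * (?d powr (\<tau> * ?p) * ?d powr ?p))"
      by (simp only: powr_mult powr_powr mult.assoc)
    finally have "c_cons * ?e powr (\<beta> - 2 * s) * ?d powr (s - \<beta>)
      \<le> c_cons * (K powr ?p * (h powr ?p * (?d powr (\<tau> * ?p) * ?d powr ?p))) * ?d powr (s - \<beta>)"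
      using c_cons_nonneg by (intro mult_right_mono mult_left_mono) auto
    also have "\<dots> = c_cons * K powr ?p * (h powr ?p * (?d powr (\<tau> * ?p) * ?d powr ?p * ?d powr (s - \<beta>)))"
      by (simp only: mult_ac)
    also have "?d powr (\<tau> * ?p) * ?d powr ?p * ?d powr (s - \<beta>) = ?d powr (s - ?p / \<mu>) * ?d powr (- 2 * s)"
    proof -
      \<comment> \<open>With 2 p = \<beta> - 2s the exponents of \<delta>(z) add up to the one of
        \<open>power_rate\<close> and the weight -2s of the claim.\<close>
      have "\<tau> * ?p = ?p - ?p / \<mu>" using mu by (simp add: field_simps)
      then have "\<tau> * ?p + ?p + (s - \<beta>) = s - ?p / \<mu> + - 2 * s" by simp
      then show ?thesis unfolding powr_add[symmetric] by simp
    qed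
    also have "c_cons * K powr ?p * (h powr ?p * (?d powr (s - ?p / \<mu>) * ?d powr (- 2 * s)))
      = c_cons * K powr ?p * ?d powr (- 2 * s) * (h powr ?p * ?d powr (s - ?p / \<mu>))" by (simp only: mult_ac)
    also have "\<dots> \<le> c_cons * K powr ?p * ?d powr (- 2 * s) * (c_pw K ?p * R)"
    proof (rule mult_left_mono)
      show "h powr ?p * ?d powr (s - ?p / \<mu>) \<le> c_pw K ?p * R"
        using d bdist_le_L[OF zc] bdist_vertex_ge[OF z] K_ge(1) rate p by (intro power_rate[OF h_pos mu]) auto
    qed (use c_cons_nonneg in auto)
    finally show ?thesis using consistency[OF zO ep(1,2)] by (simp add: mult_ac)
  qed
  \<comment> \<open>A negative power of \<epsilon>, hence the lower bound for the vertex size is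
    used.\<close>
  have eps2: "?e powr (- 2 * s) \<le> (4 * K) powr s * h powr (- s) * ?d powr (s / \<mu>) * ?d powr (- 2 * s)"
  proof -
    have "?e powr (- 2 * s) = (?h * ?d / 4) powr (- s)" using ep(3)[of "- s"] by simp
    also have "\<dots> \<le> (h * ?d powr \<tau> / K * ?d / 4) powr (- s)"
    proof (rule powr_mono2')
      show "h * ?d powr \<tau> / K * ?d / 4 \<le> ?h * ?d / 4"
        using hz' d by (intro divide_right_mono mult_right_mono) auto
    qed (use h_pos d K_pos s01 in auto)
    also have "h * ?d powr \<tau> / K * ?d / 4 = h * (?d powr \<tau> * ?d) / (4 * K)" by simp
    also have "(h * (?d powr \<tau> * ?d) / (4 * K)) powr (- s) = (4 * K) powr s * h powr (- s) * (?d powr (- (\<tau> * s)) * ?d powr (- s))"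
    proof -
      have "(h * (?d powr \<tau> * ?d) / (4 * K)) powr (- s) = (h * (?d powr \<tau> * ?d)) powr (- s) * (1 / (4 * K) powr (- s))"
        using h_pos d K_pos by (simp add: powr_divide)
      also have "1 / (4 * K) powr (- s) = (4 * K) powr s" using powr_minus_divide[of "4 * K" "- s"] by simp
      also have "(h * (?d powr \<tau> * ?d)) powr (- s) = h powr (- s) * (?d powr (- (\<tau> * s)) * ?d powr (- s))"
        by (simp only: powr_mult powr_powr mult_minus_right)
      finally show ?thesis by (simp only: mult_ac)
    qed
    also have "?d powr (- (\<tau> * s)) * ?d powr (- s) = ?d powr (s / \<mu>) * ?d powr (- 2 * s)"
    proof -
      have "\<tau> * s = s - s / \<mu>" using mu by (simp add: field_simps)
      then have "- (\<tau> * s) + - s = s / \<mu> + - 2 * s" by simp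
      then show ?thesis by (simp only: powr_add[symmetric])
    qed
    finally show ?thesis by (simp only: mult.assoc)
  qed
  let ?Wn = "c_loc K * R * h powr s * ?d powr (- (s / \<mu>))"
  have wz: "w z = 0"
  proof -
    obtain T where T: "T \<in> \<T>" "z \<in> T" using interior_vertexD(2)[OF z] by blast
    show ?thesis using Iu(2)[OF T(1) interior_vertexD(3)[OF z T]] by simp
  qed
  have Im [measurable]: "Iu \<in> borel_measurable borel" by (rule fe_measurable[OF Iu(1)])
  obtain NI where NI: "\<And>y. \<bar>Iu y\<bar> \<le> NI" using fe_bounded[OF Iu(1)] by blast
  have wm: "w \<in> borel_measurable borel" by measurable
  \<comment> \<open>Near and far are separated at the radius \<delta>(z)/2, so the far part costs
    only \<delta>^(-2s).\<close>
  have "\<bar>reg_op \<eta> s ?e w z\<bar> \<le> Lam * (?Wn * cK * ?e powr (- 2 * s) + c_sup K * R * tail_const (- d - 2 * s) * (?d / 2) powr (- 2 * s))"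
    by (rule reg_op_bound[OF wm wz w_sup w_near[OF z] ep(1,2)])
  also have "\<dots> \<le> Lam * (c_loc K * cK * (4 * K) powr s * R * ?d powr (- 2 * s)
      + c_sup K * tail_const (- d - 2 * s) * (1 / 2) powr (- 2 * s) * R * ?d powr (- 2 * s))"
  proof (intro mult_left_mono add_mono)
    have Wn0: "0 \<le> ?Wn * cK" using c_loc_nonneg R_nonneg cK_nonneg by (intro mult_nonneg_nonneg) auto
    have "?Wn * cK * ?e powr (- 2 * s) \<le> ?Wn * cK * ((4 * K) powr s * h powr (- s) * ?d powr (s / \<mu>) * ?d powr (- 2 * s))"
      by (rule mult_left_mono[OF eps2 Wn0])
    also have "\<dots> = c_loc K * cK * (4 * K) powr s * R * ?d powr (- 2 * s) * (h powr s * h powr (- s)) * (?d powr (- (s / \<mu>)) * ?d powr (s / \<mu>))"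
      by (simp only: mult_ac)
    \<comment> \<open>The gain of the local interpolation bound cancels the excess in
      \<epsilon>^(-2s) exactly, powers of h and \<delta> alike.\<close>
    also have "h powr s * h powr (- s) = 1" using h_pos by (simp add: powr_add[symmetric])
    also have "?d powr (- (s / \<mu>)) * ?d powr (s / \<mu>) = 1" using d by (simp add: powr_add[symmetric])
    finally show "?Wn * cK * ?e powr (- 2 * s) \<le> c_loc K * cK * (4 * K) powr s * R * ?d powr (- 2 * s)" by simp
    have "(?d / 2) powr (- 2 * s) = (1 / 2) powr (- 2 * s) * ?d powr (- 2 * s)"
      using powr_mult[of "1 / 2" ?d "- 2 * s"] by simp
    then show "c_sup K * R * tail_const (- d - 2 * s) * (?d / 2) powr (- 2 * s)
      \<le> c_sup K * tail_const (- d - 2 * s) * (1 / 2) powr (- 2 * s) * R * ?d powr (- 2 * s)"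
      by (simp only: mult_ac)
  qed (use Lam0 in simp)
  finally have wb: "\<bar>reg_op \<eta> s ?e w z\<bar> \<le> Lam * (c_loc K * cK * (4 * K) powr s * R * ?d powr (- 2 * s)
      + c_sup K * tail_const (- d - 2 * s) * (1 / 2) powr (- 2 * s) * R * ?d powr (- 2 * s))" .
  have "reg_op \<eta> s ?e w z = reg_op \<eta> s ?e u z - reg_op \<eta> s ?e Iu z"
    by (rule reg_op_diff[OF u_meas Im u_bound NI ep(1)])
  then have "\<bar>reg_op \<eta> s ?e Iu z - f z\<bar> \<le> \<bar>f z - reg_op \<eta> s ?e u z\<bar> + \<bar>reg_op \<eta> s ?e w z\<bar>" by linarith
  also have "\<dots> \<le> c_cons * K powr ?p * c_pw K ?p * R * ?d powr (- 2 * s) +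
     Lam * (c_loc K * cK * (4 * K) powr s * R * ?d powr (- 2 * s)
      + c_sup K * tail_const (- d - 2 * s) * (1 / 2) powr (- 2 * s) * R * ?d powr (- 2 * s))"
    by (rule add_mono[OF cons wb])
  also have "\<dots> = c_res K * R * ?d powr (- 2 * s)" unfolding c_res_def by (simp only: distrib_right distrib_left mult.assoc)
  finally show ?thesis .
qed

text \<open>A one-sided bound; the two-sided estimate follows by applying it to the difference with
  either sign. The second alternative disposes of the points where \<open>v\<close> is not
  positive.\<close>

lemma fe_comparison:
  assumes v: "v \<in> fe_space \<Omega> \<T>"
    and res: "\<And>z. z \<in> interior_vertices \<Omega> \<T> \<Longrightarrow> reg_op \<eta> s (eps_bar \<Omega> \<T> z) v z \<le> c_res K * R * bdist \<Omega> z powr (- 2 * s)"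
  shows "v x \<le> 2 * (c_res K * R) / cE \<or> v x \<le> 0"
proof (rule ccontr)
  assume neg: "\<not> ?thesis"
  let ?V = "interior_vertices \<Omega> \<T>"
  \<comment> \<open>Without interior vertices \<open>v\<close> would be at most 0 everywhere, by
    \<open>fe_le_vertices\<close> with bound 0.\<close>
  have "?V \<noteq> {}" using fe_le_vertices[OF v order_refl, of x] neg by force
  then have "Max (v ` ?V) \<in> v ` ?V" using finite_interior_vertices by (intro Max_in) auto
  then obtain z where z: "z \<in> ?V" "v z = Max (v ` ?V)" by auto
  have zmax: "v y \<le> v z" if "y \<in> ?V" for y
    using z(2) that finite_interior_vertices by simp
  have z0: "0 \<le> v z"
  proof (rule ccontr)
    assume "\<not> 0 \<le> v z"
    then have "v y \<le> 0" if "y \<in> ?V" for y using zmax[OF that] by linarith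
    then have "v x \<le> 0" by (rule fe_le_vertices[OF v order_refl])
    then show False using neg by blast
  qed
  have gmax: "v y \<le> v z" for y by (rule fe_le_vertices[OF v z0 zmax])
  obtain B where B: "\<And>y. \<bar>v y\<bar> \<le> B" using fe_bounded[OF v] by blast
  let ?d = "bdist \<Omega> z"
  have zO: "z \<in> \<Omega>" using interior_vertexD(1)[OF z(1)] .
  have d: "0 < ?d" using dpos[OF zO] .
  have out: "v y = 0" if "y \<notin> closure \<Omega>" for y
    using v that subsetD[OF closure_subset[of \<Omega>], of y] unfolding fe_space_def by blast
  have "v z * cE * ?d powr (- 2 * s) \<le> 2 * reg_op \<eta> s (eps_bar \<Omega> \<T> z) v z"
    using eps_bar_props(1,2)[OF z(1)] d
    by (intro maximum_principle[OF fe_measurable[OF v] B zO gmax z0 out]) auto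
  also have "\<dots> \<le> 2 * (c_res K * R * ?d powr (- 2 * s))" using res[OF z(1)] by simp
  finally have "v z * cE * ?d powr (- 2 * s) \<le> 2 * (c_res K * R) * ?d powr (- 2 * s)" by simp
  then have "v z * cE \<le> 2 * (c_res K * R)" using d by (simp add: mult_le_cancel_right)
  then have "v z \<le> 2 * (c_res K * R) / cE" using cE_pos by (simp add: pos_le_divide_eq)
  then show False using gmax[of x] neg by simp
qed

lemma c_res_nonneg: "0 \<le> c_res K"
  unfolding c_res_def using c_cons_nonneg c_pw_nonneg Lam0 c_loc_nonneg c_sup_nonneg cK_nonneg
    consts_nonneg(2)[of "- d - 2 * s"] s01
  by (intro add_nonneg_nonneg mult_nonneg_nonneg) auto

theorem error_estimate: "\<bar>u x - uh x\<bar> \<le> c_total K * R"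
proof -
  have Im: "Iu \<in> borel_measurable borel" "uh \<in> borel_measurable borel"
    using fe_measurable Iu(1) uh by auto
  obtain NI where NI: "\<And>y. \<bar>Iu y\<bar> \<le> NI" using fe_bounded[OF Iu(1)] by blast
  obtain NU where NU: "\<And>y. \<bar>uh y\<bar> \<le> NU" using fe_bounded[OF uh] by blast
  have r: "\<bar>reg_op \<eta> s (eps_bar \<Omega> \<T> z) Iu z - reg_op \<eta> s (eps_bar \<Omega> \<T> z) uh z\<bar> \<le> c_res K * R * bdist \<Omega> z powr (- 2 * s)"
    if "z \<in> interior_vertices \<Omega> \<T>" for z using residual[OF that] scheme[OF that] by simp
  let ?C = "2 * (c_res K * R) / cE"
  have C: "0 \<le> ?C" using c_res_nonneg R_nonneg cE_pos by simp
  have "Iu x - uh x \<le> ?C \<or> Iu x - uh x \<le> 0"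
  proof (rule fe_comparison[OF fe_space_diff[OF Iu(1) uh]])
    fix z assume z: "z \<in> interior_vertices \<Omega> \<T>"
    show "reg_op \<eta> s (eps_bar \<Omega> \<T> z) (\<lambda>x. Iu x - uh x) z \<le> c_res K * R * bdist \<Omega> z powr (- 2 * s)"
      unfolding reg_op_diff[OF Im NI NU eps_bar_props(1)[OF z]] using r[OF z] by linarith
  qed
  moreover have "uh x - Iu x \<le> ?C \<or> uh x - Iu x \<le> 0"
  proof (rule fe_comparison[OF fe_space_diff[OF uh Iu(1)]])
    fix z assume z: "z \<in> interior_vertices \<Omega> \<T>"
    show "reg_op \<eta> s (eps_bar \<Omega> \<T> z) (\<lambda>x. uh x - Iu x) z \<le> c_res K * R * bdist \<Omega> z powr (- 2 * s)"
      unfolding reg_op_diff[OF Im(2,1) NU NI eps_bar_props(1)[OF z]] using r[OF z] by linarith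
  qed
  ultimately have "\<bar>Iu x - uh x\<bar> \<le> ?C" using C by linarith
  then have "\<bar>u x - uh x\<bar> \<le> c_sup K * R + ?C" using w_sup[of x] by linarith
  also have "\<dots> = c_total K * R" unfolding c_total_def by (simp add: distrib_right)
  finally show ?thesis .
qed

end

section \<open>From the norms of the statement to real constants, and conclusion\<close>

lemma hoelder_norm_pair_le:
  assumes "hoelder_norm b A f \<le> c" "x \<in> A" "y \<in> A" "x \<noteq> y"
  shows "ennreal (deriv_dist (hoelder_int b) f x y / norm (x - y) powr hoelder_frac b) \<le> c"
proof -
  let ?F = "\<lambda>(x, y). ennreal (deriv_dist (hoelder_int b) f x y / norm (x - y) powr hoelder_frac b)"
  have "?F (x, y) \<le> (SUP p\<in>{(x, y). x \<in> A \<and> y \<in> A \<and> x \<noteq> y}. ?F p)"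
    using assms by (intro SUP_upper) auto
  also have "\<dots> \<le> hoelder_norm b A f" unfolding hoelder_norm_def by (simp add: add_increasing)
  finally show ?thesis using assms(1) by simp
qed

lemma hoelder_norm_deriv_le:
  assumes "x \<in> A" "l \<le> hoelder_int b"
  shows "ennreal (deriv_norm l f x) \<le> hoelder_norm b A f"
proof -
  have "ennreal (deriv_norm l f x) \<le> (SUP x\<in>A. ennreal (deriv_norm l f x))"
    using assms(1) by (intro SUP_upper)
  also have "\<dots> \<le> (\<Sum>l\<le>hoelder_int b. SUP x\<in>A. ennreal (deriv_norm l f x))"
    using assms(2) member_le_sum[of l "{..hoelder_int b}" "\<lambda>l. SUP x\<in>A. ennreal (deriv_norm l f x)"] by simp
  also have "\<dots> \<le> hoelder_norm b A f" unfolding hoelder_norm_def by (simp add: add_increasing2)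
  finally show ?thesis .
qed

lemma le_enn2real:
  assumes "X < \<infinity>" "ennreal q \<le> X"
  shows "q \<le> enn2real X"
proof -
  have "ennreal q \<le> ennreal (enn2real X)" using assms by simp
  then show ?thesis by (simp add: ennreal_le_iff)
qed

lemma deriv_dist_self [simp]: "deriv_dist k f x x = 0"
  by (simp add: deriv_dist_def L2_set_def)

lemma deriv_dist_0: "deriv_dist 0 f x y = \<bar>f x - f y\<bar>"
  by (simp add: deriv_dist_def)

lemma deriv_norm_0: "deriv_norm 0 f x = \<bar>f x\<bar>"
  by (simp add: deriv_norm_def)

text \<open>The inball diameter of a simplex is nonnegative. Together with
  \<open>graded_mono\<close> this allows both mesh constants to be raised to at least 1.\<close>

lemma shape_regular_mono:
  assumes "mesh_of \<Omega> \<T>" "shape_regular \<sigma> \<T>" "\<sigma> \<le> \<sigma>'"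
  shows "shape_regular \<sigma>' (\<T> :: 'a::euclidean_space set set)"
  unfolding shape_regular_def
proof
  fix T assume T: "T \<in> \<T>"
  then have sx: "int DIM('a) simplex T" using assms(1) by (simp add: mesh_of_def)
  have "aff_dim T = int DIM('a)" by (rule aff_dim_simplex[OF sx])
  then have "T \<noteq> {}" by (auto simp: aff_dim_empty)
  moreover have "bounded T" using simplexD[OF sx] compact_imp_bounded by blast
  ultimately have "0 \<le> inball_diam T" by (intro inball_diam_nonneg)
  then have "\<sigma> * inball_diam T \<le> \<sigma>' * inball_diam T" using assms(3) by (intro mult_right_mono)
  then show "diameter T \<le> \<sigma>' * inball_diam T" using assms(2) T unfolding shape_regular_def by force
qed

lemma graded_mono:
  assumes "mesh_of \<Omega> \<T>" "graded \<Omega> \<kappa> \<mu> h \<T>" "\<kappa> \<le> \<kappa>'" "0 < h"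
  shows "graded \<Omega> \<kappa>' \<mu> h (\<T> :: 'a::euclidean_space set set)"
  unfolding graded_def Let_def
proof
  fix T assume T: "T \<in> \<T>"
  define G where "G = (if T \<inter> frontier \<Omega> \<noteq> {} then h powr \<mu> else h * setdist T (frontier \<Omega>) powr ((\<mu> - 1) / \<mu>))"
  have G: "G \<le> \<kappa> * diameter T" "diameter T \<le> \<kappa> * G"
    using assms(2) T unfolding graded_def Let_def G_def by blast+
  have sx: "int DIM('a) simplex T" using assms(1) T by (simp add: mesh_of_def)
  have "bounded T" using simplexD[OF sx] compact_imp_bounded by blast
  then have "\<kappa> * diameter T \<le> \<kappa>' * diameter T"
    using assms(3) by (intro mult_right_mono diameter_ge_0)
  moreover have "0 \<le> G" using assms(4) by (simp add: G_def)
  then have "\<kappa> * G \<le> \<kappa>' * G" using assms(3) by (intro mult_right_mono)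
  ultimately show "(if T \<inter> frontier \<Omega> \<noteq> {} then h powr \<mu> else h * setdist T (frontier \<Omega>) powr ((\<mu> - 1) / \<mu>)) \<le> \<kappa>' * diameter T \<and>
    diameter T \<le> \<kappa>' * (if T \<inter> frontier \<Omega> \<noteq> {} then h powr \<mu> else h * setdist T (frontier \<Omega>) powr ((\<mu> - 1) / \<mu>))"
    unfolding G_def[symmetric] using G by linarith
qed

lemma class_S_weighted_hoelder:
  fixes u :: "'a::euclidean_space \<Rightarrow> real"
  assumes \<Omega>: "open \<Omega>" "convex \<Omega>" "bounded \<Omega>"
    and s: "0 < s" "s < 1" and \<beta>: "\<beta> \<le> 4" "2 * s < \<beta>" "\<beta> \<notin> \<nat>" and u: "u \<in> class_S s \<beta> \<Omega>"
  obtains M N where "weighted_hoelder \<Omega> u s \<beta> M N" "\<And>x. x \<in> closure \<Omega> \<Longrightarrow> \<bar>u x\<bar> \<le> N"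
proof -
  have b4: "\<beta> < 4"
  proof -
    \<comment> \<open>Noninteger \<beta> makes the upper bound strict, which the cancellation of
      Taylor terms relies on.\<close>
    have "\<beta> \<noteq> 4" using \<beta>(3) by (metis of_nat_in_Nats of_nat_numeral)
    then show ?thesis using \<beta>(1) by simp
  qed
  obtain M where M: "\<And>\<rho>. \<rho> > 0 \<Longrightarrow> hoelder_norm \<beta> {x\<in>\<Omega>. bdist \<Omega> x \<ge> \<rho>} u \<le> ennreal (M * \<rho> powr (s - \<beta>))"
    and loc: "hoelder_loc \<beta> \<Omega> u" and fin: "hoelder_norm s (closure \<Omega>) u < \<infinity>"
    using u unfolding class_S_def by blast
  define N where "N = enn2real (hoelder_norm s (closure \<Omega>) u)"
  \<comment> \<open>For exponents below 1 the Hoelder norm has integer part 0, so it controls only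
    values and their differences.\<close>
  have "\<lceil>s\<rceil> = 1" using s by (intro ceiling_unique) auto
  then have hi: "hoelder_int s = 0" "hoelder_frac s = s" by (simp_all add: hoelder_int_def hoelder_frac_def)
  have bound: "\<bar>u x\<bar> \<le> N" if "x \<in> closure \<Omega>" for x
    using le_enn2real[OF fin, of "\<bar>u x\<bar>"] hoelder_norm_deriv_le[OF that, of 0 s u] unfolding N_def deriv_norm_0 by simp
  \<comment> \<open>\<open>M\<close> may be negative, in which case \<open>ennreal\<close> reads the
    bound as 0.\<close>
  have "weighted_hoelder \<Omega> u s \<beta> (max M 0) N"
  proof
    show "open \<Omega>" "bounded \<Omega>" "convex \<Omega>" "0 < s" "s < 1" "2 * s < \<beta>" "\<beta> < 4" "\<beta> \<notin> \<nat>" "0 \<le> max M 0" "0 \<le> N"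
      using \<Omega> s \<beta> b4 by (auto simp: N_def)
    show "Ck_on (hoelder_int \<beta>) \<Omega> u" using loc by (simp add: hoelder_loc_def)
    fix \<rho> x x' assume A: "0 < \<rho>" "x \<in> \<Omega>" "x' \<in> \<Omega>" "\<rho> \<le> bdist \<Omega> x" "\<rho> \<le> bdist \<Omega> x'"
    show "deriv_dist (hoelder_int \<beta>) u x x' \<le> max M 0 * \<rho> powr (s - \<beta>) * norm (x - x') powr hoelder_frac \<beta>"
    proof (cases "x = x'")
      case False
      have "ennreal (deriv_dist (hoelder_int \<beta>) u x x' / norm (x - x') powr hoelder_frac \<beta>) \<le> ennreal (M * \<rho> powr (s - \<beta>))"
        using A False by (intro hoelder_norm_pair_le[OF M]) auto
      also have "\<dots> \<le> ennreal (max M 0 * \<rho> powr (s - \<beta>))"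
        by (intro ennreal_leI mult_right_mono) auto
      finally have "deriv_dist (hoelder_int \<beta>) u x x' / norm (x - x') powr hoelder_frac \<beta> \<le> max M 0 * \<rho> powr (s - \<beta>)"
        by (subst (asm) ennreal_le_iff) auto
      then show ?thesis using False by (simp add: pos_divide_le_eq)
    qed simp
  next
    fix x x' assume A: "x \<in> closure \<Omega>" "x' \<in> closure \<Omega>"
    show "\<bar>u x - u x'\<bar> \<le> N * norm (x - x') powr s"
    proof (cases "x = x'")
      case False
      have "\<bar>u x - u x'\<bar> / norm (x - x') powr s \<le> N"
        using le_enn2real[OF fin] hoelder_norm_pair_le[OF order_refl A False, of s u]
        unfolding N_def hi deriv_dist_0 by blast
      then show ?thesis using False by (simp add: pos_divide_le_eq)
    qed simp
  qed
  then show ?thesis using that bound by blast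
qed

theorem theorem4p8:
  fixes \<Omega> :: "'a::euclidean_space set" and s \<beta> lam Lam \<mu> \<sigma> \<kappa> :: real
    and \<eta> f u :: "'a \<Rightarrow> real"
  assumes "open_convex_polytope \<Omega>"
    and "0 < s" and "s < 1"
    and "\<beta> \<le> 4" and "2 * s < \<beta>" and "\<beta> \<notin> \<nat>" and "\<beta> - 2 * s \<notin> \<nat>"
    and "hoelder_loc (\<beta> - 2 * s) \<Omega> f" and "Linf_norm \<Omega> f < \<infinity>"
    and "weighted_norm s (\<beta> - 2 * s) \<Omega> f < \<infinity>"
    and "0 < lam" and "lam \<le> Lam" and "\<eta> \<in> kernel_class lam Lam"
    and "\<And>k::nat. k \<ge> 1 \<Longrightarrow> real k < \<beta> \<Longrightarrow> Ck_sphere k \<eta>"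
    and "u \<in> class_S s \<beta> \<Omega>"
    and "\<And>x. x \<in> \<Omega> \<Longrightarrow> has_frac_op \<eta> s u x (f x)"
    and "\<And>x. x \<in> - closure \<Omega> \<Longrightarrow> u x = 0"
    and "\<mu> \<ge> 1"
  shows "\<exists>C::real. \<forall>(h::real) (\<T>::'a set set) (uh::'a \<Rightarrow> real).
    h > 0 \<and> mesh_of \<Omega> \<T> \<and> shape_regular \<sigma> \<T> \<and> graded \<Omega> \<kappa> \<mu> h \<T> \<and>
    uh \<in> fe_space \<Omega> \<T> \<and>
    (\<forall>z\<in>interior_vertices \<Omega> \<T>. reg_op \<eta> s (eps_bar \<Omega> \<T> z) uh z = f z) \<longrightarrow>
    Linf_norm \<Omega> (\<lambda>x. u x - uh x)
      \<le> ennreal (C * Max {h powr (\<mu> * s), h powr (min \<beta> 2 - s), h powr (\<beta> / 2 - s)})"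
proof -
  obtain P where P: "polytope P" "\<Omega> = interior P" "\<Omega> \<noteq> {}"
    using assms(1) unfolding open_convex_polytope_def by blast
  have dom: "open \<Omega>" "convex \<Omega>" "bounded \<Omega>" "\<Omega> \<noteq> {}"
    using P polytope_imp_convex[OF P(1)] bounded_subset[OF polytope_imp_bounded[OF P(1)] interior_subset]
    by (simp_all add: convex_interior)
  obtain M N where MN: "weighted_hoelder \<Omega> u s \<beta> M N" and bound: "\<And>x. x \<in> closure \<Omega> \<Longrightarrow> \<bar>u x\<bar> \<le> N"
    using class_S_weighted_hoelder[OF dom(1-3) assms(2-6,15)] by blast
  obtain g where g: "g \<in> borel_measurable borel" "\<And>y. lam \<le> g y" "\<And>y. g y \<le> Lam"
    "\<And>c y. c > 0 \<Longrightarrow> g (c *\<^sub>R y) = g y" "\<And>y. g (- y) = g y" "negligible {y. \<eta> (sgn y) \<noteq> g y}"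
    using kernel_class_representative[OF assms(13,12)] by blast
  interpret wh: weighted_hoelder \<Omega> u s \<beta> M N by (rule MN)
  interpret hk: homogeneous_kernel g \<eta> lam Lam s "real DIM('a)"
    by standard (use g assms(2,3,11) in auto)
  \<comment> \<open>The zeroth-order term of the weighted norm, which limits the growth of
    \<open>f\<close> to \<delta>^(-s).\<close>
  define W where "W = (SUP x\<in>\<Omega>. ennreal (bdist \<Omega> x powr s * \<bar>f x\<bar>))"
  have "W \<le> weighted_norm s (\<beta> - 2 * s) \<Omega> f"
    unfolding weighted_norm_def W_def by (simp add: add_increasing2)
  then have W: "W < \<infinity>" using assms(10) by (rule le_less_trans)
  have uN: "\<bar>u x\<bar> \<le> N" for x
    using bound[of x] assms(17)[of x] wh.N0 by (cases "x \<in> closure \<Omega>") auto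
  interpret fp: fractional_problem \<Omega> u s \<beta> M N g \<eta> lam Lam "real DIM('a)" f "enn2real W"
  proof
    show "\<Omega> \<noteq> {}" "\<bar>u x\<bar> \<le> N" "0 \<le> enn2real W" for x using dom uN by auto
    show "u x = 0" if "x \<notin> closure \<Omega>" for x using assms(17) that by simp
    fix x assume x: "x \<in> \<Omega>"
    show "has_frac_op \<eta> s u x (f x)" by (rule assms(16)[OF x])
    show "bdist \<Omega> x powr s * \<bar>f x\<bar> \<le> enn2real W"
      by (rule le_enn2real[OF W]) (use x in \<open>auto simp: W_def intro: SUP_upper\<close>)
  qed
  \<comment> \<open>The constant is formed from these before \<open>h\<close>, the mesh and
    \<open>uh\<close> are chosen.\<close>
  let ?\<sigma> = "max \<sigma> 1" and ?\<kappa> = "max \<kappa> 1"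
  let ?R = "\<lambda>h. Max {h powr (\<mu> * s), h powr (min \<beta> 2 - s), h powr (\<beta> / 2 - s)}"
  have "Linf_norm \<Omega> (\<lambda>x. u x - uh x) \<le> ennreal (fp.c_total (mesh_const ?\<sigma> ?\<kappa> \<mu>) * ?R h)"
    if h: "h > 0" and mesh: "mesh_of \<Omega> \<T>" and shape: "shape_regular \<sigma> \<T>" and grad: "graded \<Omega> \<kappa> \<mu> h \<T>"
      and uh: "uh \<in> fe_space \<Omega> \<T>"
      and sch: "\<forall>z\<in>interior_vertices \<Omega> \<T>. reg_op \<eta> s (eps_bar \<Omega> \<T> z) uh z = f z"
    for h \<T> uh
  proof -
    interpret dp: discrete_problem \<Omega> u s \<beta> M N g \<eta> lam Lam "real DIM('a)" f "enn2real W" \<T> ?\<sigma> ?\<kappa> \<mu> h uh "?R h"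
    proof
      show "convex \<Omega>" "bounded \<Omega>" "open \<Omega>" "\<Omega> \<noteq> {}" by fact+
      show "mesh_of \<Omega> \<T>" "h > 0" "uh \<in> fe_space \<Omega> \<T>" "\<mu> \<ge> 1" by fact+
      show "?\<sigma> \<ge> 1" "?\<kappa> \<ge> 1" by simp_all
      show "shape_regular ?\<sigma> \<T>" by (rule shape_regular_mono[OF mesh shape]) simp
      show "graded \<Omega> ?\<kappa> \<mu> h \<T>" by (rule graded_mono[OF mesh grad _ h]) simp
      show "reg_op \<eta> s (eps_bar \<Omega> \<T> z) uh z = f z" if "z \<in> interior_vertices \<Omega> \<T>" for z
        using sch that by blast
      show "h powr (\<mu> * s) \<le> ?R h" "h powr (min \<beta> 2 - s) \<le> ?R h" "h powr (\<beta> / 2 - s) \<le> ?R h"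
        by (simp_all add: Max_ge)
    qed
    have [measurable]: "uh \<in> borel_measurable borel" by (rule dp.fe_measurable[OF uh])
    have [measurable]: "u \<in> borel_measurable borel" by (rule fp.u_meas)
    \<comment> \<open>Measurability is part of the claim, since the essential supremum of a
      nonmeasurable function is infinite; the bound itself holds at every point.\<close>
    have "(\<lambda>x. ennreal \<bar>u x - uh x\<bar>) \<in> borel_measurable lborel" by measurable
    then have "(\<lambda>x. ennreal \<bar>u x - uh x\<bar>) \<in> borel_measurable (restrict_space lebesgue \<Omega>)"
      by (intro measurable_restrict_space1 measurable_completion)
    then show ?thesis
      unfolding Linf_norm_def using dp.error_estimate by (intro esssup_I) (auto intro: ennreal_leI)
  qed
  then show ?thesis by blast
qed

end
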